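(* Let $G$ be a $PI$-group which is a nil-group. Then $G$ is locally nilpotent.
   Context: The words $e_n(x,y)$ in the free group on $x,y$ are defined by $e_1(x,y)=[x,y]$ and $e_n(x,y)=[e_{n-1}(x,y),y]$ for $n\ge 2$, where $[x,y]$ denotes the group commutator (with one fixed standard convention, say $[x,y]=x^{-1}y^{-1}xy$). An element $g$ of a group $G$ is a nil-element if for every $a\in G$ there is $n=n(a,g)\ge 1$ with $e_n(a,g)=1$. A group is a nil-group if each of its elements is a nil-element. A group $G$ is a $PI$-group if there exist a field $P$ and an associative algebra $A$ with $1$ over $P$ satisfying a nontrivial polynomial identity (a $PI$-algebra) such that $G$ is isomorphic to a subgroup of the group of invertible elements of $A$. A group is locally nilpotent if each of its finitely generated subgroups is nilpotent. *)

theory Defs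
  imports "HOL-Algebra.Algebra"
begin

definition comm :: "('g, 'x) monoid_scheme \<Rightarrow> 'g \<Rightarrow> 'g \<Rightarrow> 'g" where
  "comm G x y = inv\<^bsub>G\<^esub> x \<otimes>\<^bsub>G\<^esub> inv\<^bsub>G\<^esub> y \<otimes>\<^bsub>G\<^esub> x \<otimes>\<^bsub>G\<^esub> y"

text \<open>The value of the word \<open>e_n\<close> at \<open>x, y\<close>. The recursion starts with the conventional
  \<open>e_0(x, y) = x\<close>, so that \<open>e_1(x, y) = [x, y]\<close>.\<close>

primrec engel :: "('g, 'x) monoid_scheme \<Rightarrow> nat \<Rightarrow> 'g \<Rightarrow> 'g \<Rightarrow> 'g" where
  "engel G 0 x y = x"
| "engel G (Suc n) x y = comm G (engel G n x y) y"

definition nil_element :: "('g, 'x) monoid_scheme \<Rightarrow> 'g \<Rightarrow> bool" where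
  "nil_element G g \<longleftrightarrow> g \<in> carrier G \<and> (\<forall>a \<in> carrier G. \<exists>n\<ge>1. engel G n a g = \<one>\<^bsub>G\<^esub>)"

definition nil_group :: "('g, 'x) monoid_scheme \<Rightarrow> bool" where
  "nil_group G \<longleftrightarrow> group G \<and> (\<forall>g \<in> carrier G. nil_element G g)"

primrec lower_central :: "('g, 'x) monoid_scheme \<Rightarrow> nat \<Rightarrow> 'g set" where
  "lower_central G 0 = carrier G"
| "lower_central G (Suc n) =
     generate G {comm G x y | x y. x \<in> lower_central G n \<and> y \<in> carrier G}"

definition nilpotent_group :: "('g, 'x) monoid_scheme \<Rightarrow> bool" where
  "nilpotent_group G \<longleftrightarrow> group G \<and> (\<exists>n. lower_central G n = {\<one>\<^bsub>G\<^esub>})"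

definition locally_nilpotent :: "('g, 'x) monoid_scheme \<Rightarrow> bool" where
  "locally_nilpotent G \<longleftrightarrow> group G \<and>
     (\<forall>S. finite S \<and> S \<subseteq> carrier G \<longrightarrow> nilpotent_group (G\<lparr>carrier := generate G S\<rparr>))"

text \<open>The locale \<open>algebra\<close> of HOL-Algebra requires the algebra to be commutative.\<close>

locale assoc_algebra = module P A + P?: field P + A?: ring A
  for P (structure) and A (structure) +
  assumes smult_mult_left: "\<lbrakk>c \<in> carrier P; x \<in> carrier A; y \<in> carrier A\<rbrakk> \<Longrightarrow>
      (c \<odot>\<^bsub>A\<^esub> x) \<otimes>\<^bsub>A\<^esub> y = c \<odot>\<^bsub>A\<^esub> (x \<otimes>\<^bsub>A\<^esub> y)"
    and smult_mult_right: "\<lbrakk>c \<in> carrier P; x \<in> carrier A; y \<in> carrier A\<rbrakk> \<Longrightarrow>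
      x \<otimes>\<^bsub>A\<^esub> (c \<odot>\<^bsub>A\<^esub> y) = c \<odot>\<^bsub>A\<^esub> (x \<otimes>\<^bsub>A\<^esub> y)"

text \<open>Elements of the free unital associative algebra over \<open>P\<close> on the noncommuting variables
  \<open>X_0, X_1, \<dots>\<close> are given by their coefficients: the word \<open>[i, j, \<dots>]\<close> stands for the monomial
  \<open>X_i X_j \<cdots>\<close> and the empty word for \<open>1\<close>.\<close>

definition nc_support :: "('p, 'r) ring_scheme \<Rightarrow> (nat list \<Rightarrow> 'p) \<Rightarrow> nat list set" where
  "nc_support P f = {w. f w \<noteq> \<zero>\<^bsub>P\<^esub>}"

definition nc_polys :: "('p, 'r) ring_scheme \<Rightarrow> (nat list \<Rightarrow> 'p) set" where
  "nc_polys P = {f. range f \<subseteq> carrier P \<and> finite (nc_support P f)}"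

definition nc_monom_eval :: "('a, 'm) monoid_scheme \<Rightarrow> (nat \<Rightarrow> 'a) \<Rightarrow> nat list \<Rightarrow> 'a" where
  "nc_monom_eval A s w = foldr (\<lambda>i r. s i \<otimes>\<^bsub>A\<^esub> r) w \<one>\<^bsub>A\<^esub>"

definition nc_eval ::
  "('p, 'r) ring_scheme \<Rightarrow> ('p, 'a, 'm) module_scheme \<Rightarrow> (nat list \<Rightarrow> 'p) \<Rightarrow> (nat \<Rightarrow> 'a) \<Rightarrow> 'a" where
  "nc_eval P A f s = (\<Oplus>\<^bsub>A\<^esub>w\<in>nc_support P f. f w \<odot>\<^bsub>A\<^esub> nc_monom_eval A s w)"

definition PI_algebra :: "('p, 'r) ring_scheme \<Rightarrow> ('p, 'a, 'm) module_scheme \<Rightarrow> bool" where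
  "PI_algebra P A \<longleftrightarrow> assoc_algebra P A \<and>
     (\<exists>f \<in> nc_polys P. nc_support P f \<noteq> {} \<and>
        (\<forall>s. range s \<subseteq> carrier A \<longrightarrow> nc_eval P A f s = \<zero>\<^bsub>A\<^esub>))"

text \<open>HOL cannot quantify over types inside a formula, so the types carrying the field and the
  algebra are parameters. A theorem that assumes \<open>PI_group TYPE('p) TYPE('a) G\<close> for type
  variables \<open>'p\<close> and \<open>'a\<close> covers every choice of field and algebra.\<close>

definition PI_group :: "'p itself \<Rightarrow> 'a itself \<Rightarrow> ('g, 'x) monoid_scheme \<Rightarrow> bool" where
  "PI_group (TP :: 'p itself) (TA :: 'a itself) G \<longleftrightarrow> group G \<and>
     (\<exists>(P :: 'p ring) (A :: ('p, 'a) module) H. PI_algebra P A \<and>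
        subgroup H (units_of A) \<and> G \<cong> (units_of A)\<lparr>carrier := H\<rparr>)"

end

theory Submission
  imports Defs "HOL-Combinatorics.Multiset_Permutations" "HOL-Library.Poly_Mapping"
begin

text \<open>
  A finitely generated subgroup \<open>N\<close> generates, together with the coefficients of the identity, a
  finitely generated PI ring. Suppose that \<open>N\<close> is not nilpotent. The lower central terms of \<open>N\<close>
  are finitely generated as normal subgroups, so Zorn's lemma yields an ideal \<open>Q\<close> maximal among
  those modulo which the image of \<open>N\<close> is not nilpotent. A finitely generated Engel group that is
  abelian-by-nilpotent is nilpotent, hence \<open>Q\<close> is prime, and it suffices to show that \<open>N\<close> is
  solvable modulo \<open>Q\<close>.

  A prime PI ring has no nonzero nil one-sided ideals, and Rabinowitsch's trick detects each
  element that is not nilpotent on a simple module of the polynomial ring. On such a module,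
  density and the identity bound the dimension over a maximal subfield of the endomorphism
  division ring; this subfield is finitely generated as a ring, so it is finite and so is the
  module. Thus \<open>N\<close> acts through a finite Engel group, which is nilpotent. Finally, if a nilpotent
  group acts and satisfies a multilinear identity of degree \<open>d\<close>, the centralizer of an element of
  the second centre satisfies one of degree \<open>d - 1\<close>, so the derived length of the action is at
  most \<open>2 d\<close>. The bound does not depend on the module, therefore \<open>N\<close> is solvable modulo \<open>Q\<close>.
\<close>

section \<open>Engel groups\<close>

text \<open>The Engel condition is not uniform and \<open>P\<close> may be infinite. Over a ring
  finitely generated over the integers the simple modules are finite, and a finite Engel group is
  nilpotent without any uniformity; but the class obtained in this way comes without a bound common
  to all modules. Derived length is the invariant that survives, because the degree \<open>d\<close>
  of the identity alone controls it. The constant \<open>2 * d\<close> splits into \<open>d\<close>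
  for the degree, which drops when the group is replaced by a centralizer, and \<open>d\<close> for
  the dimension over the maximal subfield, which is smaller than \<open>d\<close> and drops when a
  reducible module is split. Solvability is then turned back into nilpotency by a maximality
  argument, since no class can be computed. The simple modules are those of a polynomial ring
  because a ring element that annihilates all of them must be nilpotent; for an arbitrary ring its
  own simple modules do not give this.\<close>

context group
begin

section \<open>Commutators and Engel words\<close>

lemma comm_closed [simp]: "x \<in> carrier G \<Longrightarrow> y \<in> carrier G \<Longrightarrow> comm G x y \<in> carrier G"
  by (simp add: comm_def)

lemma inv_cancel1: "x \<in> carrier G \<Longrightarrow> y \<in> carrier G \<Longrightarrow> inv x \<otimes> (x \<otimes> y) = y"
  by (simp add: m_assoc[symmetric])

lemma inv_cancel2: "x \<in> carrier G \<Longrightarrow> y \<in> carrier G \<Longrightarrow> x \<otimes> (inv x \<otimes> y) = y"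
  by (simp add: m_assoc[symmetric])

text \<open>Right association, inverses of products and cancellation of neighbouring inverse letters
  bring both sides to reduced words, so an identity that holds in every group is settled by
  simplification.\<close>

lemmas free_simps = m_assoc inv_mult_group inv_cancel1 inv_cancel2

lemma comm_eq_one_iff:
  assumes "x \<in> carrier G" "y \<in> carrier G"
  shows "comm G x y = \<one> \<longleftrightarrow> x \<otimes> y = y \<otimes> x"
proof -
  have e: "x \<otimes> y = y \<otimes> x \<otimes> comm G x y" using assms by (simp add: comm_def free_simps)
  have "x \<otimes> y = y \<otimes> x" if "comm G x y = \<one>" using e that assms by simp
  moreover have "comm G x y = \<one>" if "x \<otimes> y = y \<otimes> x"
  proof -
    have "comm G x y = inv (y \<otimes> x) \<otimes> (x \<otimes> y)" using assms by (simp add: comm_def free_simps)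
    thus ?thesis using assms that by simp
  qed
  ultimately show ?thesis by blast
qed

lemma inv_comm_cancel:
  assumes "x \<in> carrier G" "y \<in> carrier G" "x \<otimes> y = y \<otimes> x"
  shows "inv x \<otimes> y = y \<otimes> inv x"
proof -
  have "inv x \<otimes> y = inv x \<otimes> (y \<otimes> x) \<otimes> inv x" using assms(1,2) by (simp add: m_assoc)
  also have "\<dots> = inv x \<otimes> (x \<otimes> y) \<otimes> inv x" by (simp only: assms(3))
  also have "\<dots> = y \<otimes> inv x" using assms(1,2) by (simp add: free_simps)
  finally show ?thesis .
qed

lemma comm_inv: "x \<in> carrier G \<Longrightarrow> y \<in> carrier G \<Longrightarrow> inv (comm G x y) = comm G y x"
  by (simp add: comm_def free_simps)

lemma engel_closed [simp]: "x \<in> carrier G \<Longrightarrow> y \<in> carrier G \<Longrightarrow> engel G n x y \<in> carrier G"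
  by (induct n) auto

text \<open>A sequence that starts outside \<open>N\<close> and reaches it has a step at which it
  enters. The term before that step is an element outside \<open>N\<close> whose commutator with
  \<open>t\<close> is in \<open>N\<close>; in the end this is the only way in which the Engel
  condition is exploited.\<close>

lemma engel_exit:
  assumes "x \<notin> N" "engel G m x t \<in> N"
  obtains k where "engel G k x t \<notin> N" "engel G (Suc k) x t \<in> N"
proof -
  have "\<exists>k. engel G k x t \<notin> N \<and> engel G (Suc k) x t \<in> N"
    using assms(2)
  proof (induct m)
    case 0 thus ?case using assms(1) by simp
  next
    case (Suc m) thus ?case by blast
  qed
  thus ?thesis using that by blast
qed

lemma subgroup_comm:
  assumes "subgroup H G" "x \<in> H" "y \<in> H" shows "comm G x y \<in> H"
  unfolding comm_def using assms by (simp add: subgroup.m_closed subgroup.m_inv_closed)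

lemma normal_comm:
  assumes "N \<lhd> G" "x \<in> N" "y \<in> carrier G" shows "comm G x y \<in> N" "comm G y x \<in> N"
proof -
  interpret normal N G by fact
  have "inv y \<otimes> x \<otimes> y \<in> N" using assms inv_op_closed1 by simp
  hence "inv x \<otimes> (inv y \<otimes> x \<otimes> y) \<in> N" using assms by simp
  thus 1: "comm G x y \<in> N" using assms by (simp add: comm_def m_assoc)
  have "inv (comm G x y) \<in> N" using 1 by simp
  thus "comm G y x \<in> N" using assms by (simp add: comm_inv)
qed

text \<open>Turns a membership condition into commutation in the quotient, so that facts about
  commuting elements carry over to commutators modulo \<open>N\<close> without commutator
  calculus.\<close>

lemma comm_in_normal_iff:
  assumes "N \<lhd> G" "x \<in> carrier G" "y \<in> carrier G"
  shows "comm G x y \<in> N \<longleftrightarrow>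
    (N #> x) \<otimes>\<^bsub>G Mod N\<^esub> (N #> y) = (N #> y) \<otimes>\<^bsub>G Mod N\<^esub> (N #> x)"
proof -
  interpret normal N G by fact
  have e: "x \<otimes> y = y \<otimes> x \<otimes> comm G x y" using assms by (simp add: comm_def free_simps)
  have "N #> (x \<otimes> y) = N #> (y \<otimes> x) \<longleftrightarrow> comm G x y \<in> N"
  proof
    assume "comm G x y \<in> N"
    hence "(y \<otimes> x) \<otimes> comm G x y \<otimes> inv (y \<otimes> x) \<in> N" using assms inv_op_closed2 by simp
    hence "x \<otimes> y \<otimes> inv (y \<otimes> x) \<in> N" using e by simp
    hence "N #> (x \<otimes> y \<otimes> inv (y \<otimes> x)) = N"
      using assms by (intro coset_join2[OF _ is_subgroup]) auto
    thus "N #> (x \<otimes> y) = N #> (y \<otimes> x)"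
      using assms subset by (intro coset_mult_inv1) auto
  next
    assume "N #> (x \<otimes> y) = N #> (y \<otimes> x)"
    hence "x \<otimes> y \<in> N #> (y \<otimes> x)" using assms(2,3) rcos_self[OF _ is_subgroup, of "x \<otimes> y"] by simp
    then obtain n where n: "n \<in> N" "x \<otimes> y = n \<otimes> (y \<otimes> x)" unfolding r_coset_def by auto
    have nc: "n \<in> carrier G" using n(1) subset by auto
    have "comm G x y = inv (y \<otimes> x) \<otimes> (x \<otimes> y)" using assms by (simp add: comm_def free_simps)
    also have "\<dots> = inv (y \<otimes> x) \<otimes> n \<otimes> (y \<otimes> x)" using n assms nc by (simp add: m_assoc)
    also have "\<dots> \<in> N" using inv_op_closed1[OF _ n(1)] assms by simp
    finally show "comm G x y \<in> N" .
  qed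
  thus ?thesis using assms by (simp add: FactGroup_def rcos_sum)
qed

section \<open>Centralizers modulo a normal subgroup\<close>

text \<open>For normal \<open>N\<close> this is the preimage of the centralizer of the image of
  \<open>Z\<close> in \<open>G Mod N\<close>. Staying inside \<open>G\<close> avoids iterated
  quotient groups.\<close>

definition centralizer_mod :: "'a set \<Rightarrow> 'a set \<Rightarrow> 'a set" where
  "centralizer_mod N Z = {x \<in> carrier G. \<forall>z\<in>Z. comm G x z \<in> N}"

lemma centralizer_mod_carrier: "centralizer_mod N Z \<subseteq> carrier G" by (auto simp: centralizer_mod_def)

lemma centralizer_mod_subgroup:
  assumes "N \<lhd> G" "Z \<subseteq> carrier G" shows "subgroup (centralizer_mod N Z) G"
proof -
  interpret normal N G by fact
  interpret Q: group "G Mod N" by (rule factorgroup_is_group)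
  interpret h: group_hom G "G Mod N" "\<lambda>a. N #> a"
    using r_coset_hom_Mod by unfold_locales
  show ?thesis
  proof (rule subgroupI)
    show "centralizer_mod N Z \<subseteq> carrier G" by (rule centralizer_mod_carrier)
    have "comm G \<one> z \<in> N" if "z \<in> Z" for z
      using that assms normal_comm(1)[OF assms(1) one_closed] by blast
    thus "centralizer_mod N Z \<noteq> {}" by (auto simp: centralizer_mod_def)
  next
    fix a assume a: "a \<in> centralizer_mod N Z"
    have "comm G (inv a) z \<in> N" if z: "z \<in> Z" for z
    proof -
      have c: "a \<in> carrier G" "z \<in> carrier G" using a z assms by (auto simp: centralizer_mod_def)
      have "(N #> a) \<otimes>\<^bsub>G Mod N\<^esub> (N #> z) = (N #> z) \<otimes>\<^bsub>G Mod N\<^esub> (N #> a)"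
        using a z c assms comm_in_normal_iff by (auto simp: centralizer_mod_def)
      hence "inv\<^bsub>G Mod N\<^esub> (N #> a) \<otimes>\<^bsub>G Mod N\<^esub> (N #> z) = (N #> z) \<otimes>\<^bsub>G Mod N\<^esub> inv\<^bsub>G Mod N\<^esub> (N #> a)"
        using c Q.inv_comm_cancel[of "N #> a" "N #> z"] h.hom_closed by blast
      thus ?thesis using c assms by (simp add: comm_in_normal_iff)
    qed
    thus "inv a \<in> centralizer_mod N Z" using a by (auto simp: centralizer_mod_def)
  next
    fix a b assume a: "a \<in> centralizer_mod N Z" and b: "b \<in> centralizer_mod N Z"
    have "comm G (a \<otimes> b) z \<in> N" if z: "z \<in> Z" for z
    proof -
      have c: "a \<in> carrier G" "z \<in> carrier G" "b \<in> carrier G" using a b z assms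
        by (auto simp: centralizer_mod_def)
      have "(N #> a) \<otimes>\<^bsub>G Mod N\<^esub> (N #> z) = (N #> z) \<otimes>\<^bsub>G Mod N\<^esub> (N #> a)"
           "(N #> b) \<otimes>\<^bsub>G Mod N\<^esub> (N #> z) = (N #> z) \<otimes>\<^bsub>G Mod N\<^esub> (N #> b)"
        using a b z c assms comm_in_normal_iff by (auto simp: centralizer_mod_def)
      hence "((N #> a) \<otimes>\<^bsub>G Mod N\<^esub> (N #> b)) \<otimes>\<^bsub>G Mod N\<^esub> (N #> z) =
        (N #> z) \<otimes>\<^bsub>G Mod N\<^esub> ((N #> a) \<otimes>\<^bsub>G Mod N\<^esub> (N #> b))"
        using c by (metis Q.m_assoc h.hom_closed)
      thus ?thesis using c assms by (simp add: comm_in_normal_iff)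
    qed
    thus "a \<otimes> b \<in> centralizer_mod N Z" using a b by (auto simp: centralizer_mod_def)
  qed
qed

lemma comm_mem_sym:
  assumes "N \<lhd> G" "x \<in> carrier G" "y \<in> carrier G" "comm G x y \<in> N"
  shows "comm G y x \<in> N"
  by (rule iffD2[OF comm_in_normal_iff[OF assms(1,3,2)]
        iffD1[OF comm_in_normal_iff[OF assms(1-3)] assms(4), symmetric]])

text \<open>Commutation modulo \<open>N\<close> is symmetric: if \<open>x\<close> commutes with
  \<open>Z\<close>, then \<open>Z\<close> lies in the centralizer of \<open>x\<close>, which is a
  subgroup and so contains all that \<open>Z\<close> generates.\<close>

lemma centralizer_mod_generate:
  assumes "N \<lhd> G" "Z \<subseteq> carrier G" shows "centralizer_mod N (generate G Z) = centralizer_mod N Z"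
proof
  show "centralizer_mod N (generate G Z) \<subseteq> centralizer_mod N Z"
    by (auto simp: centralizer_mod_def intro: generate.incl)
  show "centralizer_mod N Z \<subseteq> centralizer_mod N (generate G Z)"
  proof
    fix x assume x: "x \<in> centralizer_mod N Z"
    hence xc: "x \<in> carrier G" by (auto simp: centralizer_mod_def)
    have "Z \<subseteq> centralizer_mod N {x}"
      using x assms(2) by (auto simp: centralizer_mod_def intro: comm_mem_sym[OF assms(1)])
    hence "generate G Z \<subseteq> centralizer_mod N {x}"
      using centralizer_mod_subgroup[OF assms(1), of "{x}"] xc by (simp add: generate_subgroup_incl)
    thus "x \<in> centralizer_mod N (generate G Z)"
      using xc by (auto simp: centralizer_mod_def intro: comm_mem_sym[OF assms(1)])
  qed
qed

lemma conj_comm: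
  assumes "x \<in> carrier G" "y \<in> carrier G" "g \<in> carrier G"
  shows "g \<otimes> comm G x y \<otimes> inv g = comm G (g \<otimes> x \<otimes> inv g) (g \<otimes> y \<otimes> inv g)"
  using assms by (simp add: comm_def free_simps)

text \<open>Generating does not change the centralizer, so conjugates of \<open>Z\<close> need only
  lie in the subgroup generated by \<open>Z\<close>. A union of a lower central term with some
  elements of the preceding term is invariant in just this weaker sense.\<close>

lemma centralizer_mod_normal:
  assumes N: "N \<lhd> G" and Z: "Z \<subseteq> carrier G"
    and inv: "\<And>z g. z \<in> Z \<Longrightarrow> g \<in> carrier G \<Longrightarrow> g \<otimes> z \<otimes> inv g \<in> generate G Z"
  shows "centralizer_mod N Z \<lhd> G"
proof (rule normal_invI)
  show "subgroup (centralizer_mod N Z) G" by (rule centralizer_mod_subgroup[OF N Z])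
  fix g x assume g: "g \<in> carrier G" and x: "x \<in> centralizer_mod N Z"
  hence xc: "x \<in> carrier G" by (auto simp: centralizer_mod_def)
  have "comm G (g \<otimes> x \<otimes> inv g) z \<in> N" if z: "z \<in> Z" for z
  proof -
    have zc: "z \<in> carrier G" using z Z by auto
    define z' where "z' = inv g \<otimes> z \<otimes> g"
    have z'c: "z' \<in> carrier G" using zc g by (simp add: z'_def)
    have "z' \<in> generate G Z" using inv[OF z, of "inv g"] g by (simp add: z'_def)
    hence "comm G x z' \<in> N" using x centralizer_mod_generate[OF N Z]
      by (auto simp: centralizer_mod_def)
    hence "g \<otimes> comm G x z' \<otimes> inv g \<in> N" using N g by (simp add: normal_inv_iff)
    moreover have "g \<otimes> z' \<otimes> inv g = z" using zc g by (simp add: z'_def free_simps)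
    ultimately show ?thesis using conj_comm[OF xc z'c g] by simp
  qed
  moreover have "g \<otimes> x \<otimes> inv g \<in> carrier G" using g xc by simp
  ultimately show "g \<otimes> x \<otimes> inv g \<in> centralizer_mod N Z" unfolding centralizer_mod_def by blast
qed

lemma centralizer_mod_normal_normal:
  assumes "N \<lhd> G" "Z \<lhd> G" shows "centralizer_mod N Z \<lhd> G"
proof (rule centralizer_mod_normal[OF assms(1)])
  interpret Z: normal Z G by fact
  show "Z \<subseteq> carrier G" by (rule Z.subset)
  show "g \<otimes> z \<otimes> inv g \<in> generate G Z" if "z \<in> Z" "g \<in> carrier G" for z g
    using Z.inv_op_closed2[OF that(2,1)] by (rule generate.incl)
qed

lemma centralizer_mod_carrier_normal: "N \<lhd> G \<Longrightarrow> centralizer_mod N (carrier G) \<lhd> G"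
  by (simp add: centralizer_mod_normal_normal normal_self)

section \<open>The lower central series and abelian-by-nilpotent Engel groups\<close>

lemma lower_central_normal: "lower_central G n \<lhd> G"
proof (induct n)
  case 0 show ?case by (simp add: normal_self)
next
  case (Suc n)
  have s: "lower_central G n \<subseteq> carrier G" using Suc
    by (simp add: normal_imp_subgroup subgroup.subset)
  show ?case unfolding lower_central.simps
  proof (rule normal_generateI)
    show "{comm G x y |x y. x \<in> lower_central G n \<and> y \<in> carrier G} \<subseteq> carrier G" using s by auto
    fix h g assume "h \<in> {comm G x y |x y. x \<in> lower_central G n \<and> y \<in> carrier G}"
      and g: "g \<in> carrier G"
    then obtain x y where h: "h = comm G x y" "x \<in> lower_central G n" "y \<in> carrier G" by auto
    have "g \<otimes> x \<otimes> inv g \<in> lower_central G n" using Suc g h by (simp add: normal_inv_iff)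
    thus "g \<otimes> h \<otimes> inv g \<in> {comm G x y |x y. x \<in> lower_central G n \<and> y \<in> carrier G}"
      using conj_comm[of x y g] h g s by auto
  qed
qed

lemma lower_central_carrier: "lower_central G n \<subseteq> carrier G"
  using lower_central_normal by (simp add: normal_imp_subgroup subgroup.subset)

lemma lower_central_comm:
  "x \<in> lower_central G n \<Longrightarrow> y \<in> carrier G \<Longrightarrow> comm G x y \<in> lower_central G (Suc n)"
  by (auto intro: generate.incl)

lemma lower_central_Suc_subset: "lower_central G (Suc n) \<subseteq> lower_central G n"
  unfolding lower_central.simps
  by (rule generate_subgroup_incl) (auto simp: normal_imp_subgroup lower_central_normal intro:
    normal_comm)

text \<open>Trades the next term of the series for the current one, at the price of replacing
  \<open>N\<close> by the preimage of the centre of the quotient. Inductions along the series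
  therefore vary \<open>N\<close>.\<close>

lemma lower_central_Suc_subset_iff:
  assumes "N \<lhd> G"
  shows "lower_central G (Suc n) \<subseteq> N \<longleftrightarrow> lower_central G n \<subseteq> centralizer_mod N (carrier G)"
proof
  assume "lower_central G (Suc n) \<subseteq> N"
  thus "lower_central G n \<subseteq> centralizer_mod N (carrier G)"
    using lower_central_carrier lower_central_comm by (fastforce simp: centralizer_mod_def)
next
  assume "lower_central G n \<subseteq> centralizer_mod N (carrier G)"
  thus "lower_central G (Suc n) \<subseteq> N" unfolding lower_central.simps
    by (intro generate_subgroup_incl) (use assms in \<open>auto simp: centralizer_mod_def
      normal_imp_subgroup\<close>)
qed

text \<open>The left-normed commutators of weight \<open>n + 1\<close> in the generators. They are
  finitely many if \<open>S\<close> is finite, which no lower central term itself need be.\<close>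

primrec gen_comms :: "'a set \<Rightarrow> nat \<Rightarrow> 'a set" where
  "gen_comms S 0 = S"
| "gen_comms S (Suc n) = (\<lambda>(x, y). comm G x y) ` (gen_comms S n \<times> S)"

lemma gen_comms_finite: "finite S \<Longrightarrow> finite (gen_comms S n)"
  by (induct n) auto

lemma gen_comms_lower_central: "S \<subseteq> carrier G \<Longrightarrow> gen_comms S n \<subseteq> lower_central G n"
  by (induct n) (auto intro!: generate.incl)

text \<open>An element that commutes modulo \<open>N\<close> with the generators commutes with all
  of \<open>G\<close>. So the commutators of weight one less lie in the preimage of the centre, and
  the induction hypothesis applies to that normal subgroup.\<close>

lemma lower_central_subset_if_gen_comms:
  assumes "S \<subseteq> carrier G" "generate G S = carrier G" "N \<lhd> G" "gen_comms S n \<subseteq> N"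
  shows "lower_central G n \<subseteq> N"
  using assms(3,4)
proof (induct n arbitrary: N)
  case 0 thus ?case
    using assms by (simp add: generate_subgroup_incl[of S N,
      simplified assms(2)] normal_imp_subgroup)
next
  case (Suc n)
  have "gen_comms S n \<subseteq> centralizer_mod N S"
    using Suc(3) gen_comms_lower_central[OF assms(1), of n] lower_central_carrier[of n]
      by (auto simp: centralizer_mod_def)
  hence "gen_comms S n \<subseteq> centralizer_mod N (carrier G)"
    using centralizer_mod_generate[OF Suc(2) assms(1)] assms(2) by simp
  hence "lower_central G n \<subseteq> centralizer_mod N (carrier G)"
    using Suc centralizer_mod_carrier_normal by blast
  thus ?case using lower_central_Suc_subset_iff Suc by blast
qed

text \<open>The lower central terms of a finitely generated group are finitely generated as normal
  subgroups, so a normal subgroup containing none of them survives unions of chains.\<close>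

lemma normal_Union_chain:
  assumes "C \<noteq> {}" "\<And>N. N \<in> C \<Longrightarrow> N \<lhd> G" "subset.chain A C"
  shows "\<Union>C \<lhd> G"
proof (rule normal_invI)
  have cmp: "\<exists>N\<in>C. x \<in> N \<and> y \<in> N" if xy: "x \<in> \<Union>C" "y \<in> \<Union>C" for x y
  proof -
    obtain N N' where N: "N \<in> C" "x \<in> N" "N' \<in> C" "y \<in> N'" using xy by blast
    hence "N \<subseteq> N' \<or> N' \<subseteq> N" using assms(3) unfolding subset.chain_def by blast
    thus ?thesis using N by blast
  qed
  show "subgroup (\<Union>C) G"
  proof (rule subgroupI)
    show "\<Union>C \<subseteq> carrier G" using assms(2) by (meson Union_least normal_imp_subgroup subgroup.subset)
    obtain N where "N \<in> C" using assms(1) by auto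
    hence "\<one> \<in> \<Union>C" using assms(2)[THEN normal_imp_subgroup, THEN subgroup.one_closed] by auto
    thus "\<Union>C \<noteq> {}" by auto
    show "inv a \<in> \<Union>C" if "a \<in> \<Union>C" for a
      using that assms(2)[THEN normal_imp_subgroup, THEN subgroup.m_inv_closed] by blast
    show "a \<otimes> b \<in> \<Union>C" if "a \<in> \<Union>C" "b \<in> \<Union>C" for a b
      using cmp[OF that] assms(2) by (meson Union_iff normal_imp_subgroup subgroup.m_closed)
  qed
  show "g \<otimes> h \<otimes> inv g \<in> \<Union>C" if "g \<in> carrier G" "h \<in> \<Union>C" for g h
    using that assms(2) by (meson Union_iff normal_inv_iff)
qed

text \<open>Enlarge \<open>K\<close> to a normal subgroup \<open>N\<close> maximal among those below \<open>B\<close> that contain no lower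
  central term, and let \<open>i\<close> be least such that some element of \<open>B - N\<close> commutes modulo \<open>N\<close> with
  the \<open>i\<close>-th lower central term. If \<open>i = 0\<close>, then \<open>N\<close> can be enlarged. If \<open>i = j + 1\<close>, the Engel
  condition produces elements of \<open>B - N\<close> that also commute with the finitely many left-normed
  commutators generating the \<open>j\<close>-th term as a normal subgroup, against the choice of \<open>i\<close>.\<close>

lemma engel_abelian_by_nilpotent:
  assumes eng: "\<And>a b. a \<in> carrier G \<Longrightarrow> b \<in> carrier G \<Longrightarrow> \<exists>n. engel G n a b = \<one>"
    and S: "finite S" "S \<subseteq> carrier G" "generate G S = carrier G"
    and K: "K \<lhd> G" and B: "B \<lhd> G" and KB: "K \<subseteq> B"
    and ab: "\<And>x y. x \<in> B \<Longrightarrow> y \<in> B \<Longrightarrow> comm G x y \<in> K"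
    and nil: "lower_central G n \<subseteq> B"
  shows "\<exists>m. lower_central G m \<subseteq> K"
proof (rule ccontr)
  assume neg: "\<nexists>m. lower_central G m \<subseteq> K"
  define bad where "bad = {N. N \<lhd> G \<and> K \<subseteq> N \<and> N \<subseteq> B \<and> (\<forall>m. \<not> lower_central G m \<subseteq> N)}"
  have "\<exists>M\<in>bad. \<forall>L\<in>bad. M \<subseteq> L \<longrightarrow> L = M"
  proof (rule subset_Zorn_nonempty)
    show "bad \<noteq> {}" using neg K KB by (auto simp: bad_def)
    fix C assume Cc: "C \<noteq> {}" "subset.chain bad C"
    hence sub: "C \<subseteq> bad" by (auto simp: subset.chain_def)
    have "\<not> lower_central G m \<subseteq> \<Union>C" for m
    proof
      assume "lower_central G m \<subseteq> \<Union>C"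
      hence "gen_comms S m \<subseteq> \<Union>C" using gen_comms_lower_central[OF S(2)] by blast
      then obtain N where "N \<in> C" "gen_comms S m \<subseteq> N"
        using finite_subset_Union_chain[OF gen_comms_finite[OF S(1)] _ Cc] by blast
      moreover from this have "N \<lhd> G" "\<not> lower_central G m \<subseteq> N" using sub by (auto simp: bad_def)
      ultimately show False using lower_central_subset_if_gen_comms[OF S(2,3)] by blast
    qed
    moreover have "\<Union>C \<lhd> G" using normal_Union_chain[OF Cc(1) _ Cc(2)] sub by (auto simp: bad_def)
    moreover have "K \<subseteq> \<Union>C" "\<Union>C \<subseteq> B" using Cc(1) sub by (fastforce simp: bad_def)+
    ultimately show "\<Union>C \<in> bad" by (auto simp: bad_def)
  qed
  then obtain N where N: "N \<in> bad" and Nmax: "\<And>L. L \<in> bad \<Longrightarrow> N \<subseteq> L \<Longrightarrow> L = N" by auto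
  have Nn: "N \<lhd> G" and NB: "N \<subseteq> B" and KN: "K \<subseteq> N" and Nneg: "\<And>m. \<not> lower_central G m \<subseteq> N"
    using N by (auto simp: bad_def)
  have Bc: "B \<subseteq> carrier G" using B by (simp add: normal_imp_subgroup subgroup.subset)
  define Y where "Y i = B \<inter> centralizer_mod N (lower_central G i)" for i
  have Yn: "Y i \<lhd> G" for i
    unfolding Y_def using normal_subgroup_intersect[OF B centralizer_mod_normal_normal[OF Nn
      lower_central_normal]] .
  have NY: "N \<subseteq> Y i" for i
  proof
    fix x assume x: "x \<in> N"
    have "comm G x z \<in> N" if "z \<in> lower_central G i" for z
      using normal_comm(1)[OF Nn x] lower_central_carrier that by blast
    thus "x \<in> Y i" using x NB Bc by (auto simp: Y_def centralizer_mod_def)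
  qed
  \<comment> \<open>The \<open>n\<close>-th term lies in \<open>B\<close>, and \<open>B\<close> is
    abelian modulo \<open>K\<close>; so some index qualifies and a least one exists.\<close>
  have "Y n = B" using nil ab KN Bc by (auto simp: Y_def centralizer_mod_def)
  moreover have "B \<noteq> N" using nil Nneg by auto
  ultimately have ex: "\<exists>i. Y i \<noteq> N" by auto
  define i where "i = (LEAST i. Y i \<noteq> N)"
  have i: "Y i \<noteq> N" unfolding i_def using ex by (rule LeastI_ex)
  have imin: "Y j = N" if "j < i" for j using not_less_Least[of j] that unfolding i_def by blast
  show False
  proof (cases i)
    case 0
    \<comment> \<open>\<open>Y 0\<close> is contained in the preimage of the centre of the quotient
      by \<open>N\<close>. A lower central term inside \<open>Y 0\<close> thus puts the next one
      inside \<open>N\<close>.\<close>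
    have "Y 0 \<notin> bad" using Nmax[of "Y 0"] NY[of 0] i 0 by auto
    moreover have "K \<subseteq> Y 0" using KN NY[of 0] by blast
    moreover have "Y 0 \<subseteq> B" by (simp add: Y_def)
    ultimately obtain m where "lower_central G m \<subseteq> Y 0" using Yn[of 0] by (auto simp: bad_def)
    hence "lower_central G (Suc m) \<subseteq> N"
      using lower_central_Suc_subset_iff[OF Nn] by (auto simp: Y_def)
    thus False using Nneg by blast
  next
    case (Suc j)
    define T where "T = gen_comms S j"
    have Tl: "T \<subseteq> lower_central G j" unfolding T_def by (rule gen_comms_lower_central[OF S(2)])
    define W where "W T' = B \<inter> centralizer_mod N (lower_central G i \<union> T')" for T'
    have Wn: "W T' \<lhd> G" if T': "T' \<subseteq> T" for T'
    proof -
      let ?Z = "lower_central G i \<union> T'"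
      have Zc: "?Z \<subseteq> carrier G" using lower_central_carrier Tl T' by blast
      have "centralizer_mod N ?Z \<lhd> G"
      proof (rule centralizer_mod_normal[OF Nn Zc])
        fix z g assume z: "z \<in> ?Z" and g: "g \<in> carrier G"
        have zc: "z \<in> carrier G" using z Zc by auto
        show "g \<otimes> z \<otimes> inv g \<in> generate G ?Z"
        proof (cases "z \<in> lower_central G i")
          case True
          hence "g \<otimes> z \<otimes> inv g \<in> lower_central G i" using g lower_central_normal
            by (simp add: normal_inv_iff)
          thus ?thesis by (auto intro: generate.incl)
        next
          case False
          \<comment> \<open>A conjugate of an element of \<open>T'\<close> differs from it by a
            commutator in the term of index \<open>i = Suc j\<close>, which belongs to the
            centralized set.\<close>
          hence "z \<in> lower_central G j" "z \<in> T'" using z T' Tl by auto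
          hence "comm G z (inv g) \<in> lower_central G i" using lower_central_comm g Suc by simp
          moreover have "g \<otimes> z \<otimes> inv g = z \<otimes> comm G z (inv g)" using zc g
            by (simp add: comm_def free_simps)
          moreover have "z \<in> generate G ?Z" using z by (rule generate.incl)
          moreover have "comm G z (inv g) \<in> generate G ?Z"
            using \<open>comm G z (inv g) \<in> _\<close> by (auto intro: generate.incl)
          ultimately show ?thesis by (simp add: generate.eng)
        qed
      qed
      thus ?thesis unfolding W_def using normal_subgroup_intersect[OF B] by blast
    qed
    have Tc: "T \<subseteq> carrier G" using Tl lower_central_carrier by blast
    have "finite T" unfolding T_def by (rule gen_comms_finite[OF S(1)])
    have W: "T' \<subseteq> T \<Longrightarrow> \<not> W T' \<subseteq> N" if "finite T'" for T'
      using that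
    proof (induct T')
      case empty
      show ?case using i NY[of i] by (auto simp: W_def Y_def)
    next
      case (insert t T')
      then obtain b where b: "b \<in> W T'" "b \<notin> N" by auto
      have t: "t \<in> carrier G" using insert Tc by auto
      have bc: "b \<in> carrier G" using b(1) Bc by (auto simp: W_def)
      \<comment> \<open>\<open>W T'\<close> is normal, so the whole Engel sequence stays in it; its
        last term before \<open>N\<close> commutes modulo \<open>N\<close> with \<open>t\<close> in
        addition.\<close>
      have eW: "engel G k b t \<in> W T'" for k
        by (induct k) (use b insert t normal_comm[OF Wn] in auto)
      obtain m where "engel G m b t = \<one>" using eng bc t by blast
      hence "engel G m b t \<in> N" using Nn by (simp add: normal_imp_subgroup subgroup.one_closed)
      with b(2) obtain k where k: "engel G k b t \<notin> N" "engel G (Suc k) b t \<in> N"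
        using engel_exit by blast
      have "engel G k b t \<in> W (insert t T')"
        using eW[of k] k(2) by (auto simp: W_def centralizer_mod_def)
      thus ?case using k(1) by auto
    qed
    have WT: "\<not> W T \<subseteq> N" using W[OF \<open>finite T\<close>] by auto
    \<comment> \<open>The roles are exchanged: what commutes modulo \<open>N\<close> with
      \<open>W T\<close> is a normal subgroup containing \<open>T\<close>, hence contains the whole
      \<open>j\<close>-th term.\<close>
    have "centralizer_mod N (W T) \<lhd> G" using centralizer_mod_normal_normal[OF Nn Wn] by auto
    moreover have "T \<subseteq> centralizer_mod N (W T)" using Tc Bc
      by (auto simp: W_def centralizer_mod_def intro: comm_mem_sym[OF Nn])
    ultimately have l: "lower_central G j \<subseteq> centralizer_mod N (W T)"
      unfolding T_def using lower_central_subset_if_gen_comms[OF S(2,3)] by blast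
    have "W T \<subseteq> Y j"
    proof
      fix x assume x: "x \<in> W T"
      hence xB: "x \<in> B" and xc: "x \<in> carrier G" using Bc by (auto simp: W_def)
      have "comm G x z \<in> N" if z: "z \<in> lower_central G j" for z
        using l z x xc comm_mem_sym[OF Nn, of z x] by (auto simp: centralizer_mod_def)
      thus "x \<in> Y j" using xB xc by (auto simp: Y_def centralizer_mod_def)
    qed
    thus False using WT imin[of j] Suc by auto
  qed
qed

section \<open>Solvable Engel groups\<close>

text \<open>The derived subgroup is generated by the products
  \<open>h1 \<otimes> h2 \<otimes> inv h1 \<otimes> inv h2\<close>, which in the convention of
  \<open>comm\<close> are commutators of the inverses.\<close>

lemma derived_comm:
  assumes "H \<subseteq> carrier G"
    and "subgroup N G" "\<And>x y. x \<in> H \<Longrightarrow> y \<in> H \<Longrightarrow> comm G (inv x) (inv y) \<in> N"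
  shows "derived G H \<subseteq> N"
  unfolding derived_def
proof (rule generate_subgroup_incl[OF _ assms(2)])
  have "h1 \<otimes> h2 \<otimes> inv h1 \<otimes> inv h2 = comm G (inv h1) (inv h2)" if "h1 \<in> H" "h2 \<in> H" for h1 h2
    using that[THEN subsetD[OF assms(1)]] by (simp add: comm_def)
  thus "derived_set G H \<subseteq> N" using assms(3) by auto
qed

lemma comm_derived:
  assumes "subgroup H G" "x \<in> H" "y \<in> H"
  shows "comm G x y \<in> derived G H"
proof -
  have "inv x \<otimes> inv y \<otimes> inv (inv x) \<otimes> inv (inv y) \<in> derived_set G H"
    using assms by (auto intro: subgroup.m_inv_closed)
  moreover have "x \<in> carrier G" "y \<in> carrier G"
    using assms subgroup.mem_carrier[OF assms(1)] by auto
  ultimately show ?thesis unfolding derived_def comm_def by (auto intro: generate.incl)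
qed

lemma funpow_derived_normal:
  "(derived G ^^ j) (carrier G) \<lhd> G"
  by (induct j) (simp_all add: normal_self derived_is_normal)

lemma set_mult_normal:
  assumes N: "N \<lhd> G" and M: "M \<lhd> G"
  shows "N <#> M \<lhd> G"
proof (rule normal_invI)
  interpret N: normal N G by fact
  interpret M: normal M G by fact
  show "subgroup (N <#> M) G"
  proof (rule subgroupI)
    show "N <#> M \<subseteq> carrier G" using N.subset M.subset by (auto simp: set_mult_def)
    have "\<one> \<otimes> \<one> \<in> N <#> M" using N.one_closed M.one_closed unfolding set_mult_def by blast
    thus "N <#> M \<noteq> {}" by blast
    fix a assume "a \<in> N <#> M"
    then obtain n m where a: "a = n \<otimes> m" "n \<in> N" "m \<in> M" by (auto simp: set_mult_def)
    have c: "n \<in> carrier G" "m \<in> carrier G" using a by auto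
    have "inv a = inv n \<otimes> (n \<otimes> inv m \<otimes> inv n)" using c a(1) by (simp add: free_simps)
    moreover have "n \<otimes> inv m \<otimes> inv n \<in> M" using M.inv_op_closed2[of n "inv m"] c a by simp
    ultimately show "inv a \<in> N <#> M" using a by (auto simp: set_mult_def)
    fix b assume "b \<in> N <#> M"
    then obtain n' m' where b: "b = n' \<otimes> m'" "n' \<in> N" "m' \<in> M" by (auto simp: set_mult_def)
    have c': "n' \<in> carrier G" "m' \<in> carrier G" using b by auto
    have "a \<otimes> b = (n \<otimes> n') \<otimes> ((inv n' \<otimes> m \<otimes> n') \<otimes> m')"
      using c c' a(1) b(1) by (simp add: free_simps)
    moreover have "inv n' \<otimes> m \<otimes> n' \<in> M" using M.inv_op_closed1[of n' m] c' a by simp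
    ultimately show "a \<otimes> b \<in> N <#> M" using a b by (auto simp: set_mult_def)
  qed
  fix g h assume g: "g \<in> carrier G" and "h \<in> N <#> M"
  then obtain n m where h: "h = n \<otimes> m" "n \<in> N" "m \<in> M" by (auto simp: set_mult_def)
  have "g \<otimes> h \<otimes> inv g = (g \<otimes> n \<otimes> inv g) \<otimes> (g \<otimes> m \<otimes> inv g)"
    using g h by (simp add: free_simps)
  thus "g \<otimes> h \<otimes> inv g \<in> N <#> M"
    using N.inv_op_closed2[OF g h(2)] M.inv_op_closed2[OF g h(3)] by (auto simp: set_mult_def)
qed

lemma set_mult_I: "x \<in> N \<Longrightarrow> y \<in> M \<Longrightarrow> x \<otimes> y \<in> N <#> M"
  unfolding set_mult_def by blast

lemma set_mult_subset:
  assumes "subgroup H G" "N \<subseteq> H" "M \<subseteq> H" shows "N <#> M \<subseteq> H"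
proof
  fix z assume "z \<in> N <#> M"
  then obtain x y where "x \<in> N" "y \<in> M" "z = x \<otimes> y" unfolding set_mult_def by blast
  thus "z \<in> H" using subgroup.m_closed[OF assms(1)] assms(2,3) by auto
qed

text \<open>Commuting modulo \<open>N\<close> is a subgroup condition on either argument, so it may
  be checked on the factors \<open>N\<close> and \<open>M\<close> separately, once in each
  argument.\<close>

lemma comm_set_mult:
  assumes N: "N \<lhd> G" and M: "M \<lhd> G"
    and MN: "\<And>x y. x \<in> M \<Longrightarrow> y \<in> M \<Longrightarrow> comm G x y \<in> N"
    and a: "a \<in> N <#> M" and b: "b \<in> N <#> M"
  shows "comm G a b \<in> N"
proof -
  interpret N: normal N G by fact
  interpret M: normal M G by fact
  have sub: "subgroup (centralizer_mod N M) G" by (rule centralizer_mod_subgroup[OF N M.subset])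
  have "N \<subseteq> centralizer_mod N M" "M \<subseteq> centralizer_mod N M" using MN normal_comm[OF N]
    by (auto simp: centralizer_mod_def)
  hence "N <#> M \<subseteq> centralizer_mod N M" by (rule set_mult_subset[OF sub])
  hence *: "comm G x y \<in> N" if "x \<in> N <#> M" "y \<in> M" for x y
    using that unfolding centralizer_mod_def by blast
  have Pc: "N <#> M \<subseteq> carrier G" using N.subset M.subset by (auto simp: set_mult_def)
  have sub': "subgroup (centralizer_mod N (N <#> M)) G" by (rule centralizer_mod_subgroup[OF N Pc])
  have "N \<subseteq> centralizer_mod N (N <#> M)" using normal_comm[OF N] Pc
    by (auto simp: centralizer_mod_def)
  moreover have "M \<subseteq> centralizer_mod N (N <#> M)"
  proof
    fix y assume y: "y \<in> M"
    have "comm G y x \<in> N" if "x \<in> N <#> M" for x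
      using comm_mem_sym[OF N _ _ *[OF that y]] that y Pc by auto
    thus "y \<in> centralizer_mod N (N <#> M)" using y by (auto simp: centralizer_mod_def)
  qed
  ultimately have "N <#> M \<subseteq> centralizer_mod N (N <#> M)"
    by (rule set_mult_subset[OF sub'])
  hence "a \<in> centralizer_mod N (N <#> M)" using a by blast
  hence "\<forall>z\<in>N <#> M. comm G a z \<in> N"
    unfolding centralizer_mod_def mem_Collect_eq by (rule conjunct2)
  thus ?thesis using b by (rule bspec)
qed

text \<open>Induction on the derived length. The product of \<open>K\<close> with the last
  nontrivial derived term is abelian modulo \<open>K\<close>, and some lower central term lies in
  that product by induction, so the abelian-by-nilpotent case applies.\<close>

lemma engel_solvable:
  assumes eng: "\<And>a b. a \<in> carrier G \<Longrightarrow> b \<in> carrier G \<Longrightarrow> \<exists>n. engel G n a b = \<one>"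
    and S: "finite S" "S \<subseteq> carrier G" "generate G S = carrier G"
    and K: "K \<lhd> G" and solv: "(derived G ^^ j) (carrier G) \<subseteq> K"
  shows "\<exists>m. lower_central G m \<subseteq> K"
  using K solv
proof (induct j arbitrary: K)
  case 0
  hence "lower_central G 0 \<subseteq> K" by simp
  thus ?case by blast
next
  case (Suc j)
  let ?D = "(derived G ^^ j) (carrier G)"
  have D: "?D \<lhd> G" by (rule funpow_derived_normal)
  interpret K: normal K G by fact
  interpret D: normal ?D G by fact
  have n: "K <#> ?D \<lhd> G" by (rule set_mult_normal[OF Suc(2) D])
  have KB: "K \<subseteq> K <#> ?D"
  proof
    fix x assume x: "x \<in> K"
    thus "x \<in> K <#> ?D" using set_mult_I[OF x D.one_closed] by simp
  qed
  have "?D \<subseteq> K <#> ?D"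
  proof
    fix x assume x: "x \<in> ?D"
    thus "x \<in> K <#> ?D" using set_mult_I[OF K.one_closed x] D.mem_carrier[OF x] by simp
  qed
  then obtain m where m: "lower_central G m \<subseteq> K <#> ?D" using Suc(1)[OF n] by blast
  have "comm G x y \<in> K" if "x \<in> ?D" "y \<in> ?D" for x y
    using comm_derived[OF normal_imp_subgroup[OF D] that] Suc(3) unfolding funpow.simps comp_apply
      by blast
  hence *: "comm G x y \<in> K" if "x \<in> K <#> ?D" "y \<in> K <#> ?D" for x y
    by (rule comm_set_mult[OF Suc(2) D _ that])
  show ?case by (rule engel_abelian_by_nilpotent[OF eng S Suc(2) n KB * m])
qed

section \<open>Normalizers and maximal subgroups in finite Engel groups\<close>

text \<open>The equivalence expresses equality of \<open>D\<close> with its conjugate rather than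
  inclusion, so that closure under inverses holds for infinite \<open>D\<close> too.\<close>

definition set_normalizer :: "'a set \<Rightarrow> 'a set" where
  "set_normalizer D = {g \<in> carrier G. \<forall>d\<in>carrier G. g \<otimes> d \<otimes> inv g \<in> D \<longleftrightarrow> d \<in> D}"

lemma set_normalizerD: "a \<in> set_normalizer D \<Longrightarrow> d \<in> carrier G \<Longrightarrow> a \<otimes> d \<otimes> inv a \<in> D \<longleftrightarrow> d \<in> D"
  by (simp add: set_normalizer_def)

lemma set_normalizerI:
  assumes "a \<in> carrier G" "\<And>d. d \<in> carrier G \<Longrightarrow> a \<otimes> d \<otimes> inv a \<in> D \<longleftrightarrow> d \<in> D"
  shows "a \<in> set_normalizer D"
  using assms by (simp add: set_normalizer_def)

lemma set_normalizer_subgroup: "subgroup (set_normalizer D) G"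
proof (rule subgroupI)
  show "set_normalizer D \<subseteq> carrier G" by (auto simp: set_normalizer_def)
  have "\<one> \<in> set_normalizer D" by (simp add: set_normalizer_def)
  thus "set_normalizer D \<noteq> {}" by auto
  fix a assume a: "a \<in> set_normalizer D"
  hence ac: "a \<in> carrier G" by (simp add: set_normalizer_def)
  have "inv a \<otimes> d \<otimes> a \<in> D \<longleftrightarrow> d \<in> D" if "d \<in> carrier G" for d
  proof -
    have "a \<otimes> (inv a \<otimes> d \<otimes> a) \<otimes> inv a \<in> D \<longleftrightarrow> inv a \<otimes> d \<otimes> a \<in> D"
      using a ac that by (intro set_normalizerD) auto
    moreover have "a \<otimes> (inv a \<otimes> d \<otimes> a) \<otimes> inv a = d" using ac that by (simp add: free_simps)
    ultimately show ?thesis by simp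
  qed
  thus "inv a \<in> set_normalizer D" using ac by (intro set_normalizerI) auto
  fix b assume b: "b \<in> set_normalizer D"
  hence bc: "b \<in> carrier G" by (simp add: set_normalizer_def)
  have "(a \<otimes> b) \<otimes> d \<otimes> inv (a \<otimes> b) \<in> D \<longleftrightarrow> d \<in> D" if d: "d \<in> carrier G" for d
  proof -
    have "b \<otimes> d \<otimes> inv b \<in> carrier G" using bc d by simp
    hence "a \<otimes> (b \<otimes> d \<otimes> inv b) \<otimes> inv a \<in> D \<longleftrightarrow> d \<in> D"
      using set_normalizerD[OF a] set_normalizerD[OF b d] by blast
    moreover have "a \<otimes> (b \<otimes> d \<otimes> inv b) \<otimes> inv a = (a \<otimes> b) \<otimes> d \<otimes> inv (a \<otimes> b)"
      using ac bc d by (simp add: free_simps)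
    ultimately show ?thesis by simp
  qed
  thus "a \<otimes> b \<in> set_normalizer D" using ac bc by (intro set_normalizerI) auto
qed

lemma set_normalizer_normal:
  assumes "subgroup D G" "set_normalizer D = carrier G" shows "D \<lhd> G"
proof (rule normal_invI[OF assms(1)])
  fix g h assume "g \<in> carrier G" "h \<in> D"
  thus "g \<otimes> h \<otimes> inv g \<in> D" using set_normalizerD[of g D h] subgroup.mem_carrier[OF assms(1)]
    assms(2) by blast
qed

lemma subgroup_subset_set_normalizer:
  assumes "subgroup D G" shows "D \<subseteq> set_normalizer D"
proof
  fix g assume g: "g \<in> D"
  interpret D: subgroup D G by fact
  have gc: "g \<in> carrier G" using g by simp
  have "d \<in> D" if "g \<otimes> d \<otimes> inv g \<in> D" "d \<in> carrier G" for d
  proof -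
    have "inv g \<otimes> (g \<otimes> d \<otimes> inv g) \<otimes> g \<in> D"
      using that g by simp
    moreover have "inv g \<otimes> (g \<otimes> d \<otimes> inv g) \<otimes> g = d" using gc that by (simp add: free_simps)
    ultimately show ?thesis by simp
  qed
  moreover have "g \<otimes> d \<otimes> inv g \<in> D" if "d \<in> D" for d using that g by simp
  ultimately show "g \<in> set_normalizer D" using gc by (intro set_normalizerI) blast+
qed

text \<open>Conjugation is injective, and an injective map of a finite set into itself is onto;
  inclusion of the conjugate suffices.\<close>

lemma finite_set_normalizerI:
  assumes "finite D" "D \<subseteq> carrier G" "g \<in> carrier G" "\<And>d. d \<in> D \<Longrightarrow> inv g \<otimes> d \<otimes> g \<in> D"
  shows "g \<in> set_normalizer D"
proof -
  let ?f = "\<lambda>d. inv g \<otimes> d \<otimes> g"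
  have e: "g \<otimes> ?f d \<otimes> inv g = d" if "d \<in> carrier G" for d
    using assms that by (simp add: free_simps)
  have "inj_on ?f D" by (rule inj_on_inverseI[where g = "\<lambda>d. g \<otimes> d \<otimes> inv g"]) (use e assms in auto)
  hence im: "?f ` D = D" using assms(1,4) by (intro endo_inj_surj) auto
  have "g \<otimes> d \<otimes> inv g \<in> D \<longleftrightarrow> d \<in> D" if d: "d \<in> carrier G" for d
  proof
    assume "g \<otimes> d \<otimes> inv g \<in> D"
    hence "?f (g \<otimes> d \<otimes> inv g) \<in> D" using assms(4) by blast
    thus "d \<in> D" using assms(3) d by (simp add: free_simps)
  next
    assume "d \<in> D"
    then obtain d' where "d' \<in> D" "d = ?f d'" using im by auto
    thus "g \<otimes> d \<otimes> inv g \<in> D" using e assms(2) by auto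
  qed
  thus ?thesis using assms(3) by (intro set_normalizerI)
qed

lemma comm_subgroup_eq:
  assumes "subgroup H G" "x \<in> H" "y \<in> H"
  shows "comm (G\<lparr>carrier := H\<rparr>) x y = comm G x y"
  unfolding comm_def using assms by (simp add: m_inv_consistent)

lemma engel_subgroup_eq:
  assumes "subgroup H G" "x \<in> H" "y \<in> H"
  shows "engel (G\<lparr>carrier := H\<rparr>) n x y = engel G n x y"
proof -
  have "engel (G\<lparr>carrier := H\<rparr>) n x y = engel G n x y \<and> engel G n x y \<in> H"
    by (induct n) (use assms in \<open>auto simp: comm_subgroup_eq subgroup_comm\<close>)
  thus ?thesis by simp
qed

text \<open>Normalizers grow in nilpotent groups. Let the \<open>i\<close>-th lower central term of
  \<open>M\<close> be the first inside \<open>D\<close>; an element of the preceding term outside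
  \<open>D\<close> has its commutators with \<open>D\<close> in \<open>D\<close>, so it normalizes
  \<open>D\<close>.\<close>

lemma lower_central_subgroup_normalizes:
  assumes M: "subgroup M G" and nil: "lower_central (G\<lparr>carrier := M\<rparr>) n = {\<one>}"
    and D: "subgroup D G" "D \<subset> M"
  obtains y where "y \<in> M" "y \<notin> D" "\<And>d. d \<in> D \<Longrightarrow> inv y \<otimes> d \<otimes> y \<in> D"
proof -
  interpret D: subgroup D G by fact
  interpret M: subgroup M G by fact
  interpret GM: group "G\<lparr>carrier := M\<rparr>" by (rule subgroup_imp_group[OF M])
  let ?L = "lower_central (G\<lparr>carrier := M\<rparr>)"
  have L: "?L i \<subseteq> M" for i using GM.lower_central_carrier[of i] by simp
  have "\<exists>i. ?L i \<subseteq> D" using nil D.one_closed by (metis empty_subsetI insert_subset)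
  then have i: "?L (LEAST i. ?L i \<subseteq> D) \<subseteq> D" by (rule LeastI_ex)
  define i where "i = (LEAST i. ?L i \<subseteq> D)"
  have "i \<noteq> 0"
  proof
    assume "i = 0"
    hence "?L 0 \<subseteq> D" using i unfolding i_def[symmetric] by simp
    thus False using D(2) by auto
  qed
  then obtain j where j: "i = Suc j" by (cases i) auto
  have "\<not> ?L j \<subseteq> D" using not_less_Least[of j "\<lambda>i. ?L i \<subseteq> D"] j unfolding i_def by simp
  then obtain y where y: "y \<in> ?L j" "y \<notin> D" by blast
  have yM: "y \<in> M" using y L by blast
  have "inv y \<otimes> d \<otimes> y \<in> D" if d: "d \<in> D" for d
  proof -
    have dM: "d \<in> M" using d D by blast
    have "comm (G\<lparr>carrier := M\<rparr>) y (inv d) \<in> ?L (Suc j)"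
      by (rule GM.lower_central_comm[OF y(1)]) (use dM in simp)
    hence "comm G y (inv d) \<in> D"
      using i j comm_subgroup_eq[OF M yM, of "inv d"] dM unfolding i_def[symmetric] by auto
    hence "comm G y (inv d) \<otimes> d \<in> D" using d by simp
    moreover have "comm G y (inv d) \<otimes> d = inv y \<otimes> d \<otimes> y"
      using M.mem_carrier[OF yM] D.mem_carrier[OF d] by (simp add: comm_def free_simps)
    ultimately show ?thesis by simp
  qed
  thus ?thesis using that yM y(2) by blast
qed

definition maximal_subgroup :: "'a set \<Rightarrow> bool" where
  "maximal_subgroup M \<longleftrightarrow> subgroup M G \<and> M \<noteq> carrier G \<and>
     (\<forall>H. subgroup H G \<and> M \<subseteq> H \<longrightarrow> H = M \<or> H = carrier G)"

lemma maximal_subgroup_subset: "maximal_subgroup M \<Longrightarrow> M \<subseteq> carrier G"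
  unfolding maximal_subgroup_def using subgroup.subset by blast

lemma maximal_subgroup_exists:
  assumes fin: "finite (carrier G)" and H: "subgroup H G" "H \<noteq> carrier G"
  obtains M where "maximal_subgroup M" "H \<subseteq> M"
proof -
  define A where "A = {M. subgroup M G \<and> H \<subseteq> M \<and> M \<noteq> carrier G}"
  have "A \<subseteq> Pow (carrier G)" unfolding A_def using subgroup.subset by blast
  hence "finite A" using fin by (meson finite_Pow_iff finite_subset)
  moreover have "H \<in> A" using H by (auto simp: A_def)
  ultimately obtain M where M: "M \<in> A" "H \<subseteq> M" "\<And>L. L \<in> A \<Longrightarrow> M \<subseteq> L \<Longrightarrow> L = M"
    using finite_has_maximal2[of A H] by metis
  have "maximal_subgroup M" using M unfolding maximal_subgroup_def A_def by blast
  thus ?thesis using that M(2) by blast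
qed

lemma maximal_subgroup_conj:
  assumes M: "maximal_subgroup M" and g: "g \<in> carrier G"
  shows "maximal_subgroup ((\<lambda>x. inv g \<otimes> x \<otimes> g) ` M)"
proof -
  have sub: "subgroup ((\<lambda>x. inv g \<otimes> x \<otimes> g) ` H) G" if H: "subgroup H G" and g: "g \<in> carrier G"
    for H g
  proof -
    interpret H: subgroup H G by fact
    show ?thesis
    proof (rule subgroupI)
      show "(\<lambda>x. inv g \<otimes> x \<otimes> g) ` H \<subseteq> carrier G" using g by auto
      show "(\<lambda>x. inv g \<otimes> x \<otimes> g) ` H \<noteq> {}" using H.one_closed by blast
      fix a assume "a \<in> (\<lambda>x. inv g \<otimes> x \<otimes> g) ` H"
      then obtain x where x: "x \<in> H" "a = inv g \<otimes> x \<otimes> g" by auto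
      have "inv a = inv g \<otimes> inv x \<otimes> g" using x g by (simp add: free_simps)
      thus "inv a \<in> (\<lambda>x. inv g \<otimes> x \<otimes> g) ` H" using x H.m_inv_closed by blast
      fix b assume "b \<in> (\<lambda>x. inv g \<otimes> x \<otimes> g) ` H"
      then obtain y where y: "y \<in> H" "b = inv g \<otimes> y \<otimes> g" by auto
      have "a \<otimes> b = inv g \<otimes> (x \<otimes> y) \<otimes> g" using x y g by (simp add: free_simps)
      thus "a \<otimes> b \<in> (\<lambda>x. inv g \<otimes> x \<otimes> g) ` H" using x y H.m_closed by blast
    qed
  qed
  have bk: "(\<lambda>x. inv (inv g) \<otimes> x \<otimes> inv g) ` (\<lambda>x. inv g \<otimes> x \<otimes> g) ` H = H" if "H \<subseteq> carrier G" for H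
  proof -
    have "inv (inv g) \<otimes> (inv g \<otimes> x \<otimes> g) \<otimes> inv g = x" if "x \<in> carrier G" for x
      using g that by (simp add: free_simps)
    hence "(\<lambda>x. inv (inv g) \<otimes> (inv g \<otimes> x \<otimes> g) \<otimes> inv g) ` H = (\<lambda>x. x) ` H"
      using that by (intro image_cong) blast+
    thus ?thesis unfolding image_image by simp
  qed
  have forth: "(\<lambda>x. inv g \<otimes> x \<otimes> g) ` (\<lambda>x. inv (inv g) \<otimes> x \<otimes> inv g) ` H = H" if "H \<subseteq> carrier G" for H
  proof -
    have "inv g \<otimes> (inv (inv g) \<otimes> x \<otimes> inv g) \<otimes> g = x" if "x \<in> carrier G" for x
      using g that by (simp add: free_simps)
    hence "(\<lambda>x. inv g \<otimes> (inv (inv g) \<otimes> x \<otimes> inv g) \<otimes> g) ` H = (\<lambda>x. x) ` H"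
      using that by (intro image_cong) blast+
    thus ?thesis unfolding image_image by simp
  qed
  have full: "(\<lambda>x. inv h \<otimes> x \<otimes> h) ` carrier G = carrier G" if h: "h \<in> carrier G" for h
  proof
    show "(\<lambda>x. inv h \<otimes> x \<otimes> h) ` carrier G \<subseteq> carrier G" using h by auto
    show "carrier G \<subseteq> (\<lambda>x. inv h \<otimes> x \<otimes> h) ` carrier G"
    proof
      fix x assume x: "x \<in> carrier G"
      have "x = inv h \<otimes> (h \<otimes> x \<otimes> inv h) \<otimes> h" using h x by (simp add: free_simps)
      moreover have "h \<otimes> x \<otimes> inv h \<in> carrier G" using h x by simp
      ultimately show "x \<in> (\<lambda>x. inv h \<otimes> x \<otimes> h) ` carrier G" by (rule image_eqI)
    qed
  qed
  have Ms: "subgroup M G" and Mc: "M \<subseteq> carrier G" and Mp: "M \<noteq> carrier G"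
    using M by (auto simp: maximal_subgroup_def subgroup.subset)
  show ?thesis unfolding maximal_subgroup_def
  proof (intro conjI allI impI)
    show "subgroup ((\<lambda>x. inv g \<otimes> x \<otimes> g) ` M) G" by (rule sub[OF Ms g])
    show "(\<lambda>x. inv g \<otimes> x \<otimes> g) ` M \<noteq> carrier G"
      using bk[OF Mc] full[of "inv g"] g Mp by auto
    fix H assume H: "subgroup H G \<and> (\<lambda>x. inv g \<otimes> x \<otimes> g) ` M \<subseteq> H"
    have Hc: "H \<subseteq> carrier G" using H by (simp add: subgroup.subset)
    have "M \<subseteq> (\<lambda>x. inv (inv g) \<otimes> x \<otimes> inv g) ` H" using bk[OF Mc] H by blast
    moreover have "subgroup ((\<lambda>x. inv (inv g) \<otimes> x \<otimes> inv g) ` H) G" using H g by (intro sub) auto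
    ultimately have "(\<lambda>x. inv (inv g) \<otimes> x \<otimes> inv g) ` H = M \<or>
        (\<lambda>x. inv (inv g) \<otimes> x \<otimes> inv g) ` H = carrier G"
      using M unfolding maximal_subgroup_def by blast
    thus "H = (\<lambda>x. inv g \<otimes> x \<otimes> g) ` M \<or> H = carrier G"
      using forth[OF Hc] full[OF g] by metis
  qed
qed

text \<open>For a maximal proper normal subgroup \<open>N\<close>, two distinct maximal subgroups above \<open>N\<close> meet in
  \<open>N\<close>: normalizers grow in the proper subgroups, so an intersection of largest order is normal. If
  \<open>g \<in> M - N\<close> with \<open>M\<close> maximal, the point where an Engel sequence enters \<open>M\<close> gives \<open>z \<notin> M\<close> such
  that \<open>M\<close> and its conjugate by \<open>z\<close> share a conjugate of \<open>g\<close>; hence \<open>z\<close> normalizes \<open>M\<close>, and \<open>M\<close> is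
  normal.\<close>

lemma finite_engel_step:
  assumes fin: "finite (carrier G)"
    and eng: "\<And>a b. a \<in> carrier G \<Longrightarrow> b \<in> carrier G \<Longrightarrow> \<exists>n. engel G n a b = \<one>"
    and nil: "\<And>H. subgroup H G \<Longrightarrow> H \<noteq> carrier G \<Longrightarrow> \<exists>n. lower_central (G\<lparr>carrier := H\<rparr>) n = {\<one>}"
  shows "\<exists>N. N \<lhd> G \<and> (carrier G = {\<one>} \<or> N \<noteq> carrier G) \<and> (\<forall>x\<in>carrier G. \<forall>y\<in>carrier G. comm G x y \<in>
    N)"
proof (cases "carrier G = {\<one>}")
  case True
  have "\<forall>x\<in>carrier G. \<forall>y\<in>carrier G. comm G x y \<in> carrier G" using comm_closed by blast
  thus ?thesis using True normal_self by blast
next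
  case nontriv: False
  define A where "A = {N. N \<lhd> G \<and> N \<noteq> carrier G}"
  have "A \<subseteq> Pow (carrier G)"
    unfolding A_def by (auto dest!: normal_imp_subgroup dest: subgroup.mem_carrier)
  hence "finite A" using fin by (meson finite_Pow_iff finite_subset)
  moreover have "{\<one>} \<in> A" unfolding A_def using nontriv one_is_normal by blast
  ultimately obtain N where N: "N \<in> A" "\<And>L. L \<in> A \<Longrightarrow> N \<subseteq> L \<Longrightarrow> L = N"
    using finite_has_maximal2[of A "{\<one>}"] by metis
  have Nn: "N \<lhd> G" and Np: "N \<noteq> carrier G" using N(1) by (auto simp: A_def)
  interpret N: normal N G by (rule Nn)
  show ?thesis
  proof (cases "\<forall>g\<in>carrier G - N. generate G (N \<union> {g}) = carrier G")
    case True
    \<comment> \<open>\<open>G\<close> is generated by \<open>N\<close> and a single element, so the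
      quotient is cyclic and therefore abelian.\<close>
    obtain g where g: "g \<in> carrier G" "g \<notin> N" using Np N.subset by blast
    have gc: "{g} \<subseteq> carrier G" using g by simp
    have "N \<union> {g} \<subseteq> centralizer_mod N {g}"
      using normal_comm(1)[OF Nn _ g(1)] g N.subset comm_eq_one_iff[OF g(1) g(1)]
        by (auto simp: centralizer_mod_def)
    hence "carrier G \<subseteq> centralizer_mod N {g}"
      using True g generate_subgroup_incl[OF _ centralizer_mod_subgroup[OF Nn gc]] by blast
    hence 1: "comm G x g \<in> N" if "x \<in> carrier G" for x using that
      by (auto simp: centralizer_mod_def)
    have "comm G g x \<in> N" if "x \<in> carrier G" for x
      by (rule comm_mem_sym[OF Nn that g(1) 1[OF that]])
    hence "N \<union> {g} \<subseteq> centralizer_mod N (carrier G)"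
      using normal_comm(1)[OF Nn] g N.subset by (auto simp: centralizer_mod_def)
    hence "carrier G \<subseteq> centralizer_mod N (carrier G)"
      using True g generate_subgroup_incl[OF _ centralizer_mod_subgroup[OF Nn order_refl]] by blast
    thus ?thesis using Nn Np by (intro exI[of _ N]) (auto simp: centralizer_mod_def)
  next
    case False
    then obtain g where g: "g \<in> carrier G" "g \<notin> N" "generate G (N \<union> {g}) \<noteq> carrier G" by blast
    have "subgroup (generate G (N \<union> {g})) G" using g N.subset by (intro generate_is_subgroup) auto
    then obtain M where M: "maximal_subgroup M" "generate G (N \<union> {g}) \<subseteq> M"
      using maximal_subgroup_exists[OF fin _ g(3)] by blast
    have NM: "N \<subseteq> M" and gM: "g \<in> M" using M(2) generate.incl[of _ "N \<union> {g}" G] by blast+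
    have Ms: "subgroup M G" and Mp: "M \<noteq> carrier G" using M(1) by (auto simp: maximal_subgroup_def)
    interpret M: subgroup M G by (rule Ms)
    have notnormal: "L = N" if "N \<subseteq> L" "L \<lhd> G" "L \<noteq> carrier G" for L
      using N(2)[of L] that by (auto simp: A_def)
    define P where "P = {(M1, M2). maximal_subgroup M1 \<and> maximal_subgroup M2 \<and> M1 \<noteq> M2 \<and> N \<subseteq> M1 \<and>
      N \<subseteq> M2}"
    have small: "M1 \<inter> M2 = N" if P: "(M1, M2) \<in> P" for M1 M2
    proof -
      have "P \<subseteq> Pow (carrier G) \<times> Pow (carrier G)" unfolding P_def using maximal_subgroup_subset
        by blast
      hence finP: "finite P" using fin by (meson finite_Pow_iff finite_SigmaI finite_subset)
      define c where "c = (\<lambda>(M1, M2). card (M1 \<inter> M2 :: 'a set))"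
      have "Max (c ` P) \<in> c ` P" using finP P by (intro Max_in) auto
      then obtain p where p: "p \<in> P" "Max (c ` P) = c p" by blast
      obtain M1' M2' where pp: "p = (M1', M2')" by (cases p) blast
      have m1: "(M1', M2') \<in> P" using p pp by simp
      have m2: "c q \<le> card (M1' \<inter> M2')" if "q \<in> P" for q
      proof -
        have "c q \<le> Max (c ` P)" using finP that by simp
        also have "\<dots> = card (M1' \<inter> M2')" using p(2) by (simp add: pp c_def)
        finally show ?thesis .
      qed
      note m = m1 m2
      define D where "D = M1' \<inter> M2'"
      have mx: "maximal_subgroup M1'" "maximal_subgroup M2'" "M1' \<noteq> M2'" "N \<subseteq> D" using m(1)
        by (auto simp: P_def D_def)
      have sg: "subgroup M1' G" "subgroup M2' G" "M1' \<noteq> carrier G" "M2' \<noteq> carrier G"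
        using mx by (auto simp: maximal_subgroup_def)
      have Ds: "subgroup D G" unfolding D_def by (rule subgroups_Inter_pair[OF sg(1,2)])
      have "D \<noteq> M1'" "D \<noteq> M2'"
        using mx sg unfolding maximal_subgroup_def D_def by (metis Int_lower1 Int_lower2)+
      hence Dlt: "D \<subset> M1'" "D \<subset> M2'" by (auto simp: D_def)
      have finD: "finite D" using fin subgroup.subset[OF Ds] finite_subset by blast
      have up: "\<exists>y. y \<in> L \<and> y \<notin> D \<and> y \<in> set_normalizer D"
        if L: "subgroup L G" "L \<noteq> carrier G" "D \<subset> L" for L
      proof -
        obtain n where "lower_central (G\<lparr>carrier := L\<rparr>) n = {\<one>}" using nil[OF L(1,2)] by blast
        then obtain y where y: "y \<in> L" "y \<notin> D" "\<And>d. d \<in> D \<Longrightarrow> inv y \<otimes> d \<otimes> y \<in> D"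
          using lower_central_subgroup_normalizes[OF L(1) _ Ds L(3)] by blast
        have "y \<in> set_normalizer D"
          using finite_set_normalizerI[OF finD subgroup.subset[OF Ds] _ y(3)] y(1)
            subgroup.mem_carrier[OF L(1)] by blast
        thus ?thesis using y by blast
      qed
      \<comment> \<open>If the normalizer were proper, a maximal subgroup above it would meet each
        of \<open>M1'\<close> and \<open>M2'\<close> in more than \<open>D\<close>. As no
        intersection of distinct members is larger than \<open>D\<close>, it would coincide with
        both.\<close>
      have "set_normalizer D = carrier G"
      proof (rule ccontr)
        assume "set_normalizer D \<noteq> carrier G"
        then obtain M3 where M3: "maximal_subgroup M3" "set_normalizer D \<subseteq> M3"
          using maximal_subgroup_exists[OF fin set_normalizer_subgroup] by blast
        have DM3: "D \<subseteq> M3" using subgroup_subset_set_normalizer[OF Ds] M3(2) by blast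
        have eq: "M3 = L" if L: "maximal_subgroup L" "D \<subset> L" for L
        proof (rule ccontr)
          assume ne: "M3 \<noteq> L"
          have "(M3, L) \<in> P" using M3 L ne mx(4) DM3 by (auto simp: P_def)
          hence le: "card (M3 \<inter> L) \<le> card D" using m(2)[of "(M3, L)"] by (simp add: c_def D_def)
          obtain y where y: "y \<in> L" "y \<notin> D" "y \<in> set_normalizer D" using up[of L] L
            by (auto simp: maximal_subgroup_def)
          have "D \<subset> M3 \<inter> L" using y M3(2) DM3 L(2) by blast
          moreover have "finite (M3 \<inter> L)"
            using fin L(1) by (meson finite_Int finite_subset maximal_subgroup_subset)
          ultimately have "card D < card (M3 \<inter> L)" by (simp add: psubset_card_mono)
          thus False using le by simp
        qed
        show False using eq[OF mx(1) Dlt(1)] eq[OF mx(2) Dlt(2)] mx(3) by simp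
      qed
      hence "D \<lhd> G" by (rule set_normalizer_normal[OF Ds])
      moreover have "D \<noteq> carrier G" using Dlt subgroup.subset[OF sg(1)] by blast
      \<comment> \<open>The largest intersection is normal and proper, hence equal to
        \<open>N\<close> by maximality of \<open>N\<close>. All other intersections contain
        \<open>N\<close> and are no larger.\<close>
      ultimately have DN: "D = N" using notnormal mx(4) by blast
      have "N \<subseteq> M1 \<inter> M2" using P by (auto simp: P_def)
      moreover have "finite (M1 \<inter> M2)"
        using fin P maximal_subgroup_subset unfolding P_def by (blast intro: finite_subset)
      moreover have "card (M1 \<inter> M2) \<le> card N" using m(2)[OF P] DN by (simp add: c_def D_def)
      ultimately show ?thesis using card_seteq by metis
    qed
    have "\<not> M \<lhd> G" using notnormal[OF NM _ Mp] gM g(2) by blast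
    obtain y where y: "y \<in> carrier G" "y \<notin> M" using Mp M.subset by blast
    obtain n where "engel G n y g = \<one>" using eng[OF y(1) g(1)] by blast
    hence "engel G n y g \<in> M" by simp
    then obtain k where k: "engel G k y g \<notin> M" "engel G (Suc k) y g \<in> M" using engel_exit[OF y(2)]
      by blast
    define z where "z = engel G k y g"
    have zc: "z \<in> carrier G" using y g by (simp add: z_def)
    have zM: "z \<notin> M" "comm G z g \<in> M" using k by (simp_all add: z_def)
    have "comm G z g \<otimes> inv g \<in> M" using zM(2) gM by simp
    moreover have "comm G z g \<otimes> inv g = inv (inv z \<otimes> g \<otimes> z)" using zc g
      by (simp add: comm_def free_simps)
    ultimately have "inv (inv (inv z \<otimes> g \<otimes> z)) \<in> M" using M.m_inv_closed by metis
    hence zg: "inv z \<otimes> g \<otimes> z \<in> M" using zc g by simp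
    define M' where "M' = (\<lambda>x. inv z \<otimes> x \<otimes> z) ` M"
    have M': "maximal_subgroup M'" unfolding M'_def by (rule maximal_subgroup_conj[OF M(1) zc])
    have NM': "N \<subseteq> M'"
    proof
      fix x assume x: "x \<in> N"
      have "z \<otimes> x \<otimes> inv z \<in> M" using N.inv_op_closed2[OF zc x] NM by blast
      moreover have "x = inv z \<otimes> (z \<otimes> x \<otimes> inv z) \<otimes> z" using zc x by (simp add: free_simps)
      ultimately show "x \<in> M'" unfolding M'_def by (rule rev_image_eqI)
    qed
    have "M' = M"
    proof (rule ccontr)
      assume "M' \<noteq> M"
      hence "(M, M') \<in> P" using M M' NM NM' by (auto simp: P_def)
      hence "M \<inter> M' = N" by (rule small)
      moreover have "inv z \<otimes> g \<otimes> z \<in> M'" using gM by (auto simp: M'_def)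
      ultimately have "inv z \<otimes> g \<otimes> z \<in> N" using zg by blast
      hence "z \<otimes> (inv z \<otimes> g \<otimes> z) \<otimes> inv z \<in> N" by (rule N.inv_op_closed2[OF zc])
      moreover have "z \<otimes> (inv z \<otimes> g \<otimes> z) \<otimes> inv z = g" using zc g by (simp add: free_simps)
      ultimately show False using g(2) by simp
    qed
    hence "inv z \<otimes> d \<otimes> z \<in> M" if "d \<in> M" for d using that unfolding M'_def by blast
    hence "z \<in> set_normalizer M" by (intro finite_set_normalizerI[OF finite_subset[OF M.subset fin]
      M.subset zc])
    moreover have "M \<subseteq> set_normalizer M" by (rule subgroup_subset_set_normalizer[OF Ms])
    ultimately have "set_normalizer M = carrier G"
      using M(1) set_normalizer_subgroup[of M] zM(1) unfolding maximal_subgroup_def by blast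
    hence "M \<lhd> G" by (rule set_normalizer_normal[OF Ms])
    thus ?thesis using \<open>\<not> M \<lhd> G\<close> by simp
  qed
qed

section \<open>Nilpotency of finite Engel groups\<close>

lemma funpow_derived_subset_lower_central:
  "(derived G ^^ k) (carrier G) \<subseteq> lower_central G k"
proof (induct k)
  case 0 show ?case by simp
next
  case (Suc k)
  have s: "subgroup (lower_central G (Suc k)) G"
    using lower_central_normal[of "Suc k"] by (rule normal_imp_subgroup)
  have "derived G (lower_central G k) \<subseteq> lower_central G (Suc k)"
  proof (rule derived_comm[OF lower_central_carrier s])
    fix x y assume x: "x \<in> lower_central G k" and y: "y \<in> lower_central G k"
    have "inv x \<in> lower_central G k"
      using x normal_imp_subgroup[OF lower_central_normal] by (simp add: subgroup.m_inv_closed)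
    moreover have "inv y \<in> carrier G" using y lower_central_carrier by blast
    ultimately show "comm G (inv x) (inv y) \<in> lower_central G (Suc k)" by (rule lower_central_comm)
  qed
  thus ?case using mono_derived[OF Suc] by auto
qed

lemma funpow_derived_consistent:
  assumes "subgroup H G" "K \<subseteq> H"
  shows "(derived (G\<lparr>carrier := H\<rparr>) ^^ k) K = (derived G ^^ k) K \<and> (derived G ^^ k) K \<subseteq> H"
  by (induct k) (use assms in \<open>auto simp: derived_consistent derived_incl[THEN subsetD]\<close>)

text \<open>Induction on the order of a subgroup. When all proper subgroups are nilpotent, a
  nontrivial group has its derived subgroup inside a proper, hence nilpotent, one; so it is
  solvable, and solvable Engel groups with finitely many generators are nilpotent.\<close>

theorem finite_engel_nilpotent:
  assumes fin: "finite (carrier G)"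
    and eng: "\<And>a b. a \<in> carrier G \<Longrightarrow> b \<in> carrier G \<Longrightarrow> \<exists>n. engel G n a b = \<one>"
  shows "\<exists>n. lower_central G n = {\<one>}"
proof -
  have "\<exists>n. lower_central (G\<lparr>carrier := H\<rparr>) n = {\<one>}" if "subgroup H G" for H
    using that
  proof (induct "card H" arbitrary: H rule: less_induct)
    case less
    interpret H: subgroup H G by (rule less(2))
    let ?H = "G\<lparr>carrier := H\<rparr>"
    interpret GH: group ?H by (rule subgroup_imp_group[OF less(2)])
    have finH: "finite (carrier ?H)" using fin H.subset by (simp add: finite_subset)
    have engH: "\<exists>n. engel ?H n a b = \<one>\<^bsub>?H\<^esub>" if "a \<in> carrier ?H" "b \<in> carrier ?H" for a b
      using eng[of a b] that engel_subgroup_eq[OF less(2)] H.mem_carrier by auto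
    have nil: "\<exists>n. lower_central (?H\<lparr>carrier := K\<rparr>) n = {\<one>\<^bsub>?H\<^esub>}"
      if K: "subgroup K ?H" "K \<noteq> carrier ?H" for K
    proof -
      have "subgroup K G" using incl_subgroup[OF less(2) K(1)] .
      moreover have "card K < card H"
        using K finH subgroup.subset[OF K(1)] by (auto intro: psubset_card_mono)
      ultimately show ?thesis using less(1)[of K] by simp
    qed
    obtain N where N: "N \<lhd> ?H" "carrier ?H = {\<one>\<^bsub>?H\<^esub>} \<or> N \<noteq> carrier ?H"
      "\<And>x y. x \<in> carrier ?H \<Longrightarrow> y \<in> carrier ?H \<Longrightarrow> comm ?H x y \<in> N"
      using GH.finite_engel_step[OF finH engH nil] by blast
    show ?case
    proof (cases "carrier ?H = {\<one>\<^bsub>?H\<^esub>}")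
      case True
      hence "lower_central ?H 0 = {\<one>}" by simp
      thus ?thesis by blast
    next
      case False
      have NH: "subgroup N ?H" using N(1) by (rule normal_imp_subgroup)
      interpret GN: group "?H\<lparr>carrier := N\<rparr>" by (rule GH.subgroup_imp_group[OF NH])
      obtain n where n: "lower_central (?H\<lparr>carrier := N\<rparr>) n = {\<one>\<^bsub>?H\<^esub>}"
        using nil[OF NH] N(2) False by blast
      have "derived ?H (carrier ?H) \<subseteq> N"
        by (rule GH.derived_comm[OF order_refl NH]) (intro N(3) GH.inv_closed)
      hence "(derived ?H ^^ n) (derived ?H (carrier ?H)) \<subseteq> (derived ?H ^^ n) N"
        by (rule GH.mono_exp_of_derived)
      moreover have "(derived ?H ^^ n) N \<subseteq> {\<one>\<^bsub>?H\<^esub>}"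
        using GN.funpow_derived_subset_lower_central[of n] n
          GH.funpow_derived_consistent[OF NH order_refl, of n] by simp
      ultimately have solv: "(derived ?H ^^ Suc n) (carrier ?H) \<subseteq> {\<one>\<^bsub>?H\<^esub>}"
        by (simp add: funpow_swap1)
      have "generate ?H (carrier ?H) = carrier ?H"
        using GH.generate_incl[of "carrier ?H"] generate.incl[of _ "carrier ?H" ?H] by blast
      hence "\<exists>m. lower_central ?H m \<subseteq> {\<one>\<^bsub>?H\<^esub>}"
        using GH.engel_solvable[OF engH finH order_refl _ GH.one_is_normal solv] by blast
      then obtain m where m: "lower_central ?H m \<subseteq> {\<one>\<^bsub>?H\<^esub>}" by blast
      have "\<one>\<^bsub>?H\<^esub> \<in> lower_central ?H m"
        using GH.lower_central_normal[of m] normal_imp_subgroup subgroup.one_closed by blast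
      thus ?thesis using m by (intro exI[of _ m]) auto
    qed
  qed
  from this[OF subgroup_self] show ?thesis by simp
qed

lemma lower_central_quotient:
  assumes "N \<lhd> G" "lower_central (G Mod N) n = {N}"
  shows "lower_central G n \<subseteq> N"
proof -
  interpret N: normal N G by fact
  interpret Q: group "G Mod N" by (rule N.factorgroup_is_group)
  interpret h: group_hom G "G Mod N" "\<lambda>a. N #> a"
    using N.r_coset_hom_Mod by unfold_locales
  have hc: "N #> comm G x y = comm (G Mod N) (N #> x) (N #> y)"
    if "x \<in> carrier G" "y \<in> carrier G" for x y
    using that by (simp only: comm_def h.hom_mult h.hom_inv inv_closed m_closed)
  have "(\<lambda>a. N #> a) ` lower_central G k \<subseteq> lower_central (G Mod N) k" for k
  proof (induct k)
    case 0 show ?case using h.hom_closed by auto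
  next
    case (Suc k)
    define T where "T = {comm G x y |x y. x \<in> lower_central G k \<and> y \<in> carrier G}"
    have T: "T \<subseteq> carrier G"
      unfolding T_def using lower_central_carrier comm_closed by blast
    have "(\<lambda>a. N #> a) ` T \<subseteq> lower_central (G Mod N) (Suc k)"
    proof (rule image_subsetI)
      fix a assume "a \<in> T"
      then obtain x y where xy: "a = comm G x y" "x \<in> lower_central G k" "y \<in> carrier G"
        by (auto simp: T_def)
      have "N #> x \<in> lower_central (G Mod N) k" using Suc xy(2) by blast
      hence "comm (G Mod N) (N #> x) (N #> y) \<in> lower_central (G Mod N) (Suc k)"
        using Q.lower_central_comm h.hom_closed[OF xy(3)] by blast
      thus "N #> a \<in> lower_central (G Mod N) (Suc k)"
        unfolding xy(1) using hc[OF _ xy(3)] xy(2) lower_central_carrier[of k] by (metis subsetD)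
    qed
    hence "generate (G Mod N) ((\<lambda>a. N #> a) ` T) \<subseteq> lower_central (G Mod N) (Suc k)"
      using Q.lower_central_normal normal_imp_subgroup by (intro Q.generate_subgroup_incl) blast+
    thus ?case using h.generate_img[OF T] unfolding lower_central.simps(2) T_def by simp
  qed
  hence "N #> x = N" if "x \<in> lower_central G n" for x using that assms(2) by blast
  thus ?thesis using coset_join1[OF _ _ N.subgroup_axioms] lower_central_carrier by blast
qed

corollary engel_finite_index:
  assumes eng: "\<And>a b. a \<in> carrier G \<Longrightarrow> b \<in> carrier G \<Longrightarrow> \<exists>n. engel G n a b = \<one>"
    and N: "N \<lhd> G" and fin: "finite (rcosets N)"
  shows "\<exists>n. lower_central G n \<subseteq> N"
proof -
  interpret N: normal N G by fact
  interpret Q: group "G Mod N" by (rule N.factorgroup_is_group)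
  interpret h: group_hom G "G Mod N" "\<lambda>a. N #> a"
    using N.r_coset_hom_Mod by unfold_locales
  have hc: "N #> comm G x y = comm (G Mod N) (N #> x) (N #> y)"
    if "x \<in> carrier G" "y \<in> carrier G" for x y
    using that by (simp only: comm_def h.hom_mult h.hom_inv inv_closed m_closed)
  have he: "N #> engel G n x y = engel (G Mod N) n (N #> x) (N #> y)"
    if "x \<in> carrier G" "y \<in> carrier G" for n x y
    using that by (induct n) (simp_all add: hc)
  have "\<exists>n. lower_central (G Mod N) n = {\<one>\<^bsub>G Mod N\<^esub>}"
  proof (rule Q.finite_engel_nilpotent)
    show "finite (carrier (G Mod N))" using fin by (simp add: FactGroup_def)
    fix a b assume "a \<in> carrier (G Mod N)" "b \<in> carrier (G Mod N)"
    then obtain x y where xy: "x \<in> carrier G" "y \<in> carrier G" "a = N #> x" "b = N #> y"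
      by (auto simp: FactGroup_def RCOSETS_def)
    obtain n where "engel G n x y = \<one>" using eng xy by blast
    hence "engel (G Mod N) n a b = \<one>\<^bsub>G Mod N\<^esub>" using he[OF xy(1,2), of n] xy h.hom_one by simp
    thus "\<exists>n. engel (G Mod N) n a b = \<one>\<^bsub>G Mod N\<^esub>" by blast
  qed
  thus ?thesis using lower_central_quotient[OF N] by (auto simp: FactGroup_def)
qed

end

section \<open>Fields that are finitely generated as rings\<close>

text \<open>Values at \<open>x\<close> of polynomials of degree below \<open>n\<close> over
  \<open>C\<close>. Recording the degree bound in the set allows degree arguments without a
  polynomial ring, whether or not \<open>x\<close> is transcendental.\<close>

primrec pol :: "('a, 'b) ring_scheme \<Rightarrow> 'a set \<Rightarrow> 'a \<Rightarrow> nat \<Rightarrow> 'a set" where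
  "pol R C x 0 = {\<zero>\<^bsub>R\<^esub>}"
| "pol R C x (Suc n) = {u \<oplus>\<^bsub>R\<^esub> c \<otimes>\<^bsub>R\<^esub> x [^]\<^bsub>R\<^esub> n | u c. u \<in> pol R C x n \<and> c \<in> C}"

definition adjoin :: "('a, 'b) ring_scheme \<Rightarrow> 'a set \<Rightarrow> 'a \<Rightarrow> 'a set" where
  "adjoin R C x = (\<Union>n. pol R C x n)"

text \<open>Goldman's condition: inverting the single element \<open>e\<close> turns the domain \<open>C\<close> into a field. A
  field satisfies it, and it descends along the adjunction of one element.\<close>

definition goldman :: "('a, 'b) ring_scheme \<Rightarrow> 'a set \<Rightarrow> bool" where
  "goldman R C \<longleftrightarrow> (\<exists>e\<in>C - {\<zero>\<^bsub>R\<^esub>}. \<forall>y\<in>C - {\<zero>\<^bsub>R\<^esub>}. \<exists>k. \<exists>z\<in>C. e [^]\<^bsub>R\<^esub> (k::nat) = y \<otimes>\<^bsub>R\<^esub> z)"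

locale field_adjoin = field R for R (structure) +
  fixes C x
  assumes C: "subring C R" and x [simp]: "x \<in> carrier R"
begin

abbreviation "P \<equiv> pol R C x"

lemma C_closed [simp]:
  "c \<in> C \<Longrightarrow> c \<in> carrier R" "\<zero> \<in> C" "\<one> \<in> C" "c \<in> C \<Longrightarrow> d \<in> C \<Longrightarrow> c \<oplus> d \<in> C"
  "c \<in> C \<Longrightarrow> d \<in> C \<Longrightarrow> c \<otimes> d \<in> C" "c \<in> C \<Longrightarrow> \<ominus> c \<in> C"
  using subringE[OF C] by (blast, simp_all)

lemma C_pow [simp]: "c \<in> C \<Longrightarrow> c [^] (n::nat) \<in> C"
  by (induct n) auto

lemma P_SucI: "u \<in> P n \<Longrightarrow> c \<in> C \<Longrightarrow> u \<oplus> c \<otimes> x [^] n \<in> P (Suc n)" by auto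

lemma P_SucE:
  assumes "v \<in> P (Suc n)"
  obtains u c where "u \<in> P n" "c \<in> C" "v = u \<oplus> c \<otimes> x [^] n"
  using assms by auto

declare pol.simps(2) [simp del]

lemma P_carrier [simp]: "u \<in> P n \<Longrightarrow> u \<in> carrier R"
  by (induct n arbitrary: u) (auto elim!: P_SucE)

lemma P_zero [simp]: "\<zero> \<in> P n"
proof (induct n)
  case (Suc n) thus ?case using P_SucI[OF Suc C_closed(2)] by simp
qed simp

lemma P_Suc_mono: "u \<in> P n \<Longrightarrow> u \<in> P (Suc n)"
  using P_SucI[OF _ C_closed(2), of u n] by simp

lemma P_mono: "u \<in> P n \<Longrightarrow> n \<le> m \<Longrightarrow> u \<in> P m"
  by (induct m) (auto simp: le_Suc_eq P_Suc_mono)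

lemma P_add: "u \<in> P n \<Longrightarrow> v \<in> P n \<Longrightarrow> u \<oplus> v \<in> P n"
proof (induct n arbitrary: u v)
  case (Suc n)
  obtain u' c v' d where *: "u' \<in> P n" "c \<in> C" "u = u' \<oplus> c \<otimes> x [^] n"
      "v' \<in> P n" "d \<in> C" "v = v' \<oplus> d \<otimes> x [^] n"
    using Suc(2,3) by (auto elim!: P_SucE)
  hence "u \<oplus> v = (u' \<oplus> v') \<oplus> (c \<oplus> d) \<otimes> x [^] n" by (simp add: cring_simprules)
  thus ?case using * Suc(1) P_SucI by simp
qed simp

lemma P_scale: "u \<in> P n \<Longrightarrow> d \<in> C \<Longrightarrow> d \<otimes> u \<in> P n"
proof (induct n arbitrary: u)
  case (Suc n)
  obtain u' c where *: "u' \<in> P n" "c \<in> C" "u = u' \<oplus> c \<otimes> x [^] n" using Suc(2) by (rule P_SucE)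
  hence "d \<otimes> u = d \<otimes> u' \<oplus> (d \<otimes> c) \<otimes> x [^] n" using Suc(3) by (simp add: cring_simprules)
  thus ?case using * Suc P_SucI by simp
qed simp

lemma P_neg: "u \<in> P n \<Longrightarrow> \<ominus> u \<in> P n"
  using P_scale[of u n "\<ominus> \<one>"] by (simp add: l_minus)

lemma P_minus: "u \<in> P n \<Longrightarrow> v \<in> P n \<Longrightarrow> u \<ominus> v \<in> P n"
  unfolding a_minus_def by (intro P_add P_neg)

lemma P_x: "u \<in> P n \<Longrightarrow> x \<otimes> u \<in> P (Suc n)"
proof (induct n arbitrary: u)
  case 0 thus ?case using P_zero[of 1] by simp
next
  case (Suc n)
  obtain u' c where *: "u' \<in> P n" "c \<in> C" "u = u' \<oplus> c \<otimes> x [^] n" using Suc(2) by (rule P_SucE)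
  hence "x \<otimes> u = x \<otimes> u' \<oplus> c \<otimes> x [^] Suc n" by (simp add: cring_simprules)
  thus ?case using P_SucI[OF Suc(1)[OF *(1)] *(2)] by (simp only:)
qed

lemma P_xpow: "u \<in> P n \<Longrightarrow> x [^] k \<otimes> u \<in> P (n + k)"
proof (induct k)
  case (Suc k)
  have "x [^] Suc k \<otimes> u = x \<otimes> (x [^] k \<otimes> u)" using Suc(2) by (simp add: m_ac)
  thus ?case using P_x[OF Suc(1)[OF Suc(2)]] by simp
qed simp

lemma C_P: "c \<in> C \<Longrightarrow> c \<in> P (Suc n)"
  using P_SucI[OF P_zero, of c 0] P_mono[of c 1 "Suc n"] by simp

lemma P_mult: "u \<in> P n \<Longrightarrow> v \<in> P m \<Longrightarrow> u \<otimes> v \<in> P (n + m)"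
proof (induct m arbitrary: v)
  case 0 thus ?case using P_zero by simp
next
  case (Suc m)
  obtain v' c where *: "v' \<in> P m" "c \<in> C" "v = v' \<oplus> c \<otimes> x [^] m" using Suc(3) by (rule P_SucE)
  have "u \<otimes> v = u \<otimes> v' \<oplus> c \<otimes> (x [^] m \<otimes> u)" using * Suc(2) by (simp add: cring_simprules)
  moreover have "c \<otimes> (x [^] m \<otimes> u) \<in> P (n + m)" using * Suc(2) by (intro P_scale P_xpow)
  ultimately have "u \<otimes> v \<in> P (n + m)" using P_add Suc(1)[OF Suc(2) *(1)] by simp
  thus ?case using P_Suc_mono by simp
qed

lemma adjoin_subring: "subring (adjoin R C x) R"
proof (rule subringI)
  have cmp: "\<exists>n. u \<in> P n \<and> v \<in> P n" if "u \<in> adjoin R C x" "v \<in> adjoin R C x" for u v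
  proof -
    obtain n m where "u \<in> P n" "v \<in> P m" using \<open>u \<in> _\<close> \<open>v \<in> _\<close> by (auto simp: adjoin_def)
    thus ?thesis using P_mono[of u n "max n m"] P_mono[of v m "max n m"] by auto
  qed
  show "adjoin R C x \<subseteq> carrier R" by (auto simp: adjoin_def)
  show "\<one> \<in> adjoin R C x" using C_P[of \<one>] by (auto simp: adjoin_def)
  show "\<ominus> u \<in> adjoin R C x" if "u \<in> adjoin R C x" for u using that P_neg by (auto simp: adjoin_def)
  show "u \<otimes> v \<in> adjoin R C x" if "u \<in> adjoin R C x" "v \<in> adjoin R C x" for u v
    using cmp[OF that] P_mult unfolding adjoin_def by blast
  show "u \<oplus> v \<in> adjoin R C x" if "u \<in> adjoin R C x" "v \<in> adjoin R C x" for u v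
    using cmp[OF that] P_add unfolding adjoin_def by blast
qed

lemma C_adjoin: "C \<subseteq> adjoin R C x" using C_P by (auto simp: adjoin_def)

lemma x_adjoin: "x \<in> adjoin R C x"
  using P_x[OF C_P[of \<one> 0]] by (auto simp: adjoin_def)

lemma P_leading:
  assumes "v \<in> P n" "v \<noteq> \<zero>"
  obtains s u a where "v = u \<oplus> a \<otimes> x [^] s" "u \<in> P s" "a \<in> C" "a \<noteq> \<zero>" "s < n"
  using assms
proof (induct n arbitrary: thesis)
  case (Suc n)
  obtain u c where *: "u \<in> P n" "c \<in> C" "v = u \<oplus> c \<otimes> x [^] n" using Suc(3) by (rule P_SucE)
  show ?case
  proof (cases "c = \<zero>")
    case True
    hence "v \<in> P n" using * by simp
    then obtain s u' a where "v = u' \<oplus> a \<otimes> x [^] s" "u' \<in> P s" "a \<in> C" "a \<noteq> \<zero>" "s < n"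
      using Suc(1) Suc(4) by blast
    thus ?thesis using Suc(2)[of u' a s] by simp
  next
    case False
    thus ?thesis using Suc(2)[of u c n] * by simp
  qed
qed simp

text \<open>The leading coefficient is required to be nonzero rather than 1, because
  \<open>C\<close> is a domain and in general not a field.\<close>

definition algebraic_at :: "nat \<Rightarrow> bool" where
  "algebraic_at n \<longleftrightarrow> (\<exists>u\<in>P n. \<exists>a\<in>C - {\<zero>}. u \<oplus> a \<otimes> x [^] n = \<zero>)"

text \<open>Euclid's argument with \<open>y = \<one> \<oplus> x \<otimes> c\<close>, where
  \<open>c\<close> is the element to be inverted. Modulo \<open>y\<close> the powers of
  \<open>x \<otimes> c\<close> are signs, so if \<open>y\<close> divides a power of
  \<open>c\<close>, it is a unit. But \<open>y\<close> has positive degree, and the leading term of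
  \<open>y \<otimes> v = \<one>\<close> is then an algebraic relation for \<open>x\<close>.\<close>

lemma transcendental_not_goldman:
  assumes tr: "\<And>n. \<not> algebraic_at n" and g: "goldman R (adjoin R C x)"
  shows False
proof -
  interpret S: subring "adjoin R C x" R by (rule adjoin_subring)
  obtain c where c: "c \<in> adjoin R C x" "c \<noteq> \<zero>"
    and div: "\<And>y. y \<in> adjoin R C x \<Longrightarrow> y \<noteq> \<zero> \<Longrightarrow> \<exists>k. \<exists>z\<in>adjoin R C x. c [^] (k::nat) = y \<otimes> z"
    using g by (auto simp: goldman_def)
  have sub: "a \<in> carrier R" if "a \<in> adjoin R C x" for a using that S.subset by auto
  obtain m where "c \<in> P m" using c by (auto simp: adjoin_def)
  then obtain s u a where l: "c = u \<oplus> a \<otimes> x [^] s" "u \<in> P s" "a \<in> C" "a \<noteq> \<zero>"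
    using P_leading c(2) by metis
  define p where "p = \<one> \<oplus> x \<otimes> u"
  have p: "p \<in> P (Suc s)" unfolding p_def using C_P P_x l P_add by simp
  define y where "y = \<one> \<oplus> x \<otimes> c"
  have y: "y = p \<oplus> a \<otimes> x [^] Suc s" unfolding y_def p_def l(1) using l
    by (simp add: cring_simprules)
  have "y \<noteq> \<zero>" using tr[of "Suc s"] p l y by (auto simp: algebraic_at_def)
  moreover have yS: "y \<in> adjoin R C x" unfolding y_def using c x_adjoin
    by (simp add: subringE[OF adjoin_subring])
  ultimately obtain k z where kz: "z \<in> adjoin R C x" "c [^] (k::nat) = y \<otimes> z" using div by blast
  have cc: "c \<in> carrier R" "y \<in> carrier R" "z \<in> carrier R" using sub c yS kz by auto
  have xk: "x [^] (i::nat) \<in> adjoin R C x" for i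
    by (induct i) (use x_adjoin in \<open>simp_all add: subringE[OF adjoin_subring]\<close>)
  have xc: "x \<otimes> c = y \<ominus> \<one>"
  proof -
    have "y = x \<otimes> c \<oplus> \<one>" unfolding y_def using cc by (simp add: a_comm)
    thus ?thesis using cc by (simp add: a_minus_def a_assoc r_neg)
  qed
  have "\<exists>w\<in>adjoin R C x. \<exists>\<epsilon>\<in>{\<one>, \<ominus> \<one>}. (x \<otimes> c) [^] (i::nat) = y \<otimes> w \<oplus> \<epsilon>" for i
  proof (induct i)
    case 0 show ?case
      by (rule bexI[of _ \<zero>], rule bexI[of _ \<one>]) (use cc in \<open>auto simp: subringE[OF adjoin_subring]\<close>)
  next
    case (Suc i)
    then obtain w \<epsilon> where w: "w \<in> adjoin R C x" "\<epsilon> \<in> {\<one>, \<ominus> \<one>}" "(x \<otimes> c) [^] i = y \<otimes> w \<oplus> \<epsilon>" by blast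
    have wc: "w \<in> carrier R" "\<epsilon> \<in> carrier R" "\<epsilon> \<in> adjoin R C x"
      using sub w by (auto simp: subringE[OF adjoin_subring])
    have "(x \<otimes> c) [^] Suc i = (y \<otimes> w \<oplus> \<epsilon>) \<otimes> (y \<ominus> \<one>)" using w xc by simp
    also have "\<dots> = y \<otimes> (w \<otimes> y \<oplus> \<epsilon> \<oplus> \<ominus> w) \<oplus> \<ominus> \<epsilon>"
      using cc wc by (simp add: cring_simprules a_minus_def)
    finally have e: "(x \<otimes> c) [^] Suc i = y \<otimes> (w \<otimes> y \<oplus> \<epsilon> \<oplus> \<ominus> w) \<oplus> \<ominus> \<epsilon>" .
    have 1: "w \<otimes> y \<oplus> \<epsilon> \<oplus> \<ominus> w \<in> adjoin R C x" using w wc yS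
      by (simp add: subringE[OF adjoin_subring])
    have 2: "\<ominus> \<epsilon> \<in> {\<one>, \<ominus> \<one>}" using w(2) by auto
    show ?case by (rule bexI[OF _ 1], rule bexI[OF _ 2]) (rule e)
  qed
  then obtain w \<epsilon> where w: "w \<in> adjoin R C x" "\<epsilon> \<in> {\<one>, \<ominus> \<one>}" "(x \<otimes> c) [^] k = y \<otimes> w \<oplus> \<epsilon>" by blast
  have wc: "w \<in> carrier R" "\<epsilon> \<in> carrier R" "\<epsilon> \<in> adjoin R C x" "\<epsilon> \<otimes> \<epsilon> = \<one>"
    using sub w by (auto simp: subringE[OF adjoin_subring] l_minus)
  define v where "v = \<epsilon> \<otimes> (x [^] k \<otimes> z \<ominus> w)"
  have vS: "v \<in> adjoin R C x" unfolding v_def a_minus_def using w wc kz xk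
    by (simp add: subringE[OF adjoin_subring])
  have "(x \<otimes> c) [^] k = x [^] k \<otimes> (y \<otimes> z)" using cc kz by (simp add: nat_pow_distrib)
  hence e1: "y \<otimes> w \<oplus> \<epsilon> = x [^] k \<otimes> (y \<otimes> z)" using w(3) by simp
  have "y \<otimes> v = \<epsilon> \<otimes> (x [^] k \<otimes> (y \<otimes> z) \<ominus> y \<otimes> w)"
    unfolding v_def using cc wc by (simp add: cring_simprules a_minus_def)
  also have "\<dots> = \<epsilon> \<otimes> (y \<otimes> w \<oplus> \<epsilon> \<ominus> y \<otimes> w)" by (simp only: e1)
  also have "\<dots> = \<epsilon> \<otimes> \<epsilon>" using cc wc by (simp add: cring_simprules a_minus_def a_ac)
  finally have yv: "y \<otimes> v = \<one>" using wc by simp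
  have "v \<noteq> \<zero>" using yv cc by auto
  obtain m' where "v \<in> P m'" using vS by (auto simp: adjoin_def)
  then obtain t u' b where r: "v = u' \<oplus> b \<otimes> x [^] t" "u' \<in> P t" "b \<in> C" "b \<noteq> \<zero>"
    using P_leading \<open>v \<noteq> \<zero>\<close> by metis
  \<comment> \<open>\<open>q\<close> collects the terms of
    \<open>y \<otimes> v \<ominus> \<one>\<close> below the leading term, whose coefficient is
    \<open>a \<otimes> b\<close>.\<close>
  define q where "q = p \<otimes> u' \<oplus> b \<otimes> (x [^] t \<otimes> p) \<oplus> a \<otimes> (x [^] Suc s \<otimes> u') \<oplus> \<ominus> \<one>"
  have c1: "p \<in> carrier R" "u' \<in> carrier R" "a \<in> carrier R" "b \<in> carrier R" using p r l by auto
  have "p \<otimes> u' \<in> P (Suc s + t)" using P_mult[OF p r(2)] by simp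
  moreover have "b \<otimes> (x [^] t \<otimes> p) \<in> P (Suc s + t)" using P_scale[OF P_xpow[OF p] r(3)] by simp
  moreover have "a \<otimes> (x [^] Suc s \<otimes> u') \<in> P (Suc s + t)"
    using P_scale[OF P_xpow[OF r(2)] l(3), of "Suc s"] by (simp add: add.commute)
  moreover have "\<ominus> \<one> \<in> P (Suc s + t)" using C_P by simp
  ultimately have q: "q \<in> P (Suc s + t)" unfolding q_def by (intro P_add)
  have "y \<otimes> v \<oplus> \<ominus> \<one> = q \<oplus> (a \<otimes> b) \<otimes> x [^] (Suc s + t)"
    unfolding y r(1) q_def nat_pow_mult[OF x, symmetric] using c1
    by (simp add: cring_simprules del: nat_pow_Suc)
  hence "q \<oplus> (a \<otimes> b) \<otimes> x [^] (Suc s + t) = \<zero>" using yv by (simp add: r_neg)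
  moreover have "a \<otimes> b \<in> C - {\<zero>}" using l r by (simp add: integral_iff)
  ultimately have "algebraic_at (Suc s + t)" using q unfolding algebraic_at_def by blast
  thus False using tr by blast
qed

text \<open>The relation replaces \<open>a \<otimes> x [^] n\<close> by a polynomial of degree below
  \<open>n\<close>, so a factor \<open>a\<close> removes the top term of a polynomial of degree at
  least \<open>n\<close>.\<close>

lemma algebraic_reduce:
  assumes a: "a \<in> C" and u: "u \<in> P n" and rel: "u \<oplus> a \<otimes> x [^] n = \<zero>"
  shows "v \<in> P s \<Longrightarrow> \<exists>N. a [^] (N::nat) \<otimes> v \<in> P n"
proof (induct s arbitrary: v)
  case 0
  thus ?case by (auto intro!: exI[of _ 0])
next
  case (Suc s)
  obtain w c where w: "w \<in> P s" "c \<in> C" "v = w \<oplus> c \<otimes> x [^] s" using Suc(2) by (rule P_SucE)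
  show ?case
  proof (cases "s < n")
    case True
    hence "v \<in> P n" using P_mono[OF Suc(2)] by simp
    thus ?thesis by (intro exI[of _ 0]) simp
  next
    case False
    then obtain d where d: "s = n + d" using le_Suc_ex not_less by blast
    have cl: "a \<in> carrier R" "c \<in> carrier R" "u \<in> carrier R" "w \<in> carrier R" using a u w by auto
    have "\<ominus> u = a \<otimes> x [^] n" using rel cl by (simp add: minus_equality a_comm)
    hence "a \<otimes> v = a \<otimes> w \<oplus> c \<otimes> (x [^] d \<otimes> (\<ominus> u))"
      unfolding w(3) d nat_pow_mult[OF x, symmetric] using cl by (simp add: cring_simprules)
    moreover have "c \<otimes> (x [^] d \<otimes> (\<ominus> u)) \<in> P s"
      using P_scale[OF P_xpow[OF P_neg[OF u], of d] w(2)] d by simp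
    ultimately have "a \<otimes> v \<in> P s" using P_add P_scale[OF w(1) a] by simp
    then obtain N where "a [^] (N::nat) \<otimes> (a \<otimes> v) \<in> P n" using Suc(1) by blast
    moreover have "v \<in> carrier R" using w cl by simp
    ultimately have "a [^] Suc N \<otimes> v \<in> P n" using cl by (simp add: m_assoc)
    thus ?thesis by blast
  qed
qed

text \<open>Division with remainder by \<open>v\<close>. Its leading coefficient \<open>b\<close>
  may fail to be invertible in \<open>C\<close>, so the dividend is first multiplied by a power of
  \<open>b\<close>.\<close>

lemma pseudo_division:
  assumes v: "v = q \<oplus> b \<otimes> x [^] j" "q \<in> P j" "b \<in> C"
  shows "z \<in> P (j + t) \<Longrightarrow> \<exists>N. \<exists>w\<in>P t. b [^] (N::nat) \<otimes> z \<ominus> v \<otimes> w \<in> P j"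
proof (induct t arbitrary: z)
  case 0
  have "v \<in> carrier R" using v by simp
  thus ?case using 0 by (intro exI[of _ 0] bexI[of _ \<zero>]) (auto simp: a_minus_def)
next
  case (Suc t)
  obtain u c where u: "u \<in> P (j + t)" "c \<in> C" "z = u \<oplus> c \<otimes> x [^] (j + t)"
    using Suc(2) P_SucE[of z "j + t"] by auto
  have cl: "q \<in> carrier R" "b \<in> carrier R" "c \<in> carrier R" "u \<in> carrier R" using v u by auto
  have vc: "v \<in> carrier R" using v cl by simp
  have e: "b \<otimes> z \<ominus> v \<otimes> (c \<otimes> x [^] t) = b \<otimes> u \<ominus> c \<otimes> (x [^] t \<otimes> q)"
    unfolding v(1) u(3) nat_pow_mult[OF x, symmetric] using cl
      by (simp add: cring_simprules a_minus_def)
  have "c \<otimes> (x [^] t \<otimes> q) \<in> P (j + t)" using P_scale[OF P_xpow[OF v(2)] u(2)] .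
  hence "b \<otimes> z \<ominus> v \<otimes> (c \<otimes> x [^] t) \<in> P (j + t)"
    unfolding e using P_minus[OF P_scale[OF u(1) v(3)]] by blast
  then obtain N w where w: "w \<in> P t"
    "b [^] (N::nat) \<otimes> (b \<otimes> z \<ominus> v \<otimes> (c \<otimes> x [^] t)) \<ominus> v \<otimes> w \<in> P j"
    using Suc(1) by blast
  have zc: "z \<in> carrier R" "w \<in> carrier R" using Suc(2) w by auto
  have "b [^] (N::nat) \<otimes> (b \<otimes> z \<ominus> v \<otimes> (c \<otimes> x [^] t)) \<ominus> v \<otimes> w =
      b [^] Suc N \<otimes> z \<ominus> v \<otimes> (w \<oplus> (b [^] N \<otimes> c) \<otimes> x [^] t)"
    using cl zc vc by (simp add: cring_simprules a_minus_def)
  moreover have "w \<oplus> (b [^] N \<otimes> c) \<otimes> x [^] t \<in> P (Suc t)"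
    using P_SucI[OF w(1)] v(3) u(2) by simp
  ultimately show ?case using w(2) by (metis (no_types, lifting))
qed

text \<open>Since \<open>x\<close> is algebraic, the ideal \<open>J\<close> generated by
  \<open>c\<close> contains some nonzero \<open>b\<close> of \<open>C\<close>. The element for
  \<open>C\<close> is \<open>a \<otimes> b\<close>: a power of \<open>b\<close> is a multiple of the
  given \<open>y\<close> in the larger ring, and a power of the leading coefficient \<open>a\<close>
  brings the cofactor to degree below \<open>n\<close>, where constant coefficients can be
  compared.\<close>

lemma goldman_descend:
  assumes alg: "algebraic_at n0" and g: "goldman R (adjoin R C x)"
  shows "goldman R C"
proof -
  define n where "n = (LEAST n. algebraic_at n)"
  have "algebraic_at n" unfolding n_def using alg by (rule LeastI)
  then obtain u a where ua: "u \<in> P n" "a \<in> C" "a \<noteq> \<zero>" "u \<oplus> a \<otimes> x [^] n = \<zero>"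
    by (auto simp: algebraic_at_def)
  have indep: "c = \<zero>" if "s < n" "w \<in> P s" "c \<in> C" "w \<oplus> c \<otimes> x [^] s = \<zero>" for s w c
    using not_less_Least[of s algebraic_at] that unfolding n_def algebraic_at_def by blast
  have "n \<noteq> 0" using ua by (cases n) auto
  then obtain n' where n': "n = Suc n'" by (cases n) auto
  \<comment> \<open>Below the least degree \<open>n\<close> of a relation the powers of
    \<open>x\<close> are independent over \<open>C\<close>, so a vanishing polynomial has constant
    coefficient zero.\<close>
  have const: "d = \<zero>" if "r \<in> P m" "m < n" "d \<in> C" "d \<oplus> x \<otimes> r = \<zero>" for d r m
    using that
  proof (induct m arbitrary: r)
    case 0 thus ?case by simp
  next
    case (Suc m)
    obtain r' c where r: "r' \<in> P m" "c \<in> C" "r = r' \<oplus> c \<otimes> x [^] m" using Suc(2) by (rule P_SucE)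
    have "(d \<oplus> x \<otimes> r') \<oplus> c \<otimes> x [^] Suc m = d \<oplus> x \<otimes> r"
      unfolding r(3) using r Suc(4) by (simp add: cring_simprules)
    hence "(d \<oplus> x \<otimes> r') \<oplus> c \<otimes> x [^] Suc m = \<zero>" using Suc(5) by simp
    moreover have "d \<oplus> x \<otimes> r' \<in> P (Suc m)" using P_add[OF C_P[OF Suc(4)] P_x[OF r(1)]] .
    ultimately have "c = \<zero>" using indep[OF Suc(3) _ r(2)] by blast
    hence "r = r'" using r by simp
    thus ?case using Suc r by simp
  qed
  interpret S: subring "adjoin R C x" R by (rule adjoin_subring)
  note Ssimps = subringE[OF adjoin_subring]
  obtain c where c: "c \<in> adjoin R C x" "c \<noteq> \<zero>"
    and div: "\<And>y. y \<in> adjoin R C x \<Longrightarrow> y \<noteq> \<zero> \<Longrightarrow> \<exists>k. \<exists>z\<in>adjoin R C x. c [^] (k::nat) = y \<otimes> z"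
    using g by (auto simp: goldman_def)
  have sub: "w \<in> carrier R" if "w \<in> adjoin R C x" for w using that S.subset by auto
  have red: "\<exists>N. a [^] (N::nat) \<otimes> v \<in> P n" if "v \<in> adjoin R C x" for v
    using algebraic_reduce[OF ua(2,1,4)] that by (auto simp: adjoin_def)
  have nz_pow: "d [^] (N::nat) \<noteq> \<zero>" if "d \<noteq> \<zero>" "d \<in> carrier R" for d N
    using that by (induct N) (auto simp: integral_iff)
  define J where "J = {v. \<exists>w\<in>adjoin R C x. v = c \<otimes> w}"
  define Q where "Q j \<longleftrightarrow> (\<exists>v\<in>P (Suc j) \<inter> J. v \<noteq> \<zero>)" for j
  obtain N where N: "a [^] (N::nat) \<otimes> c \<in> P n" using red[OF c(1)] by blast
  have "a [^] N \<otimes> c \<noteq> \<zero>" using nz_pow[OF ua(3)] ua(2) c sub by (simp add: integral_iff)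
  moreover have aN: "a [^] k \<in> adjoin R C x" for k :: nat
    by (rule subsetD[OF C_adjoin C_pow[OF ua(2)]])
  have "a [^] N \<otimes> c = c \<otimes> a [^] N" using sub[OF aN] sub[OF c(1)] by (rule m_comm)
  hence "a [^] N \<otimes> c \<in> J" unfolding J_def using aN[of N] by auto
  ultimately have "Q n'" using N unfolding Q_def n' by blast
  \<comment> \<open>\<open>j\<close> is the least degree in which a nonzero element of
    \<open>J\<close> can be written; the aim is to show that it is 0.\<close>
  define j where "j = (LEAST j. Q j)"
  have Qj: "Q j" unfolding j_def using \<open>Q n'\<close> by (rule LeastI)
  have jn: "j \<le> n'" unfolding j_def using \<open>Q n'\<close> by (rule Least_le)
  have jmin: "v = \<zero>" if "v \<in> P j" "v \<in> J" for v
  proof (cases j)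
    case 0 thus ?thesis using that by simp
  next
    case (Suc i)
    hence "\<not> Q i" using not_less_Least[of i Q] unfolding j_def by simp
    thus ?thesis using that Suc unfolding Q_def by blast
  qed
  obtain v where v: "v \<in> P (Suc j)" "v \<in> J" "v \<noteq> \<zero>" using Qj by (auto simp: Q_def)
  obtain q b where qb: "q \<in> P j" "b \<in> C" "v = q \<oplus> b \<otimes> x [^] j" using v(1) by (rule P_SucE)
  have "b \<noteq> \<zero>"
  proof
    assume "b = \<zero>"
    hence "v = q" using qb by simp
    thus False using jmin qb v by simp
  qed
  have bj: "\<exists>b\<in>C - {\<zero>}. \<exists>w\<in>adjoin R C x. b = c \<otimes> w"
  proof (cases "j = 0")
    case True
    hence "v = b" using qb by simp
    thus ?thesis using v qb unfolding J_def by blast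
  next
    case False
    define t where "t = n - j"
    have t: "n = j + t" "t < n" using jn n' False by (auto simp: t_def)
    have cl: "q \<in> carrier R" "b \<in> carrier R" "a \<in> carrier R" "u \<in> carrier R" "v \<in> carrier R"
      using qb ua v by auto
    have e: "b \<otimes> u \<ominus> a \<otimes> (x [^] t \<otimes> q) = b \<otimes> (u \<oplus> a \<otimes> x [^] n) \<ominus> v \<otimes> (a \<otimes> x [^] t)"
      unfolding qb(3) t(1) nat_pow_mult[OF x, symmetric] using cl
        by (simp add: cring_simprules a_minus_def)
    \<comment> \<open>The relation of degree \<open>n\<close> has value zero, so its pseudo-division
      by \<open>v\<close> leaves a remainder that is a multiple of \<open>v\<close>, of degree below
      \<open>j\<close>, and hence zero. As \<open>v\<close> is not zero, the quotient
      \<open>w'\<close> vanishes: a relation of degree \<open>t < n\<close> with leading coefficient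
      \<open>b [^] N \<otimes> a\<close>, against the choice of \<open>n\<close>.\<close>
    define z where "z = \<ominus> (v \<otimes> (a \<otimes> x [^] t))"
    have z: "z = b \<otimes> u \<ominus> a \<otimes> (x [^] t \<otimes> q)"
      unfolding e ua(4) z_def using cl by (simp add: a_minus_def)
    have "a \<otimes> (x [^] t \<otimes> q) \<in> P n" using P_scale[OF P_xpow[OF qb(1)] ua(2)] t(1) by simp
    hence "z \<in> P (j + t)" unfolding z using P_minus[OF P_scale[OF ua(1) qb(2)]] t(1) by simp
    then obtain N w where w: "w \<in> P t" "b [^] (N::nat) \<otimes> z \<ominus> v \<otimes> w \<in> P j"
      using pseudo_division[OF qb(3,1,2)] by blast
    define w' where "w' = w \<oplus> (b [^] N \<otimes> a) \<otimes> x [^] t"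
    have w'P: "w' \<in> P (Suc t)" unfolding w'_def using P_SucI[OF w(1)] qb ua by simp
    have wc: "w \<in> carrier R" "w' \<in> carrier R" using w w'P by auto
    have e2: "b [^] N \<otimes> z \<ominus> v \<otimes> w = v \<otimes> (\<ominus> w')"
      unfolding z_def w'_def using cl wc by (simp add: cring_simprules a_minus_def)
    obtain w0 where w0: "w0 \<in> adjoin R C x" "v = c \<otimes> w0" using v by (auto simp: J_def)
    have w'S: "\<ominus> w' \<in> adjoin R C x" using P_neg[OF w'P] by (auto simp: adjoin_def)
    hence "w0 \<otimes> (\<ominus> w') \<in> adjoin R C x" using w0 Ssimps by blast
    moreover have "v \<otimes> (\<ominus> w') = c \<otimes> (w0 \<otimes> (\<ominus> w'))"
      using w0 sub c wc by (simp add: m_assoc)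
    ultimately have "v \<otimes> (\<ominus> w') \<in> J" unfolding J_def by blast
    hence "v \<otimes> (\<ominus> w') = \<zero>" using jmin w(2) e2 by simp
    hence "w' = \<zero>" using v(3) cl wc integral[of v "\<ominus> w'"]
      by (metis a_inv_closed minus_minus minus_zero)
    hence "b [^] N \<otimes> a = \<zero>"
      using indep[OF t(2) w(1), of "b [^] N \<otimes> a"] qb ua unfolding w'_def by simp
    hence False using nz_pow[OF \<open>b \<noteq> \<zero>\<close>] cl ua(3) by (simp add: integral_iff)
    thus ?thesis ..
  qed
  then obtain b w where b: "b \<in> C" "b \<noteq> \<zero>" "w \<in> adjoin R C x" "b = c \<otimes> w" by blast
  have main: "\<exists>k. \<exists>z\<in>C. (a \<otimes> b) [^] (k::nat) = y \<otimes> z" if y: "y \<in> C" "y \<noteq> \<zero>" for y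
  proof -
    have cl: "a \<in> carrier R" "b \<in> carrier R" "c \<in> carrier R" "w \<in> carrier R" "y \<in> carrier R"
      using ua b c y sub by auto
    obtain k z where kz: "z \<in> adjoin R C x" "c [^] (k::nat) = y \<otimes> z" using div[of y] y C_adjoin
      by blast
    have wk: "w [^] i \<in> adjoin R C x" for i :: nat by (induct i) (use b Ssimps in auto)
    define v where "v = z \<otimes> w [^] k"
    have vS: "v \<in> adjoin R C x" unfolding v_def using kz wk Ssimps by blast
    have zc: "z \<in> carrier R" "v \<in> carrier R" using kz vS sub by auto
    have bk: "b [^] k = y \<otimes> v" unfolding b(4) v_def using cl kz zc
      by (simp add: nat_pow_distrib m_assoc)
    obtain N where "a [^] (N::nat) \<otimes> v \<in> P n" using red[OF vS] by blast
    then obtain r where r: "a [^] N \<otimes> v = r" "r \<in> P n" by blast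
    have dec: "\<exists>r0\<in>C. \<exists>r'\<in>P m. r = r0 \<oplus> x \<otimes> r'" if "r \<in> P (Suc m)" for r m
      using that
    proof (induct m arbitrary: r)
      case 0
      thus ?case by (force elim!: P_SucE)
    next
      case (Suc m)
      obtain r1 c1 where r1: "r1 \<in> P (Suc m)" "c1 \<in> C" "r = r1 \<oplus> c1 \<otimes> x [^] Suc m" using Suc(2)
        by (rule P_SucE)
      obtain r0 r' where r0: "r0 \<in> C" "r' \<in> P m" "r1 = r0 \<oplus> x \<otimes> r'" using Suc(1)[OF r1(1)] by blast
      have "r = r0 \<oplus> x \<otimes> (r' \<oplus> c1 \<otimes> x [^] m)"
        unfolding r1(3) r0(3) using r0 r1 by (simp add: cring_simprules)
      thus ?case using r0(1) P_SucI[OF r0(2) r1(2)] by blast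
    qed
    obtain r0 r' where r0: "r0 \<in> C" "r' \<in> P n'" "r = r0 \<oplus> x \<otimes> r'" using dec r(2) n' by blast
    have rc: "r0 \<in> carrier R" "r' \<in> carrier R" using r0 by auto
    have e: "a [^] N \<otimes> b [^] k = y \<otimes> r" unfolding bk r(1)[symmetric] using cl zc by (simp add: m_ac)
    \<comment> \<open>Both sides have degree below \<open>n\<close>, so comparing constant
      coefficients replaces the cofactor \<open>r\<close> by \<open>r0\<close>, which lies in
      \<open>C\<close>.\<close>
    have "(y \<otimes> r0 \<ominus> a [^] N \<otimes> b [^] k) \<oplus> x \<otimes> (y \<otimes> r') = y \<otimes> r \<ominus> a [^] N \<otimes> b [^] k"
      unfolding r0(3) using cl rc by (simp add: cring_simprules a_minus_def)
    also have "\<dots> = \<zero>" unfolding e[symmetric] using cl by (simp add: a_minus_def r_neg)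
    finally have "y \<otimes> r0 \<ominus> a [^] N \<otimes> b [^] k = \<zero>"
      using const[OF P_scale[OF r0(2) y(1)], of "y \<otimes> r0 \<ominus> a [^] N \<otimes> b [^] k"] n' y r0 ua b
      by (simp add: a_minus_def)
    hence e': "a [^] N \<otimes> b [^] k = y \<otimes> r0" using cl rc
      by (metis (no_types, lifting) m_closed minus_equality nat_pow_closed r_right_minus_eq)
    have "(a \<otimes> b) [^] (N + k) = (a [^] N \<otimes> b [^] k) \<otimes> (a [^] k \<otimes> b [^] N)"
      using cl by (simp add: nat_pow_distrib nat_pow_mult[symmetric] m_ac)
    also have "\<dots> = y \<otimes> (r0 \<otimes> (a [^] k \<otimes> b [^] N))" unfolding e' using cl rc by (simp add: m_assoc)
    finally show ?thesis using r0(1) ua(2) b(1) by (metis C_closed(5) C_pow)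
  qed
  show ?thesis unfolding goldman_def
    by (rule bexI[of _ "a \<otimes> b"]) (use main ua b in \<open>auto simp: integral_iff\<close>)
qed

text \<open>In a finite domain the leading coefficient of the relation is invertible, so every
  polynomial reduces to one of degree below \<open>n\<close>.\<close>

lemma finite_adjoin:
  assumes fin: "finite C" and alg: "algebraic_at n"
  shows "finite (adjoin R C x)"
proof -
  obtain u a where ua: "u \<in> P n" "a \<in> C" "a \<noteq> \<zero>" "u \<oplus> a \<otimes> x [^] n = \<zero>"
    using alg by (auto simp: algebraic_at_def)
  have "inj_on (\<lambda>c. a \<otimes> c) C" using ua by (auto simp: inj_on_def m_lcancel)
  hence "(\<lambda>c. a \<otimes> c) ` C = C" using fin ua by (intro endo_inj_surj) auto
  then obtain a' where a': "a' \<in> C" "a \<otimes> a' = \<one>" using C_closed(3) by (metis imageE)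
  have "adjoin R C x \<subseteq> P n"
  proof
    fix v assume v: "v \<in> adjoin R C x"
    then obtain N where N: "a [^] (N::nat) \<otimes> v \<in> P n"
      using algebraic_reduce[OF ua(2,1,4)] by (auto simp: adjoin_def)
    have vc: "v \<in> carrier R" using v by (auto simp: adjoin_def)
    have "(a' \<otimes> a) [^] N = \<one>" using a' ua m_comm by simp
    hence "a' [^] N \<otimes> (a [^] N \<otimes> v) = v"
      using a' ua vc by (simp add: nat_pow_distrib m_assoc[symmetric])
    thus "v \<in> P n" using P_scale[OF N, of "a' [^] N"] a' by simp
  qed
  moreover have "finite (P m)" for m
  proof (induct m)
    case (Suc m)
    have "P (Suc m) \<subseteq> (\<lambda>(u, c). u \<oplus> c \<otimes> x [^] m) ` (P m \<times> C)" by (auto elim!: P_SucE)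
    thus ?case using Suc fin by (meson finite_SigmaI finite_imageI finite_subset)
  qed simp
  ultimately show ?thesis using finite_subset by blast
qed

lemma goldman_step:
  assumes "goldman R (adjoin R C x)"
  shows "goldman R C" "finite C \<Longrightarrow> finite (adjoin R C x)"
  using transcendental_not_goldman[OF _ assms] goldman_descend[OF _ assms] finite_adjoin by blast+

end

section \<open>Towers of adjunctions over the prime subring\<close>

context field
begin

primrec tower :: "'a set \<Rightarrow> 'a list \<Rightarrow> 'a set" where
  "tower C [] = C"
| "tower C (x # xs) = tower (adjoin R C x) xs"

lemma tower_subring: "subring C R \<Longrightarrow> set xs \<subseteq> carrier R \<Longrightarrow>
  subring (tower C xs) R \<and> C \<union> set xs \<subseteq> tower C xs"
proof (induct xs arbitrary: C)
  case (Cons x xs)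
  have x: "x \<in> carrier R" and xs: "set xs \<subseteq> carrier R" using Cons(3) by auto
  interpret field_adjoin R C x
    by (rule field_adjoin.intro[OF field_axioms field_adjoin_axioms.intro[OF Cons(2) x]])
  have "adjoin R C x \<union> set xs \<subseteq> tower (adjoin R C x) xs" "subring (tower (adjoin R C x) xs) R"
    using Cons(1)[OF adjoin_subring xs] by blast+
  thus ?case using C_adjoin x_adjoin by auto
qed simp

lemma tower_goldman:
  "subring C R \<Longrightarrow> set xs \<subseteq> carrier R \<Longrightarrow> goldman R (tower C xs) \<Longrightarrow>
    goldman R C \<and> (finite C \<longrightarrow> finite (tower C xs))"
proof (induct xs arbitrary: C)
  case (Cons x xs)
  have x: "x \<in> carrier R" and xs: "set xs \<subseteq> carrier R" using Cons(3) by auto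
  interpret field_adjoin R C x
    by (rule field_adjoin.intro[OF field_axioms field_adjoin_axioms.intro[OF Cons(2) x]])
  have "goldman R (adjoin R C x) \<and> (finite (adjoin R C x) \<longrightarrow> finite (tower (adjoin R C x) xs))"
    using Cons(1)[OF adjoin_subring xs] Cons(4) by simp
  thus ?case using goldman_step by simp
qed simp

abbreviation emb :: "int \<Rightarrow> 'a" where "emb n \<equiv> add_pow R n \<one>"

definition prime_subring :: "'a set" where
  "prime_subring = range emb"

lemma int_mult_one: "emb m \<otimes> emb n = emb (m * n)"
  by (simp add: add_pow_ldistr_int add.int_pow_pow mult.commute)

lemma prime_subring: "subring prime_subring R"
proof (rule subringI)
  show "prime_subring \<subseteq> carrier R" by (auto simp: prime_subring_def)
  have "\<one> = emb 1" by (simp add: add.int_pow_1)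
  thus "\<one> \<in> prime_subring" unfolding prime_subring_def by blast
  fix a assume "a \<in> prime_subring"
  then obtain m where m: "a = emb m" by (auto simp: prime_subring_def)
  have "\<ominus> a = emb (- m)" unfolding m by (simp add: add.int_pow_neg)
  thus "\<ominus> a \<in> prime_subring" unfolding prime_subring_def by blast
  fix b assume "b \<in> prime_subring"
  then obtain n where n: "b = emb n" by (auto simp: prime_subring_def)
  show "a \<otimes> b \<in> prime_subring" unfolding m n int_mult_one by (simp add: prime_subring_def)
  have "a \<oplus> b = emb (m + n)" unfolding m n by (simp add: add.int_pow_mult)
  thus "a \<oplus> b \<in> prime_subring" unfolding prime_subring_def by blast
qed

text \<open>The integers violate Goldman's condition: for \<open>m \<noteq> 0\<close> the number
  \<open>\<bar>m\<bar> + 1\<close> is coprime to \<open>m\<close>, so it divides no power of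
  \<open>m\<close>. Hence \<open>emb\<close> is not injective and residues represent
  everything.\<close>

lemma prime_subring_goldman:
  assumes "goldman R prime_subring" shows "finite prime_subring"
proof (cases "inj emb")
  case True
  have z: "emb 0 = \<zero>" by (simp add: add_pow_def)
  obtain e where e: "e \<in> prime_subring" "e \<noteq> \<zero>"
    and div: "\<And>y. y \<in> prime_subring \<Longrightarrow> y \<noteq> \<zero> \<Longrightarrow> \<exists>k. \<exists>z\<in>prime_subring. e [^] (k::nat) = y \<otimes> z"
    using assms by (auto simp: goldman_def)
  obtain m where m: "e = emb m" using e by (auto simp: prime_subring_def)
  have m0: "m \<noteq> 0" using m e z by auto
  define p where "p = \<bar>m\<bar> + 1"
  have "p \<noteq> 0" unfolding p_def by linarith
  hence "emb p \<noteq> emb 0" using injD[OF True, of p 0] by blast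
  then obtain k l where kl: "e [^] (k::nat) = emb p \<otimes> emb l"
    using div[of "emb p"] z by (auto simp: prime_subring_def)
  have "e [^] i = emb (m ^ i)" for i :: nat
    by (induct i) (simp_all add: m int_mult_one mult.commute add.int_pow_1)
  hence "m ^ k = p * l" using kl True unfolding int_mult_one by (metis injD)
  hence "p dvd m ^ k" by simp
  moreover have "coprime p (m ^ k)"
  proof -
    have "coprime p m"
    proof (rule coprimeI)
      fix c assume "c dvd p" "c dvd m"
      hence "c dvd p - \<bar>m\<bar>" by (intro dvd_diff) auto
      thus "is_unit c" by (simp add: p_def)
    qed
    thus ?thesis by simp
  qed
  ultimately have "p dvd 1" by (metis coprime_def dvd_refl)
  hence "m = 0" unfolding p_def by (simp add: zdvd1_eq)
  thus ?thesis using m0 by simp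
next
  case False
  then obtain m n :: int where mn: "m \<noteq> n" "emb m = emb n" by (auto simp: inj_def)
  define d where "d = m - n"
  have "emb d = \<zero>" unfolding d_def using mn(2) by (simp add: add.int_pow_diff r_neg)
  hence dz: "emb (d * q) = \<zero>" for q :: int unfolding int_mult_one[symmetric] by simp
  have "prime_subring \<subseteq> emb ` {- \<bar>d\<bar>..\<bar>d\<bar>}"
  proof
    fix a assume "a \<in> prime_subring"
    then obtain l where l: "a = emb l" by (auto simp: prime_subring_def)
    have "a = emb (d * (l div d) + l mod d)" unfolding l by simp
    also have "\<dots> = emb (l mod d)" using dz[of "l div d"]
      by (simp only: add.int_pow_mult one_closed l_zero add.int_pow_closed)
    finally have "a = emb (l mod d)" .
    moreover have "l mod d \<in> {- \<bar>d\<bar>..\<bar>d\<bar>}" using abs_mod_less[of d l] mn(1) by (auto simp: d_def)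
    ultimately show "a \<in> emb ` {- \<bar>d\<bar>..\<bar>d\<bar>}" by blast
  qed
  thus ?thesis using finite_subset by blast
qed

text \<open>Goldman's condition holds for the field with \<open>\<one>\<close> and descends along
  the generators to the prime subring, which is therefore finite. Climbing back, each adjunction
  preserves finiteness.\<close>

theorem finitely_generated_field_finite:
  assumes xs: "set xs \<subseteq> carrier R"
    and gen: "\<And>S. subring S R \<Longrightarrow> set xs \<subseteq> S \<Longrightarrow> S = carrier R"
  shows "finite (carrier R)"
proof -
  have t: "subring (tower prime_subring xs) R" "set xs \<subseteq> tower prime_subring xs"
    using tower_subring[OF prime_subring xs] by auto
  hence eq: "tower prime_subring xs = carrier R" by (rule gen)
  have "goldman R (carrier R)" unfolding goldman_def
  proof (rule bexI[of _ \<one>], intro ballI)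
    fix y assume "y \<in> carrier R - {\<zero>}"
    hence y: "y \<in> Units R" using field_Units by simp
    have "\<one> [^] (0::nat) = y \<otimes> inv y" using y by simp
    thus "\<exists>k. \<exists>z\<in>carrier R. \<one> [^] (k::nat) = y \<otimes> z" using Units_inv_closed[OF y] by blast
  qed simp
  hence "goldman R (tower prime_subring xs)" by (simp only: eq)
  from tower_goldman[OF prime_subring xs this] prime_subring_goldman eq show ?thesis by auto
qed

end

section \<open>Prime ideals with a polynomial identity\<close>

definition additive_subgroup_set :: "'a::ab_group_add set \<Rightarrow> bool" where
  "additive_subgroup_set A \<longleftrightarrow> 0 \<in> A \<and> (\<forall>a\<in>A. \<forall>b\<in>A. a + b \<in> A) \<and> (\<forall>a\<in>A. - a \<in> A)"

definition left_ideal :: "'a::ring_1 set \<Rightarrow> bool" where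
  "left_ideal A \<longleftrightarrow> additive_subgroup_set A \<and> (\<forall>r. \<forall>a\<in>A. r * a \<in> A)"

definition two_sided :: "'a::ring_1 set \<Rightarrow> bool" where
  "two_sided A \<longleftrightarrow> left_ideal A \<and> (\<forall>r. \<forall>a\<in>A. a * r \<in> A)"

lemma asub_zero: "additive_subgroup_set A \<Longrightarrow> 0 \<in> A"
  and asub_add: "additive_subgroup_set A \<Longrightarrow> a \<in> A \<Longrightarrow> b \<in> A \<Longrightarrow> a + b \<in> A"
  and asub_neg: "additive_subgroup_set A \<Longrightarrow> a \<in> A \<Longrightarrow> - a \<in> A"
  by (auto simp: additive_subgroup_set_def)

lemma asub_diff: "additive_subgroup_set A \<Longrightarrow> a \<in> A \<Longrightarrow> b \<in> A \<Longrightarrow> a - b \<in> A"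
  using asub_add[of A a "- b"] asub_neg by auto

lemma asub_sum: "additive_subgroup_set A \<Longrightarrow> (\<And>i. i \<in> I \<Longrightarrow> f i \<in> A) \<Longrightarrow> sum f I \<in> A"
  by (induct I rule: infinite_finite_induct) (auto simp: asub_zero asub_add)

text \<open>Congruence modulo \<open>A\<close> is always written \<open>a - b \<in> A\<close>; this
  rule and the next two serve as its substitution, transitivity and symmetry.\<close>

lemma asub_iff: "additive_subgroup_set A \<Longrightarrow> a - b \<in> A \<Longrightarrow> a \<in> A \<longleftrightarrow> b \<in> A"
  using asub_add[of A "a - b" b] asub_diff[of A a "a - b"] by auto

lemma asub_trans: "additive_subgroup_set A \<Longrightarrow> a - b \<in> A \<Longrightarrow> b - c \<in> A \<Longrightarrow> a - c \<in> A"
  using asub_add[of A "a - b" "b - c"] by simp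

lemma asub_sym: "additive_subgroup_set A \<Longrightarrow> a - b \<in> A \<Longrightarrow> b - a \<in> A"
  using asub_neg[of A "a - b"] by simp

lemma left_ideal_asub: "left_ideal A \<Longrightarrow> additive_subgroup_set A"
  and left_ideal_mult: "left_ideal A \<Longrightarrow> a \<in> A \<Longrightarrow> r * a \<in> A"
  by (auto simp: left_ideal_def)

lemma left_ideal_neg: "left_ideal A \<Longrightarrow> a \<in> A \<Longrightarrow> - a \<in> A"
  by (simp add: left_ideal_asub asub_neg)

lemma two_sided_left: "two_sided A \<Longrightarrow> left_ideal A"
  and two_sided_asub: "two_sided A \<Longrightarrow> additive_subgroup_set A"
  and two_sided_lmult: "two_sided A \<Longrightarrow> a \<in> A \<Longrightarrow> r * a \<in> A"
  and two_sided_rmult: "two_sided A \<Longrightarrow> a \<in> A \<Longrightarrow> a * r \<in> A"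
  by (auto simp: left_ideal_def two_sided_def)

definition prime_ideal :: "'a::ring_1 set \<Rightarrow> bool" where
  "prime_ideal Q \<longleftrightarrow> two_sided Q \<and> (\<forall>a b. (\<forall>r. a * r * b \<in> Q) \<longrightarrow> a \<in> Q \<or> b \<in> Q)"

section \<open>Multilinear polynomials and nil left ideals\<close>

text \<open>One monomial for every ordering of the variables in \<open>I\<close>, with its
  coefficient on the left. Variables form a set and not an interval so that any of them can be
  removed in an induction on the degree.\<close>

definition mlin :: "('i list \<Rightarrow> 'a::ring_1) \<Rightarrow> 'i set \<Rightarrow> ('i \<Rightarrow> 'a) \<Rightarrow> 'a" where
  "mlin \<gamma> I x = (\<Sum>w\<in>permutations_of_set I. \<gamma> w * prod_list (map x w))"

lemma permutations_of_set_Cons: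
  "i # w \<in> permutations_of_set I \<longleftrightarrow> i \<in> I \<and> w \<in> permutations_of_set (I - {i})"
  by (auto simp: permutations_of_set_def)

text \<open>Take \<open>c \<in> L\<close> with \<open>L c\<close> not below \<open>Q\<close> but \<open>L c\<^sup>2\<close> below \<open>Q\<close>. Substituting an element of \<open>c L\<close>
  for the first variable of the identity and elements of \<open>L c\<close> for the others kills every monomial
  in which the first variable does not come first, so \<open>L c\<close> satisfies an identity of lower degree.\<close>

lemma nil_left_ideal_in_prime:
  fixes Q :: "'a::ring_1 set" and I :: "'i set"
  assumes Q: "prime_ideal Q"
  shows "finite I \<Longrightarrow> left_ideal L \<Longrightarrow> (\<And>a. a \<in> L \<Longrightarrow> \<exists>n. a ^ n \<in> Q) \<Longrightarrow>
    w0 \<in> permutations_of_set I \<Longrightarrow> \<gamma> w0 = 1 \<Longrightarrow> (\<And>w b. \<gamma> w * b - b * \<gamma> w \<in> Q) \<Longrightarrow>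
    (\<And>(x :: 'i \<Rightarrow> 'a) y. (\<And>i. x i \<in> L) \<Longrightarrow> y \<in> L \<Longrightarrow> y * mlin \<gamma> I x \<in> Q) \<Longrightarrow> L \<subseteq> Q"
proof (induct "card I" arbitrary: I L w0 \<gamma>)
  case 0
  hence "I = {}" by simp
  hence w0: "w0 = []" using 0(5) by simp
  show ?case
  proof
    fix y assume y: "y \<in> L"
    have "y * mlin \<gamma> I (\<lambda>i. y) \<in> Q" using 0(8)[of "\<lambda>i. y" y] y by blast
    thus "y \<in> Q" using \<open>I = {}\<close> 0(6) w0 by (simp add: mlin_def)
  qed
next
  case (Suc n)
  note finI = Suc(3) and L = Suc(4) and nil = Suc(5) and w0 = Suc(6) and g1 = Suc(7)
    and cent = Suc(8) and ident = Suc(9)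
  have Q2: "two_sided Q" using Q by (simp add: prime_ideal_def)
  note Qa = two_sided_asub[OF Q2] and Ql = two_sided_lmult[OF Q2] and Qr = two_sided_rmult[OF Q2]
  have prime: "a \<in> Q \<or> b \<in> Q" if "\<And>r. a * r * b \<in> Q" for a b
    using Q that by (simp add: prime_ideal_def)
  note Ll = left_ideal_mult[OF L]
  have "w0 \<noteq> []" using w0 Suc(2) by (auto simp: permutations_of_set_def)
  then obtain i0 w1 where w01: "w0 = i0 # w1" by (cases w0) auto
  define I' where "I' = I - {i0}"
  have i0: "i0 \<in> I" "w1 \<in> permutations_of_set I'"
    using w0 w01 by (auto simp: I'_def permutations_of_set_Cons)
  have card': "n = card I'" "finite I'" using Suc(2) finI i0 by (auto simp: I'_def)
  show ?case
  proof (rule ccontr)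
    assume "\<not> L \<subseteq> Q"
    then obtain l0 where l0: "l0 \<in> L" "l0 \<notin> Q" by blast
    define N where "N = {c \<in> L. \<forall>l\<in>L. l * c \<in> Q}"
    have "\<exists>a\<in>L. a \<notin> N"
    proof (rule ccontr)
      assume "\<not> (\<exists>a\<in>L. a \<notin> N)"
      hence "l0 * (r * l0) \<in> Q" for r using l0 Ll[OF l0(1)] by (auto simp: N_def)
      thus False using prime[of l0 l0] l0(2) by (simp add: mult.assoc)
    qed
    then obtain a where a: "a \<in> L" "a \<notin> N" by blast
    have aL: "a ^ Suc k \<in> L" for k using a(1) by (induct k) (simp_all add: Ll)
    have a2L: "a ^ (2 ^ k) \<in> L" for k using aL[of "2 ^ k - 1"] by simp
    obtain m where m: "a ^ m \<in> Q" using nil[OF a(1)] by blast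
    have QN: "c \<in> N" if "c \<in> L" "c \<in> Q" for c using that Ql by (auto simp: N_def)
    have "m \<le> 2 ^ m" by (rule less_imp_le[OF less_exp])
    hence e: "a ^ (2 ^ m) = a ^ (2 ^ m - m) * a ^ m" by (simp add: power_add[symmetric])
    have "a ^ (2 ^ m) \<in> Q" unfolding e by (rule Ql[OF m])
    hence "a ^ (2 ^ m) \<in> N" by (rule QN[OF a2L])
    moreover have "a ^ (2 ^ 0) \<notin> N" using a by simp
    \<comment> \<open>Repeated squaring ends in \<open>N\<close> because \<open>a\<close> is
      nilpotent modulo \<open>Q\<close>; the last square outside \<open>N\<close> is the wanted
      \<open>c\<close>.\<close>
    ultimately have "\<exists>k. a ^ (2 ^ k) \<notin> N \<and> a ^ (2 ^ Suc k) \<in> N"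
      using nat_induct[of "\<lambda>k. a ^ (2 ^ k) \<notin> N" m] by blast
    then obtain k where k: "a ^ (2 ^ k) \<notin> N" "a ^ (2 ^ Suc k) \<in> N" by blast
    define c where "c = a ^ (2 ^ k)"
    have c: "c \<in> L" "c \<notin> N" "c * c \<in> N"
      using k a2L[of k] by (simp_all add: c_def power_add[symmetric] mult_2)
    obtain l1 where l1: "l1 \<in> L" "l1 * c \<notin> Q" using c by (auto simp: N_def)
    define L2 where "L2 = (\<lambda>y. y * c) ` L"
    have L2L: "L2 \<subseteq> L" using Ll[OF c(1)] by (auto simp: L2_def)
    have "L2 \<subseteq> Q"
    proof (rule Suc(1)[OF card'(1) card'(2) _ _ i0(2)])
      show "left_ideal L2" unfolding left_ideal_def additive_subgroup_set_def
      proof (intro conjI ballI allI)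
        note La = left_ideal_asub[OF L]
        show "0 \<in> L2" unfolding L2_def by (rule image_eqI[of _ _ 0]) (simp_all add: asub_zero[OF
          La])
        fix p q assume "p \<in> L2"
        then obtain p' where p: "p = p' * c" "p' \<in> L" by (auto simp: L2_def)
        show "- p \<in> L2" unfolding L2_def p
          by (rule image_eqI[of _ _ "- p'"]) (simp_all add: p asub_neg[OF La])
        show "r * p \<in> L2" for r unfolding L2_def p
          by (rule image_eqI[of _ _ "r * p'"]) (simp_all add: p Ll mult.assoc)
        assume "q \<in> L2"
        then obtain q' where q: "q = q' * c" "q' \<in> L" by (auto simp: L2_def)
        show "p + q \<in> L2" unfolding L2_def p q
          by (rule image_eqI[of _ _ "p' + q'"]) (simp_all add: p q asub_add[OF La] distrib_right)
      qed
      show "\<exists>n. a ^ n \<in> Q" if "a \<in> L2" for a using nil that L2L by blast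
      show "\<gamma> (i0 # w1) = 1" using g1 w01 by simp
      show "\<gamma> (i0 # w) * b - b * \<gamma> (i0 # w) \<in> Q" for w b by (rule cent)
      fix x :: "'i \<Rightarrow> 'a" and y assume x: "\<And>i. x i \<in> L2" and y: "y \<in> L2"
      let ?T = "mlin (\<lambda>w. \<gamma> (i0 # w)) I' x"
      have key: "l1 * c * l * ?T \<in> Q" if l: "l \<in> L" for l
      proof -
        define x' where "x' = x(i0 := c * l)"
        have x'L: "x' i \<in> L" for i using x[of i] L2L Ll[OF l] by (auto simp: x'_def)
        have t: "l1 * mlin \<gamma> I x' \<in> Q" by (rule ident[OF x'L l1(1)])
        let ?A = "(#) i0 ` permutations_of_set I'"
        let ?f = "\<lambda>w. l1 * (\<gamma> w * prod_list (map x' w))"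
        have A: "?A \<subseteq> permutations_of_set I" using i0
          by (auto simp: permutations_of_set_Cons I'_def)
        have "l1 * mlin \<gamma> I x' = sum ?f (permutations_of_set I)"
          unfolding mlin_def by (simp add: sum_distrib_left)
        also have "\<dots> = sum ?f (permutations_of_set I - ?A) + sum ?f ?A"
          by (rule sum.subset_diff[OF A]) simp
        finally have e: "l1 * mlin \<gamma> I x' = sum ?f (permutations_of_set I - ?A) + sum ?f ?A" .
        have rest: "sum ?f (permutations_of_set I - ?A) \<in> Q"
        proof (rule asub_sum[OF Qa])
          fix w assume w: "w \<in> permutations_of_set I - ?A"
          hence "i0 \<in> set w" "distinct w" using i0 by (auto simp: permutations_of_set_def)
          then obtain u v where uv: "w = u @ i0 # v" "i0 \<notin> set u" by (meson split_list_first)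
          have "u \<noteq> []"
          proof
            assume "u = []"
            hence "w \<in> ?A" using w uv by (auto simp: permutations_of_set_Cons I'_def)
            thus False using w by simp
          qed
          then obtain u' j where u: "u = u' @ [j]" by (cases u rule: rev_exhaust) auto
          \<comment> \<open>The variable just before \<open>i0\<close> takes a value ending in
            \<open>c\<close>, and \<open>i0\<close> takes one beginning with \<open>c\<close>, so
            the monomial contains \<open>c * c\<close>.\<close>
          have "x' j \<in> L2" using uv u x[of j] by (auto simp: x'_def)
          then obtain y' where y': "x' j = y' * c" "y' \<in> L" by (auto simp: L2_def)
          define p where "p = l1 * (\<gamma> w * prod_list (map x' u')) * y'"
          have "p \<in> L" unfolding p_def using y' by (intro Ll)
          hence "p * (c * c) \<in> Q" using c(3) by (simp add: N_def)
          hence "p * (c * c) * (l * prod_list (map x' v)) \<in> Q" by (rule Qr)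
          moreover have "?f w = p * (c * c) * (l * prod_list (map x' v))"
            unfolding uv(1) u p_def using y'(1) by (simp add: x'_def mult.assoc)
          ultimately show "?f w \<in> Q" by simp
        qed
        have "l1 * mlin \<gamma> I x' - sum ?f (permutations_of_set I - ?A) \<in> Q"
          by (rule asub_diff[OF Qa t rest])
        hence s: "sum ?f ?A \<in> Q" unfolding e by (simp only: add_diff_cancel_left')
        have xx: "map x' w = map x w" if "w \<in> permutations_of_set I'" for w
          using that by (auto simp: x'_def I'_def permutations_of_set_def)
        have "sum ?f ?A = (\<Sum>w\<in>permutations_of_set I'. ?f (i0 # w))"
          by (subst sum.reindex) (auto simp: inj_on_def)
        also have "\<dots> = (\<Sum>w\<in>permutations_of_set I'. l1 * (\<gamma> (i0 # w) * (c * l)) * prod_list (map x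
          w))"
          by (rule sum.cong) (auto simp: x'_def[THEN fun_cong, of i0] xx mult.assoc)
        finally have s': "(\<Sum>w\<in>permutations_of_set I'. l1 * (\<gamma> (i0 # w) * (c * l)) * prod_list (map x
          w)) \<in> Q"
          using s by simp
        \<comment> \<open>The coefficients are central only modulo \<open>Q\<close>; moving
          \<open>c * l\<close> past them costs an element of \<open>Q\<close>.\<close>
        have "l1 * c * l * ?T - (\<Sum>w\<in>permutations_of_set I'. l1 * (\<gamma> (i0 # w) * (c * l)) * prod_list
          (map x w))
            = (\<Sum>w\<in>permutations_of_set I'. l1 * ((c * l) * \<gamma> (i0 # w) -
              \<gamma> (i0 # w) * (c * l)) * prod_list (map x w))"
          unfolding mlin_def by (simp add: sum_distrib_left sum_subtractf algebra_simps)
        also have "\<dots> \<in> Q"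
        proof (rule asub_sum[OF Qa])
          fix w
          have "- (\<gamma> (i0 # w) * (c * l) - (c * l) * \<gamma> (i0 # w)) \<in> Q" by (rule asub_neg[OF Qa cent])
          thus "l1 * ((c * l) * \<gamma> (i0 # w) - \<gamma> (i0 # w) * (c * l)) * prod_list (map x w) \<in> Q"
            by (intro Qr Ql) simp
        qed
        finally show ?thesis using s' asub_iff[OF Qa] by blast
      qed
      \<comment> \<open>The freedom in \<open>l\<close> is used with \<open>l = r * y\<close> for
        arbitrary \<open>r\<close>, so that primeness cancels \<open>l1 * c\<close>.\<close>
      have "(l1 * c) * r * (y * ?T) \<in> Q" for r
        using key[OF Ll, of y r] y L2L by (auto simp: mult.assoc)
      thus "y * ?T \<in> Q" using prime[of "l1 * c" "y * ?T"] l1(2) by blast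
    qed
    moreover have "l1 * c \<in> L2" using l1 by (auto simp: L2_def)
    ultimately show False using l1(2) by blast
  qed
qed

section \<open>Simple modules with a polynomial identity\<close>

inductive_set add_gen :: "'a::ab_group_add set \<Rightarrow> 'a set" for S where
  add_gen_zero: "0 \<in> add_gen S"
| add_gen_add: "a \<in> add_gen S \<Longrightarrow> s \<in> S \<Longrightarrow> a + s \<in> add_gen S"

definition subring_set :: "'a::ring_1 set \<Rightarrow> bool" where
  "subring_set S \<longleftrightarrow> additive_subgroup_set S \<and> 1 \<in> S \<and> (\<forall>a\<in>S. \<forall>b\<in>S. a * b \<in> S)"

text \<open>The simple module is the quotient of the ring by the maximal left ideal \<open>M\<close>; vectors are
  ring elements modulo \<open>M\<close>, and \<open>idealizer\<close> modulo \<open>M\<close> is the ring of its endomorphisms, acting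
  from the right. The ring is generated by \<open>R0\<close> over its centre, and only \<open>R0\<close> is required to
  satisfy the multilinear identity with coefficients \<open>\<gamma>\<close>.\<close>

locale simple_module =
  fixes M :: "'b::ring_1 set" and R0 :: "'b set"
    and \<gamma> :: "'i list \<Rightarrow> 'b" and I :: "'i set" and w0 :: "'i list"
  assumes M: "left_ideal M" and one_M: "1 \<notin> M"
    and maxM: "\<And>L. left_ideal L \<Longrightarrow> M \<subseteq> L \<Longrightarrow> L = M \<or> L = UNIV"
    and R0: "subring_set R0"
    and R0_gen: "\<And>b. b \<in> add_gen {c * z | c z. c \<in> R0 \<and> (\<forall>a. z * a = a * z)}"
    and finI: "finite I" and w0: "w0 \<in> permutations_of_set I" and \<gamma>_w0: "\<gamma> w0 = 1"
    and \<gamma>_central: "\<And>w b. \<gamma> w * b - b * \<gamma> w \<in> M"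
    and identity: "\<And>x v. (\<And>i. x i \<in> R0) \<Longrightarrow> mlin \<gamma> I x * v \<in> M"
begin

lemmas Ma = left_ideal_asub[OF M] and Ml = left_ideal_mult[OF M]
lemmas M_zero = asub_zero[OF Ma] and M_add = asub_add[OF Ma] and M_neg = asub_neg[OF Ma]
  and M_diff = asub_diff[OF Ma] and M_sum = asub_sum[OF Ma] and M_iff = asub_iff[OF Ma]
  and M_trans = asub_trans[OF Ma] and M_sym = asub_sym[OF Ma]

section \<open>Schur's lemma and a maximal commuting set of endomorphisms\<close>

definition idealizer :: "'b set" where "idealizer = {y. \<forall>m\<in>M. m * y \<in> M}"

lemma idealizerD: "y \<in> idealizer \<Longrightarrow> m \<in> M \<Longrightarrow> m * y \<in> M" by (simp add: idealizer_def)

text \<open>Right multiplication by \<open>y\<close> is a nonzero endomorphism of a simple module,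
  so its kernel is zero.\<close>

lemma right_kernel:
  assumes y: "y \<in> idealizer" "y \<notin> M" and d: "d * y \<in> M" shows "d \<in> M"
proof -
  let ?L = "{d. d * y \<in> M}"
  have "left_ideal ?L"
    unfolding left_ideal_def additive_subgroup_set_def
    by (auto simp: M_zero distrib_right M_add mult.assoc Ml intro: M_neg)
  moreover have "M \<subseteq> ?L" using idealizerD[OF y(1)] by blast
  moreover have "1 \<notin> ?L" using y by simp
  ultimately have "?L = M" using maxM by blast
  thus ?thesis using d by blast
qed

lemma left_inverse:
  assumes "y \<notin> M" and N: "left_ideal N" "M \<subseteq> N" "y \<in> N"
  shows "N = UNIV"
  using maxM[OF N(1,2)] assms by blast

text \<open>The image of right multiplication by \<open>y\<close> is everything, which yields
  \<open>z\<close>. Since \<open>y\<close> can be cancelled on the right modulo \<open>M\<close>,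
  this \<open>z\<close> is in the idealizer and is a two-sided inverse.\<close>

lemma schur:
  assumes y: "y \<in> idealizer" "y \<notin> M"
  obtains z where "z \<in> idealizer" "z * y - 1 \<in> M" "y * z - 1 \<in> M"
proof -
  let ?L = "{a * y + m | a m. m \<in> M}"
  have "left_ideal ?L"
    unfolding left_ideal_def additive_subgroup_set_def
  proof (intro conjI ballI allI)
    show "0 \<in> ?L" using M_zero by (auto intro!: exI[of _ 0])
    fix p q assume "p \<in> ?L"
    then obtain a m where p: "p = a * y + m" "m \<in> M" by blast
    have "- p = (- a) * y + (- m)" using p by simp
    thus "- p \<in> ?L" using M_neg[OF p(2)] by blast
    show "r * p \<in> ?L" for r
    proof -
      have "r * p = (r * a) * y + r * m" using p by (simp add: algebra_simps)
      thus ?thesis using Ml[OF p(2)] by blast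
    qed
    assume "q \<in> ?L"
    then obtain a' m' where q: "q = a' * y + m'" "m' \<in> M" by blast
    have "p + q = (a + a') * y + (m + m')" using p q by (simp add: algebra_simps)
    thus "p + q \<in> ?L" using M_add[OF p(2) q(2)] by blast
  qed
  moreover have "M \<subseteq> ?L"
  proof
    fix m assume m: "m \<in> M"
    have "m = 0 * y + m" by simp
    thus "m \<in> ?L" using m by blast
  qed
  moreover have "y \<in> ?L"
  proof -
    have "y = 1 * y + 0" by simp
    thus ?thesis using M_zero by blast
  qed
  ultimately have "?L = UNIV" using left_inverse[OF y(2)] by blast
  then obtain z m where z: "1 = z * y + m" "m \<in> M" by blast
  have zy: "z * y - 1 \<in> M" using z M_neg[OF z(2)]
    by (metis add_diff_cancel_left' minus_diff_eq diff_add_cancel uminus_add_conv_diff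
    add_uminus_conv_diff)
  have "a * z \<in> M" if a: "a \<in> M" for a
  proof -
    have "a * (z * y - 1) + a \<in> M" using M_add[OF Ml[OF zy] a] .
    hence "(a * z) * y \<in> M" by (simp add: algebra_simps)
    thus ?thesis by (rule right_kernel[OF y])
  qed
  hence zi: "z \<in> idealizer" by (simp add: idealizer_def)
  have "y * (z * y - 1) \<in> M" by (rule Ml[OF zy])
  hence "(y * z - 1) * y \<in> M" by (simp add: algebra_simps)
  hence "y * z - 1 \<in> M" by (rule right_kernel[OF y])
  thus ?thesis using that zi zy by blast
qed

definition commuting :: "'b set \<Rightarrow> bool" where
  "commuting S \<longleftrightarrow> S \<subseteq> idealizer \<and> (\<forall>a\<in>S. \<forall>b\<in>S. a * b - b * a \<in> M)"

lemma max_commuting_exists: "\<exists>E. commuting E \<and> (\<forall>S. commuting S \<and> E \<subseteq> S \<longrightarrow> S = E)"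
proof -
  have "\<exists>E\<in>Collect commuting. \<forall>S\<in>Collect commuting. E \<subseteq> S \<longrightarrow> S = E"
  proof (rule subset_Zorn_nonempty)
    show "Collect commuting \<noteq> {}" by (auto simp: commuting_def intro!: exI[of _ "{}"])
    fix C assume C: "C \<noteq> {}" "subset.chain (Collect commuting) C"
    have "\<exists>S\<in>C. a \<in> S \<and> b \<in> S" if ab: "a \<in> \<Union>C" "b \<in> \<Union>C" for a b
    proof -
      obtain S T where st: "S \<in> C" "a \<in> S" "T \<in> C" "b \<in> T" using ab by blast
      hence "S \<subseteq> T \<or> T \<subseteq> S" using C(2) by (auto simp: subset.chain_def)
      thus ?thesis using st by blast
    qed
    moreover have "\<And>S. S \<in> C \<Longrightarrow> commuting S" using C(2) by (auto simp: subset.chain_def)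
    ultimately show "\<Union>C \<in> Collect commuting"
      unfolding commuting_def mem_Collect_eq by (meson Union_least)
  qed
  thus ?thesis by blast
qed

text \<open>By Schur's lemma \<open>E\<close> modulo \<open>M\<close> is a maximal subfield of the endomorphism division ring.
  Being maximal, it is its own centralizer.\<close>

definition E :: "'b set" where
  "E = (SOME E. commuting E \<and> (\<forall>S. commuting S \<and> E \<subseteq> S \<longrightarrow> S = E))"

lemma E_max: "commuting E" "commuting S \<Longrightarrow> E \<subseteq> S \<Longrightarrow> S = E"
  using someI_ex[OF max_commuting_exists] unfolding E_def by blast+

lemma E_idealizer: "e \<in> E \<Longrightarrow> e \<in> idealizer"
  and E_comm: "e \<in> E \<Longrightarrow> e' \<in> E \<Longrightarrow> e * e' - e' * e \<in> M"
  using E_max(1) by (auto simp: commuting_def)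

lemma ME: "m \<in> M \<Longrightarrow> e \<in> E \<Longrightarrow> m * e \<in> M"
  using E_idealizer idealizerD by blast

text \<open>Adjoining to \<open>E\<close> an endomorphism that commutes with it leaves a commuting
  set, so maximality applies. Closure of \<open>E\<close> under the field operations is derived from
  this.\<close>

lemma E_I:
  assumes "y \<in> idealizer" "\<And>e. e \<in> E \<Longrightarrow> y * e - e * y \<in> M" shows "y \<in> E"
proof -
  have "commuting (insert y E)" unfolding commuting_def
    using assms E_idealizer E_comm M_sym[OF assms(2)] M_zero by auto
  thus ?thesis using E_max(2)[of "insert y E"] by blast
qed

lemma M_E: "M \<subseteq> E"
proof
  fix m assume m: "m \<in> M"
  show "m \<in> E"
    by (rule E_I) (use m Ml ME M_diff in \<open>auto simp: idealizer_def\<close>)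
qed

lemma E_central:
  assumes "\<And>a. z * a = a * z" shows "z \<in> E"
proof (rule E_I)
  show "z \<in> idealizer" using Ml assms by (auto simp: idealizer_def simp flip: assms)
qed (simp add: assms M_zero)

lemma E_one: "1 \<in> E" by (rule E_central) simp

lemma E_add: assumes "a \<in> E" "b \<in> E" shows "a + b \<in> E"
proof (rule E_I)
  show "a + b \<in> idealizer" using assms ME M_add by (auto simp: idealizer_def distrib_left)
  fix e assume e: "e \<in> E"
  have "(a + b) * e - e * (a + b) = (a * e - e * a) + (b * e - e * b)" by (simp add: algebra_simps)
  thus "(a + b) * e - e * (a + b) \<in> M" using M_add[OF E_comm[OF assms(1) e] E_comm[OF assms(2) e]]
    by simp
qed

lemma E_neg: assumes "a \<in> E" shows "- a \<in> E"
proof (rule E_I)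
  show "- a \<in> idealizer" using assms ME M_neg by (auto simp: idealizer_def)
  fix e assume e: "e \<in> E"
  show "- a * e - e * - a \<in> M" using M_neg[OF E_comm[OF assms e]] by (simp add: algebra_simps)
qed

lemma E_mult: assumes "a \<in> E" "b \<in> E" shows "a * b \<in> E"
proof (rule E_I)
  show "a * b \<in> idealizer" using assms ME by (auto simp: idealizer_def simp flip: mult.assoc)
  fix e assume e: "e \<in> E"
  have "a * b * e - e * (a * b) = a * (b * e - e * b) + (a * e - e * a) * b"
    by (simp add: algebra_simps)
  thus "a * b * e - e * (a * b) \<in> M"
    using M_add[OF Ml[OF E_comm[OF assms(2) e]] ME[OF E_comm[OF assms(1) e] assms(2)]] by simp
qed

lemma E_zero: "0 \<in> E" using M_E M_zero by blast

lemma E_asub: "additive_subgroup_set E"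
  by (simp add: additive_subgroup_set_def E_zero E_add E_neg)

lemma E_inverse:
  assumes y: "y \<in> E" "y \<notin> M"
  obtains z where "z \<in> E" "z * y - 1 \<in> M" "y * z - 1 \<in> M"
proof -
  obtain z where z: "z \<in> idealizer" "z * y - 1 \<in> M" "y * z - 1 \<in> M"
    using schur[OF E_idealizer[OF y(1)] y(2)] .
  have "z \<in> E"
  proof (rule E_I[OF z(1)])
    fix e assume e: "e \<in> E"
    have "(z * e - e * z) * y = z * (e * y - y * e) + ((z * y - 1) * e - e * (z * y - 1))"
      by (simp add: algebra_simps)
    moreover have "z * (e * y - y * e) + ((z * y - 1) * e - e * (z * y - 1)) \<in> M"
      by (intro M_add Ml M_diff E_comm e y ME z)
    ultimately show "z * e - e * z \<in> M" using right_kernel[OF E_idealizer[OF y(1)] y(2)] by simp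
  qed
  thus ?thesis using that z by blast
qed

lemma \<gamma>_E: "\<gamma> w \<in> E"
proof (rule E_I)
  have "m * \<gamma> w \<in> M" if "m \<in> M" for m
    using M_diff[OF Ml[OF that, of "\<gamma> w"] \<gamma>_central[of w m]] by simp
  thus "\<gamma> w \<in> idealizer" by (simp add: idealizer_def)
qed (rule \<gamma>_central)

text \<open>The coefficients are central modulo \<open>M\<close> and belong to \<open>E\<close>. On
  the right they act as scalars, on the same side as the other elements of \<open>E\<close>.\<close>

lemma identity_right:
  assumes "\<And>i. x i \<in> R0"
  shows "(\<Sum>w\<in>permutations_of_set I. prod_list (map x w) * v * \<gamma> w) \<in> M"
proof -
  have "(\<Sum>w\<in>permutations_of_set I. prod_list (map x w) * v * \<gamma> w) =
    mlin \<gamma> I x * v - (\<Sum>w\<in>permutations_of_set I. \<gamma> w * (prod_list (map x w) * v) -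
      (prod_list (map x w) * v) * \<gamma> w)"
    by (simp add: mlin_def sum_distrib_right sum_subtractf mult.assoc)
  thus ?thesis using M_diff[OF identity[OF assms] M_sum[OF \<gamma>_central]] by simp
qed

section \<open>Density\<close>

inductive_set ops :: "('b \<Rightarrow> 'b) set" where
  ops_zero: "(\<lambda>v. 0) \<in> ops"
| ops_add: "s \<in> ops \<Longrightarrow> c \<in> R0 \<Longrightarrow> e \<in> E \<Longrightarrow> (\<lambda>v. s v + c * v * e) \<in> ops"

lemma R0_props: "0 \<in> R0" "1 \<in> R0" "a \<in> R0 \<Longrightarrow> b \<in> R0 \<Longrightarrow> a * b \<in> R0" "a \<in> R0 \<Longrightarrow> - a \<in> R0"
  using R0 by (auto simp: subring_set_def asub_zero asub_neg)

lemma ops_plus: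
  assumes s: "s \<in> ops" and t: "t \<in> ops" shows "(\<lambda>v. s v + t v) \<in> ops"
  using t
proof (induct t rule: ops.induct)
  case (ops_add t c e)
  show ?case using ops.ops_add[OF ops_add(2,3,4)] by (simp add: add.assoc)
qed (use s in simp)

lemma ops_base: "c \<in> R0 \<Longrightarrow> e \<in> E \<Longrightarrow> (\<lambda>v. c * v * e) \<in> ops"
  using ops_add[OF ops_zero] by simp

lemma ops_additive: "s \<in> ops \<Longrightarrow> s (v + v') = s v + s v'"
  by (induct s rule: ops.induct) (simp_all add: algebra_simps)

lemma ops_diff: "s \<in> ops \<Longrightarrow> s (v - v') = s v - s v'"
  by (induct s rule: ops.induct) (simp_all add: algebra_simps)

lemma ops_M: "s \<in> ops \<Longrightarrow> v \<in> M \<Longrightarrow> s v \<in> M"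
proof (induct s rule: ops.induct)
  case (ops_add s c e)
  show ?case by (rule M_add[OF ops_add(2)[OF ops_add(5)] ME[OF Ml[OF ops_add(5)] ops_add(4)]])
qed (rule M_zero)

lemma ops_cong: "s \<in> ops \<Longrightarrow> v - v' \<in> M \<Longrightarrow> s v - s v' \<in> M"
  using ops_M[of s "v - v'"] by (simp add: ops_diff)

lemma ops_E: "s \<in> ops \<Longrightarrow> e \<in> E \<Longrightarrow> s (v * e) - s v * e \<in> M"
proof (induct s rule: ops.induct)
  case ops_zero show ?case using M_zero by simp
next
  case (ops_add s c e')
  have "(s (v * e) + c * (v * e) * e') - (s v + c * v * e') * e =
     (s (v * e) - s v * e) + c * v * (e * e' - e' * e)" by (simp add: algebra_simps)
  moreover have "(s (v * e) - s v * e) + c * v * (e * e' - e' * e) \<in> M"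
    by (rule M_add[OF ops_add(2)[OF ops_add(5)] Ml[OF E_comm[OF ops_add(5,4)]]])
  ultimately show ?case by (simp only:)
qed

text \<open>A ring element is a sum of products \<open>c * z\<close> with \<open>z\<close> central,
  and such a \<open>z\<close> may act from the right as an element of \<open>E\<close>. So the whole
  ring acts through \<open>ops\<close>, though the identity is known on \<open>R0\<close>
  only.\<close>

lemma ops_left: "(\<lambda>v. b * v) \<in> ops"
  using R0_gen[of b]
proof (induct b rule: add_gen.induct)
  case add_gen_zero thus ?case using ops_zero by simp
next
  case (add_gen_add a s)
  then obtain c z where cz: "s = c * z" "c \<in> R0" "\<And>a. z * a = a * z" by blast
  have "(\<lambda>v. a * v + c * v * z) \<in> ops" by (rule ops.ops_add[OF add_gen_add(2) cz(2) E_central[OF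
    cz(3)]])
  moreover have "c * v * z = s * v" for v unfolding cz(1) by (simp add: mult.assoc cz(3))
  ultimately show ?case by (simp add: distrib_right)
qed

lemma ops_comp_base: "s \<in> ops \<Longrightarrow> c \<in> R0 \<Longrightarrow> e \<in> E \<Longrightarrow> (\<lambda>v. c * s v * e) \<in> ops"
proof (induct s rule: ops.induct)
  case ops_zero show ?case using ops.ops_zero by simp
next
  case (ops_add s c' e')
  have "(\<lambda>v. c * s v * e + (c * c') * v * (e' * e)) \<in> ops"
    by (rule ops.ops_add[OF ops_add(2)[OF ops_add(5,6)] R0_props(3)[OF ops_add(5,3)] E_mult[OF
      ops_add(4,6)]])
  thus ?case by (simp add: algebra_simps)
qed

lemma ops_comp: "t \<in> ops \<Longrightarrow> s \<in> ops \<Longrightarrow> (\<lambda>v. t (s v)) \<in> ops"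
proof (induct t rule: ops.induct)
  case ops_zero show ?case using ops.ops_zero by simp
next
  case (ops_add t c e)
  show ?case using ops_plus[OF ops_add(2)[OF ops_add(5)] ops_comp_base[OF ops_add(5,3,4)]] .
qed

lemma ops_minus: "s \<in> ops \<Longrightarrow> t \<in> ops \<Longrightarrow> (\<lambda>v. s v - t v) \<in> ops"
  using ops_plus[of s "\<lambda>v. (- 1) * t v * 1"] ops_comp_base[of t "- 1" 1] R0_props E_one by simp

definition span :: "(nat \<Rightarrow> 'b) \<Rightarrow> nat \<Rightarrow> 'b set" where
  "span v k = {u. \<exists>e. (\<forall>i<k. e i \<in> E) \<and> u - (\<Sum>i<k. v i * e i) \<in> M}"

text \<open>Jacobson density. Suppose that operators annihilating \<open>v 0\<close>, ...,
  \<open>v k\<close> annihilate \<open>u\<close>. On operators annihilating the vectors before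
  \<open>v k\<close>, sending the value at \<open>v k\<close> to the value at \<open>u\<close> is
  then well defined; it is right multiplication by some \<open>y\<close> in \<open>E\<close>, and by
  induction \<open>u - v k * y\<close> lies in the span of the vectors before
  \<open>v k\<close>.\<close>

lemma density:
  "u \<notin> span v k \<Longrightarrow> \<exists>s\<in>ops. (\<forall>i<k. s (v i) \<in> M) \<and> s u \<notin> M"
proof (induct k arbitrary: u)
  case 0
  hence "u \<notin> M" by (auto simp: span_def)
  thus ?case using ops_left[of 1] by (intro bexI[of _ "\<lambda>v. 1 * v"]) auto
next
  case (Suc k)
  show ?case
  proof (cases "v k \<in> span v k")
    case True
    then obtain f where f: "\<forall>i<k. f i \<in> E" "v k - (\<Sum>i<k. v i * f i) \<in> M" by (auto simp: span_def)
    have "u \<notin> span v k"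
    proof
      assume "u \<in> span v k"
      then obtain e where "\<forall>i<k. e i \<in> E" "u - (\<Sum>i<k. v i * e i) \<in> M" by (auto simp: span_def)
      hence "u \<in> span v (Suc k)" unfolding span_def
        by (intro CollectI exI[of _ "e(k := 0)"]) (auto simp: E_zero less_Suc_eq)
      thus False using Suc(2) by simp
    qed
    then obtain s where s: "s \<in> ops" "\<forall>i<k. s (v i) \<in> M" "s u \<notin> M" using Suc(1) by blast
    have sE: "s (v i * f i) \<in> M" if "i < k" for i
      using ops_E[OF s(1), of "f i" "v i"] ME[of "s (v i)" "f i"] s(2) f(1) that M_iff by blast
    have "s (\<Sum>i<m. v i * f i) \<in> M" if "m \<le> k" for m
      using that
    proof (induct m)
      case 0 show ?case using ops_diff[OF s(1), of 0 0] M_zero by simp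
    next
      case (Suc m) thus ?case using sE[of m] M_add by (simp add: ops_additive[OF s(1)])
    qed
    hence "s (v k) \<in> M" using ops_cong[OF s(1) f(2)] M_iff by blast
    thus ?thesis using s less_Suc_eq by auto
  next
    case False
    show ?thesis
    proof (rule ccontr)
      assume neg: "\<not> ?thesis"
      have kill: "s u \<in> M" if "s \<in> ops" "\<And>i. i < k \<Longrightarrow> s (v i) \<in> M" "s (v k) \<in> M" for s
        using neg that less_Suc_eq by metis
      \<comment> \<open>The values at \<open>v k\<close> of operators annihilating the earlier
        vectors form a left ideal larger than \<open>M\<close>, so 1 is among them modulo
        \<open>M\<close>.\<close>
      define L where "L = {s (v k) + m | s m. s \<in> ops \<and> (\<forall>i<k. s (v i) \<in> M) \<and> m \<in> M}"
      have "left_ideal L" unfolding left_ideal_def additive_subgroup_set_def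
      proof (intro conjI ballI allI)
        show "0 \<in> L" unfolding L_def using ops_zero M_zero by (auto intro!: exI[of _ "\<lambda>v. 0"])
        fix p q assume "p \<in> L"
        then obtain s m where p: "p = s (v k) + m" "s \<in> ops" "\<forall>i<k. s (v i) \<in> M" "m \<in> M"
          unfolding L_def by blast
        have lm: "r * p \<in> L" for r
        proof -
          have "r * p = r * s (v k) + r * m" using p by (simp add: distrib_left)
          moreover have "(\<lambda>v. r * s v) \<in> ops" using ops_comp[OF ops_left p(2)] .
          moreover have "\<forall>i<k. r * s (v i) \<in> M" using p(3) Ml by blast
          ultimately show ?thesis unfolding L_def using Ml[OF p(4)]
            by (intro CollectI exI[of _ "\<lambda>v. r * s v"] exI[of _ "r * m"]) auto
        qed
        show "r * p \<in> L" for r by (rule lm)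
        show "- p \<in> L" using lm[of "- 1"] by simp
        assume "q \<in> L"
        then obtain t n where q: "q = t (v k) + n" "t \<in> ops" "\<forall>i<k. t (v i) \<in> M" "n \<in> M"
          unfolding L_def by blast
        have "p + q = (s (v k) + t (v k)) + (m + n)" using p q by (simp add: algebra_simps)
        moreover have "\<forall>i<k. s (v i) + t (v i) \<in> M" using p(3) q(3) M_add by blast
        ultimately show "p + q \<in> L" unfolding L_def using M_add[OF p(4) q(4)] ops_plus[OF p(2) q(2)]
          by (intro CollectI exI[of _ "\<lambda>v. s v + t v"] exI[of _ "m + n"]) auto
      qed
      moreover have "M \<subseteq> L" unfolding L_def using ops_zero M_zero
        by (auto intro!: exI[of _ "\<lambda>v. 0"])
      moreover obtain s0 where s0: "s0 \<in> ops" "\<forall>i<k. s0 (v i) \<in> M" "s0 (v k) \<notin> M"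
        using Suc(1)[OF False] by blast
      moreover have "s0 (v k) \<in> L" unfolding L_def using s0 M_zero
        by (auto intro!: exI[of _ s0] exI[of _ 0])
      ultimately have "L = UNIV" using left_inverse by blast
      hence "1 \<in> L" by blast
      then obtain s1 m1 where s1: "1 = s1 (v k) + m1" "s1 \<in> ops" "\<forall>i<k. s1 (v i) \<in> M" "m1 \<in> M"
        unfolding L_def by blast
      have s1v: "s1 (v k) - 1 \<in> M" using M_neg[OF s1(4)] s1(1)
        by (metis add_diff_cancel_left' diff_minus_eq_add minus_diff_eq add.commute)
      \<comment> \<open>\<open>s1\<close> sends \<open>v k\<close> to 1 modulo \<open>M\<close>, so
        its value at \<open>u\<close> is the multiplier.\<close>
      define y where "y = s1 u"
      have "y \<in> E"
      proof (rule E_I)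
        have "p * y \<in> M" if p: "p \<in> M" for p
        proof -
          have "p * (s1 (v k) - 1) + p \<in> M" by (intro M_add Ml s1v p)
          hence 1: "p * s1 (v k) \<in> M" by (simp add: algebra_simps)
          show ?thesis unfolding y_def
            by (rule kill[of "\<lambda>v. p * s1 v"]) (use ops_comp[OF ops_left s1(2)] s1(3) Ml 1 in auto)
        qed
        thus "y \<in> idealizer" by (simp add: idealizer_def)
        fix e assume e: "e \<in> E"
        let ?s = "\<lambda>v. 1 * s1 v * e - e * s1 v"
        have o: "?s \<in> ops"
          by (rule ops_minus[OF ops_comp_base[OF s1(2) R0_props(2) e] ops_comp[OF ops_left s1(2)]])
        have "?s (v i) \<in> M" if "i < k" for i
        proof -
          have "s1 (v i) \<in> M" using s1(3) that by blast
          thus ?thesis by (intro M_diff[OF ME[OF Ml e] Ml])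
        qed
        moreover have "?s (v k) = (s1 (v k) - 1) * e - e * (s1 (v k) - 1)"
          by (simp add: algebra_simps)
        hence "?s (v k) \<in> M" using M_diff[OF ME[OF s1v e] Ml[OF s1v]] by simp
        ultimately have "?s u \<in> M" by (intro kill[OF o])
        thus "y * e - e * y \<in> M" by (simp add: y_def)
      qed
      have "s (u - v k * y) \<in> M" if s: "s \<in> ops" "\<forall>i<k. s (v i) \<in> M" for s
      proof -
        \<comment> \<open>\<open>?t\<close> annihilates \<open>v k\<close> as well, hence
          \<open>u\<close>; thus \<open>s u\<close> agrees with \<open>s (v k) * y\<close>.\<close>
        let ?t = "\<lambda>w. s w - s (v k) * s1 w"
        have o: "?t \<in> ops" by (rule ops_minus[OF s(1) ops_comp[OF ops_left s1(2)]])
        have "?t (v i) \<in> M" if "i < k" for i using s(2) s1(3) that by (auto intro!: M_diff Ml)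
        moreover have "?t (v k) = - (s (v k) * (s1 (v k) - 1))" by (simp add: algebra_simps)
        hence "?t (v k) \<in> M" using M_neg[OF Ml[OF s1v]] by simp
        ultimately have "?t u \<in> M" by (intro kill[OF o])
        moreover have "s (v k * y) - s (v k) * y \<in> M" by (rule ops_E[OF s(1) \<open>y \<in> E\<close>])
        ultimately have "?t u - (s (v k * y) - s (v k) * y) \<in> M" by (rule M_diff)
        moreover have "?t u - (s (v k * y) - s (v k) * y) = s (u - v k * y)"
          by (simp add: ops_diff[OF s(1)] y_def)
        ultimately show ?thesis by simp
      qed
      hence "u - v k * y \<in> span v k" using Suc(1)[of "u - v k * y"] by blast
      then obtain e where e: "\<forall>i<k. e i \<in> E" "u - v k * y - (\<Sum>i<k. v i * e i) \<in> M"
        by (auto simp: span_def)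
      have "u \<in> span v (Suc k)" unfolding span_def
        by (intro CollectI exI[of _ "e(k := y)"]) (use e \<open>y \<in>
          E\<close> in \<open>auto simp: less_Suc_eq algebra_simps\<close>)
      thus False using Suc(2) by simp
    qed
  qed
qed

text \<open>A nonzero value generates the simple module, so a further left multiplication moves it
  to any prescribed \<open>a\<close>.\<close>

corollary density_target:
  assumes "u \<notin> span v k"
  shows "\<exists>s\<in>ops. (\<forall>i<k. s (v i) \<in> M) \<and> s u - a \<in> M"
proof -
  obtain s where s: "s \<in> ops" "\<forall>i<k. s (v i) \<in> M" "s u \<notin> M" using density[OF assms] by blast
  let ?L = "{r * s u + m | r m. m \<in> M}"
  have "left_ideal ?L" unfolding left_ideal_def additive_subgroup_set_def
  proof (intro conjI ballI allI)
    show "0 \<in> ?L" using M_zero by (auto intro!: exI[of _ 0])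
    fix p q assume "p \<in> ?L"
    then obtain a m where p: "p = a * s u + m" "m \<in> M" by blast
    have "- p = (- a) * s u + (- m)" using p by simp
    thus "- p \<in> ?L" using M_neg[OF p(2)] by blast
    show "r * p \<in> ?L" for r
    proof -
      have "r * p = (r * a) * s u + r * m" using p by (simp add: algebra_simps)
      thus ?thesis using Ml[OF p(2)] by blast
    qed
    assume "q \<in> ?L"
    then obtain a' m' where q: "q = a' * s u + m'" "m' \<in> M" by blast
    have "p + q = (a + a') * s u + (m + m')" using p q by (simp add: algebra_simps)
    thus "p + q \<in> ?L" using M_add[OF p(2) q(2)] by blast
  qed
  moreover have "M \<subseteq> ?L"
  proof
    fix m assume m: "m \<in> M"
    have "m = 0 * s u + m" by simp
    thus "m \<in> ?L" using m by blast
  qed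
  moreover have "s u \<in> ?L"
  proof -
    have "s u = 1 * s u + 0" by simp
    thus ?thesis using M_zero by blast
  qed
  ultimately have "?L = UNIV" using left_inverse[OF s(3)] by blast
  then obtain r m where r: "a = r * s u + m" "m \<in> M" by blast
  have "r * s u - a \<in> M" using M_neg[OF r(2)] r(1) by simp
  thus ?thesis using ops_comp[OF ops_left s(1), of r] s(2) Ml
    by (intro bexI[of _ "\<lambda>v. r * s v"]) auto
qed

end

section \<open>Finiteness of a finitely generated residue field\<close>

text \<open>Turns \<open>E\<close> modulo \<open>M\<close> into a quotient ring in record form,
  where the theorem on fields finitely generated as rings applies. The result returns as a finite
  set of representatives, since quotients are not formed on the type level.\<close>

lemma finite_residue_field:
  fixes E M :: "'b::ring_1 set"
  assumes E: "subring_set E" and M: "additive_subgroup_set M" "M \<subseteq> E"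
    and EM: "\<And>e m. e \<in> E \<Longrightarrow> m \<in> M \<Longrightarrow> e * m \<in> M" and ME: "\<And>e m. e \<in> E \<Longrightarrow> m \<in> M \<Longrightarrow> m * e \<in> M"
    and comm: "\<And>a b. a \<in> E \<Longrightarrow> b \<in> E \<Longrightarrow> a * b - b * a \<in> M" and one: "1 \<notin> M"
    and inv: "\<And>y. y \<in> E \<Longrightarrow> y \<notin> M \<Longrightarrow> \<exists>z\<in>E. y * z - 1 \<in> M"
    and Y: "finite Y" "Y \<subseteq> E"
    and gen: "\<And>C. subring_set C \<Longrightarrow> M \<subseteq> C \<Longrightarrow> C \<subseteq> E \<Longrightarrow> Y \<subseteq> C \<Longrightarrow> C = E"
  shows "\<exists>T. finite T \<and> T \<subseteq> E \<and> (\<forall>e\<in>E. \<exists>t\<in>T. e - t \<in> M)"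
proof -
  define R :: "'b ring" where "R = \<lparr>carrier = E, monoid.mult = (*), one = 1, ring.zero = 0,
    ring.add = (+)\<rparr>"
  have sel [simp]: "carrier R = E" "x \<otimes>\<^bsub>R\<^esub> y = x * y" "x \<oplus>\<^bsub>R\<^esub> y = x + y" "\<one>\<^bsub>R\<^esub> = 1" "\<zero>\<^bsub>R\<^esub> = 0" for x y
    by (simp_all add: R_def)
  have Ea: "additive_subgroup_set E" and E1: "1 \<in> E" and Em: "\<And>a b. a \<in> E \<Longrightarrow> b \<in> E \<Longrightarrow> a * b \<in> E"
    using E by (auto simp: subring_set_def)
  note Es = asub_zero[OF Ea] asub_add[OF Ea] asub_neg[OF Ea]
  interpret R: ring R
  proof (rule ringI)
    show "abelian_group R"
    proof (rule abelian_groupI)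
      show "\<exists>y\<in>carrier R. y \<oplus>\<^bsub>R\<^esub> x = \<zero>\<^bsub>R\<^esub>" if "x \<in> carrier R" for x
        using that Es(3) by (intro bexI[of _ "- x"]) auto
    qed (auto simp: Es add.assoc add.commute)
    show "monoid R" by unfold_locales (auto simp: E1 Em mult.assoc)
  qed (auto simp: distrib_left distrib_right)
  have neg [simp]: "\<ominus>\<^bsub>R\<^esub> x = - x" if "x \<in> E" for x
    using R.minus_equality[of "- x" x] that Es(3) by simp
  have "subgroup M (add_monoid R)"
  proof (rule R.add.subgroupI)
    show "\<ominus>\<^bsub>R\<^esub> a \<in> M" if "a \<in> M" for a using that M asub_neg[OF M(1)] by auto
  qed (use M asub_zero[OF M(1)] asub_add[OF M(1)] in auto)
  then interpret I: ideal M R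
    by (intro idealI R.ring_axioms) (auto intro: EM ME)
  define K where "K = R Quot M"
  interpret K: ring K unfolding K_def by (rule I.quotient_is_ring)
  define h where "h = (+>\<^bsub>R\<^esub>) M"
  interpret h: ring_hom_ring R K h unfolding h_def K_def by (rule I.rcos_ring_hom_ring)
  have Kc: "carrier K = h ` E" unfolding K_def h_def
    by (auto simp: FactRing_def A_RCOSETS_def' a_r_coset_def)
  have h_eq: "h a = h b \<longleftrightarrow> a - b \<in> M" if "a \<in> E" "b \<in> E" for a b
    using R.quotient_eq_iff_same_a_r_cos[OF I.is_ideal, of a b] that
      by (simp add: h_def a_minus_def)
  have hm: "h a \<otimes>\<^bsub>K\<^esub> h b = h (a * b)" "h a \<oplus>\<^bsub>K\<^esub> h b = h (a + b)" if "a \<in> E" "b \<in> E" for a b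
    using h.hom_mult[of a b] h.hom_add[of a b] that by auto
  have h01: "\<one>\<^bsub>K\<^esub> = h 1" "\<zero>\<^bsub>K\<^esub> = h 0" using h.hom_one h.hom_zero by auto
  interpret K: cring K
  proof (intro cring.intro K.ring_axioms K.monoid_comm_monoidI)
    show "x \<otimes>\<^bsub>K\<^esub> y = y \<otimes>\<^bsub>K\<^esub> x" if xy: "x \<in> carrier K" "y \<in> carrier K" for x y
    proof -
      obtain a b where ab: "a \<in> E" "b \<in> E" "x = h a" "y = h b" using xy unfolding Kc by blast
      have "h (a * b) = h (b * a)" using h_eq[OF Em Em] comm ab by blast
      thus ?thesis using ab by (simp only: hm)
    qed
  qed
  interpret K: field K
  proof (rule K.cring_fieldI2)
    show "\<zero>\<^bsub>K\<^esub> \<noteq> \<one>\<^bsub>K\<^esub>"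
      unfolding h01 using h_eq[OF E1 Es(1)] one by (metis diff_zero)
    fix a assume a: "a \<in> carrier K" "a \<noteq> \<zero>\<^bsub>K\<^esub>"
    then obtain y where y: "y \<in> E" "a = h y" by (auto simp: Kc)
    hence "y \<notin> M" using a(2) h_eq[OF y(1) Es(1)] unfolding h01 by auto
    then obtain z where z: "z \<in> E" "y * z - 1 \<in> M" using inv y by blast
    hence "h (y * z) = h 1" using y h_eq[OF Em E1] by blast
    hence "a \<otimes>\<^bsub>K\<^esub> h z = \<one>\<^bsub>K\<^esub>" using y z by (simp only: hm h01)
    thus "\<exists>b\<in>carrier K. a \<otimes>\<^bsub>K\<^esub> b = \<one>\<^bsub>K\<^esub>" using z Kc by blast
  qed
  obtain ys where ys: "set ys = Y" using Y finite_list by blast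
  have "finite (carrier K)"
  proof (rule K.finitely_generated_field_finite)
    show "set (map h ys) \<subseteq> carrier K" using ys Y Kc by auto
    fix S assume S: "subring S K" and Sg: "set (map h ys) \<subseteq> S"
    note Ss = subringE[OF S]
    define C where "C = {e \<in> E. h e \<in> S}"
    have "C = E"
    proof (rule gen)
      have "h (- a) \<in> S" if "a \<in> E" "h a \<in> S" for a
        using Ss(5)[OF that(2)] h.hom_a_inv[of a] that by simp
      thus "subring_set C"
        unfolding subring_set_def additive_subgroup_set_def C_def
        using Ss Es E1 Em by (auto simp: h01 simp flip: hm)
      have "h m = \<zero>\<^bsub>K\<^esub>" if "m \<in> M" for m
        unfolding h01 using h_eq[of m 0] that M(2) Es(1) by auto
      thus "M \<subseteq> C" using M Ss(2) by (auto simp: C_def)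
      show "C \<subseteq> E" "Y \<subseteq> C" using Y ys Sg by (auto simp: C_def)
    qed
    thus "S = carrier K" using Ss(1) unfolding Kc C_def by blast
  qed
  hence "finite (h ` E)" by (simp add: Kc)
  then obtain T where T: "T \<subseteq> E" "finite T" "h ` T = h ` E"
    using finite_subset_image[of "h ` E" h E] by auto
  have "\<exists>t\<in>T. e - t \<in> M" if e: "e \<in> E" for e
  proof -
    have "h e \<in> h ` T" using T e by blast
    then obtain t where "t \<in> T" "h e = h t" by blast
    thus ?thesis using h_eq[of e t] e T by blast
  qed
  thus ?thesis using T by blast
qed

section \<open>The identity for operators and the dimension bound\<close>

lemma foldr_add_slot:
  assumes "distinct w" "j \<in> set w"
    and "\<And>i v v'. i \<in> set w \<Longrightarrow> i \<noteq> j \<Longrightarrow> s i (v + v') = s i v + (s i v' :: 'b::ab_group_add)"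
  shows "foldr (s(j := (\<lambda>v. p v + q v))) w v = foldr (s(j := p)) w v + foldr (s(j := q)) w v"
  using assms
proof (induct w)
  case (Cons i w)
  show ?case
  proof (cases "i = j")
    case True
    hence "j \<notin> set w" using Cons(2) by simp
    hence f: "foldr (s(j := f)) w v = foldr s w v" for f by (intro foldr_cong) auto
    show ?thesis unfolding True by (simp only: foldr.simps o_apply fun_upd_same f)
  next
    case False
    thus ?thesis using Cons by simp
  qed
qed simp

lemma foldr_base:
  "(\<And>i. i \<in> set w \<Longrightarrow> s i = (\<lambda>v. c i * v * e i)) \<Longrightarrow>
   foldr s w v = prod_list (map c w) * v * prod_list (map e (rev w))" for v :: "'b::ring_1"
  by (induct w) (simp_all add: mult.assoc)

context simple_module
begin

lemma E_prod_list: "(\<And>i. i \<in> set w \<Longrightarrow> e i \<in> E) \<Longrightarrow> prod_list (map e w) \<in> E"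
  by (induct w) (auto simp: E_one E_mult)

lemma E_prod_perm:
  assumes "\<And>i. i \<in> J \<Longrightarrow> e i \<in> E"
  shows "w \<in> permutations_of_set J \<Longrightarrow> w' \<in> permutations_of_set J \<Longrightarrow>
     prod_list (map e w) - prod_list (map e w') \<in> M"
  using assms
proof (induct w arbitrary: J w')
  case Nil
  hence "w' = []" by (auto simp: permutations_of_set_def)
  thus ?case using M_zero by simp
next
  case (Cons i w)
  have i: "i \<in> J" "w \<in> permutations_of_set (J - {i})" using Cons(2)
    by (auto simp: permutations_of_set_Cons)
  hence "i \<in> set w'" using Cons(3) by (auto simp: permutations_of_set_def)
  then obtain u v where w': "w' = u @ i # v" by (meson split_list)
  have uv: "u @ v \<in> permutations_of_set (J - {i})" using Cons(3) w'
    by (auto simp: permutations_of_set_def)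
  have ei: "e i \<in> E" using Cons(4) i by blast
  have pE: "prod_list (map e u) \<in> E" "prod_list (map e v) \<in> E"
    using Cons(3,4) w' by (auto intro!: E_prod_list simp: permutations_of_set_def)
  have "prod_list (map e w) - prod_list (map e (u @ v)) \<in> M"
    by (rule Cons(1)[OF i(2) uv]) (use Cons(4) in blast)
  hence 1: "e i * (prod_list (map e w) - prod_list (map e (u @ v))) \<in> M" by (rule Ml)
  have 2: "(e i * prod_list (map e u) - prod_list (map e u) * e i) * prod_list (map e v) \<in> M"
    by (rule ME[OF E_comm[OF ei pE(1)] pE(2)])
  have "prod_list (map e (i # w)) - prod_list (map e w') =
     e i * (prod_list (map e w) - prod_list (map e (u @ v))) +
     (e i * prod_list (map e u) - prod_list (map e u) * e i) * prod_list (map e v)"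
    unfolding w' by (simp add: algebra_simps)
  thus ?case using M_add[OF 1 2] by simp
qed

text \<open>The multilinear identity evaluated at operators, with composition as product and the
  coefficients as scalars on the right.\<close>

definition opsum :: "('i \<Rightarrow> 'b \<Rightarrow> 'b) \<Rightarrow> 'b \<Rightarrow> 'b" where
  "opsum s v = (\<Sum>w\<in>permutations_of_set I. foldr s w v * \<gamma> w)"

definition base_op :: "('b \<Rightarrow> 'b) \<Rightarrow> bool" where
  "base_op f \<longleftrightarrow> (\<exists>c\<in>R0. \<exists>e\<in>E. f = (\<lambda>v. c * v * e))"

lemma base_op_ops: "base_op f \<Longrightarrow> f \<in> ops"
  using ops_base by (auto simp: base_op_def)

text \<open>The scalars of the factors combine to a single \<epsilon>, the same for each ordering
  because \<open>E\<close> is commutative modulo \<open>M\<close>. What remains is the identity on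
  \<open>R0\<close>, applied to \<open>v * \<epsilon>\<close>.\<close>

lemma opsum_base:
  assumes "\<And>i. i \<in> I \<Longrightarrow> base_op (s i)"
  shows "opsum s v \<in> M"
proof -
  have "\<forall>i\<in>I. \<exists>c e. c \<in> R0 \<and> e \<in> E \<and> s i = (\<lambda>v. c * v * e)"
    using assms unfolding base_op_def by blast
  then obtain c e where ce: "\<And>i. i \<in> I \<Longrightarrow> c i \<in> R0 \<and> e i \<in> E \<and> s i = (\<lambda>v. c i * v * e i)" by metis
  \<comment> \<open>The identity is assumed for assignments with values in \<open>R0\<close> at
    every index, so indices outside \<open>I\<close> get the value 0.\<close>
  define c' where "c' i = (if i \<in> I then c i else 0)" for i
  have c': "c' i \<in> R0" for i using ce R0_props(1) by (auto simp: c'_def)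
  define \<epsilon> where "\<epsilon> = prod_list (map e w0)"
  have f: "foldr s w v = prod_list (map c' w) * v * prod_list (map e (rev w))"
    if "w \<in> permutations_of_set I" for w
    by (rule foldr_base) (use that ce in \<open>auto simp: c'_def permutations_of_set_def\<close>)
  have d: "foldr s w v * \<gamma> w - prod_list (map c' w) * (v * \<epsilon>) * \<gamma> w \<in> M"
    if w: "w \<in> permutations_of_set I" for w
  proof -
    have "rev w \<in> permutations_of_set I" using w by (auto simp: permutations_of_set_def)
    hence "prod_list (map e (rev w)) - \<epsilon> \<in> M" unfolding \<epsilon>_def
      by (rule E_prod_perm[rotated, OF _ w0]) (use ce in blast)
    hence "(prod_list (map c' w) * v) * (prod_list (map e (rev w)) - \<epsilon>) * \<gamma> w \<in> M"
      by (intro ME[OF Ml] \<gamma>_E)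
    thus ?thesis unfolding f[OF w] by (simp add: algebra_simps)
  qed
  have "opsum s v = (\<Sum>w\<in>permutations_of_set I. foldr s w v * \<gamma> w -
    prod_list (map c' w) * (v * \<epsilon>) * \<gamma> w)
      + (\<Sum>w\<in>permutations_of_set I. prod_list (map c' w) * (v * \<epsilon>) * \<gamma> w)"
    unfolding opsum_def by (simp add: sum_subtractf)
  moreover have "(\<Sum>w\<in>permutations_of_set I. foldr s w v * \<gamma> w -
    prod_list (map c' w) * (v * \<epsilon>) * \<gamma> w) \<in> M"
    by (rule M_sum[OF d])
  ultimately show ?thesis using M_add identity_right[OF c'] by simp
qed

lemma opsum_slot:
  assumes "j \<in> I" "\<And>i. i \<in> I \<Longrightarrow> s i \<in> ops"
  shows "opsum (s(j := (\<lambda>v. p v + q v))) v = opsum (s(j := p)) v + opsum (s(j := q)) v"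
proof -
  have "foldr (s(j := (\<lambda>v. p v + q v))) w v = foldr (s(j := p)) w v + foldr (s(j := q)) w v"
    if "w \<in> permutations_of_set I" for w
    by (rule foldr_add_slot) (use that assms ops_additive in \<open>auto simp: permutations_of_set_def\<close>)
  thus ?thesis unfolding opsum_def by (simp add: distrib_right sum.distrib)
qed

text \<open>Multilinearity carries the identity from the spanning operators to their sums, one slot
  at a time.\<close>

lemma opsum_ops:
  assumes "\<And>i. i \<in> I \<Longrightarrow> s i \<in> ops"
  shows "opsum s v \<in> M"
proof -
  have "\<And>s. (\<And>i. i \<in> I \<Longrightarrow> s i \<in> ops) \<Longrightarrow> (\<And>i. i \<in> I - J \<Longrightarrow> base_op (s i)) \<Longrightarrow> opsum s v \<in> M"
    if "finite J" "J \<subseteq> I" for J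
    using that
  proof (induct J)
    case empty thus ?case using opsum_base by simp
  next
    case (insert j J)
    have j: "j \<in> I" using insert by simp
    have ops: "\<And>i. i \<in> I \<Longrightarrow> s i \<in> ops" using insert by blast
    have b: "opsum (s(j := p)) v \<in> M" if p: "base_op p" for p
      by (rule insert(3)) (use insert p base_op_ops in auto)
    have "opsum (s(j := p)) v \<in> M" if "p \<in> ops" for p
      using that
    proof (induct p rule: ops.induct)
      case ops_zero
      have "base_op (\<lambda>v. 0 * v * 1)" using R0_props(1) E_one unfolding base_op_def by blast
      from b[OF this] show ?case by (simp only: mult_zero_left)
    next
      case (ops_add p c e)
      have "base_op (\<lambda>v. c * v * e)" using ops_add unfolding base_op_def by blast
      hence "opsum (s(j := p)) v + opsum (s(j := (\<lambda>v. c * v * e))) v \<in> M"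
        using M_add[OF ops_add(2) b] by blast
      moreover have "opsum (s(j := (\<lambda>v. p v + c * v * e))) v =
          opsum (s(j := p)) v + opsum (s(j := (\<lambda>v. c * v * e))) v"
        by (rule opsum_slot[OF j ops])
      ultimately show ?case by (simp only:)
    qed
    from this[of "s j"] show ?case using ops[OF j] by simp
  qed
  from this[OF finI order_refl assms] show ?thesis by simp
qed

lemma fold_ops_M: "(\<And>i. i \<in> set us \<Longrightarrow> s i \<in> ops) \<Longrightarrow> v \<in> M \<Longrightarrow> fold s us v \<in> M"
  by (induct us arbitrary: v) (auto intro: ops_M)

text \<open>Density provides operators \<open>t\<^sub>i\<close> that send \<open>v\<^sub>i\<close> to \<open>v\<^sub>i\<^sub>+\<^sub>1\<close> and annihilate the earlier vectors.
  If the \<open>v\<^sub>i\<close> were as many as the variables, only one ordering of the product of the \<open>t\<^sub>i\<close> would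
  survive in the identity.\<close>

lemma indep_bound:
  assumes ind: "\<And>i. i < k \<Longrightarrow> v i \<notin> span v i"
  shows "k < card I"
proof (rule ccontr)
  assume "\<not> k < card I"
  define d where "d = card I"
  have dk: "d \<le> k" using \<open>\<not> k < card I\<close> by (simp add: d_def)
  \<comment> \<open>Behind the last vector used the chain continues with 1, a target outside
    \<open>M\<close>.\<close>
  define a where "a i = (if i < d then v i else 1)" for i
  have "\<forall>i\<in>{..<d}. \<exists>t. t \<in> ops \<and> (\<forall>j<i. t (v j) \<in> M) \<and> t (v i) - a (Suc i) \<in> M"
    using density_target ind dk by (meson lessThan_iff order_less_le_trans)
  then obtain t where t: "\<And>i. i < d \<Longrightarrow> t i \<in> ops" "\<And>i j. i < d \<Longrightarrow> j < i \<Longrightarrow> t i (v j) \<in> M"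
    "\<And>i. i < d \<Longrightarrow> t i (v i) - a (Suc i) \<in> M"
    by (metis lessThan_iff)
  \<comment> \<open>\<open>foldr\<close> applies the last letter first, so positions are counted
    along the reverse of \<open>w0\<close>.\<close>
  define l where "l = rev w0"
  have l: "distinct l" "set l = I" "length l = d"
    using w0 by (auto simp: l_def permutations_of_set_def d_def distinct_card)
  define pos where "pos x = (THE i. i < d \<and> l ! i = x)" for x
  have pos: "pos (l ! i) = i" if "i < d" for i
    unfolding pos_def by (rule the_equality) (use that l nth_eq_iff_index_eq in auto)
  have posI: "pos x < d" "l ! pos x = x" if "x \<in> I" for x
    using that l pos by (metis in_set_conv_nth)+
  define s where "s x = t (pos x)" for x
  have s: "s x \<in> ops" if "x \<in> I" for x using t(1) posI(1)[OF that] by (simp add: s_def)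
  have pre: "fold s (take i l) (a 0) - a i \<in> M" if "i \<le> d" for i
    using that
  proof (induct i)
    case 0 show ?case using M_zero by simp
  next
    case (Suc i)
    have i: "i < d" using Suc by simp
    have ti: "take (Suc i) l = take i l @ [l ! i]" using i l by (simp add: take_Suc_conv_app_nth)
    have "fold s (take i l) (a 0) - a i \<in> M" using Suc(1) i by simp
    hence "t i (fold s (take i l) (a 0)) - t i (a i) \<in> M" by (rule ops_cong[OF t(1)[OF i]])
    moreover have "t i (a i) - a (Suc i) \<in> M" using t(3)[OF i] i by (simp add: a_def)
    ultimately have "t i (fold s (take i l) (a 0)) - a (Suc i) \<in> M" by (rule M_trans)
    moreover have "s (l ! i) = t i" using pos[OF i] by (simp add: s_def)
    ultimately show ?case unfolding ti by simp
  qed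
  have other: "fold s us (a 0) \<in> M" if us: "us \<in> permutations_of_set I" "us \<noteq> l" for us
  proof -
    have u: "distinct us" "set us = I" "length us = d"
      using us by (auto simp: permutations_of_set_def d_def distinct_card)
    have "\<exists>i<d. us ! i \<noteq> l ! i" using us(2) u(3) l(3) nth_equalityI by metis
    \<comment> \<open>At the first departure of \<open>us\<close> from \<open>l\<close> the next
      operator belongs to a later position \<open>j > i\<close>, and that operator annihilates the
      current vector \<open>v i\<close>.\<close>
    define i where "i = (LEAST i. i < d \<and> us ! i \<noteq> l ! i)"
    have i: "i < d" "us ! i \<noteq> l ! i"
      using LeastI_ex[OF \<open>\<exists>i<d. us ! i \<noteq> l ! i\<close>] by (auto simp: i_def)
    have same: "us ! j = l ! j" if "j < i" for j
      using not_less_Least[of j "\<lambda>i. i < d \<and> us ! i \<noteq> l ! i"] that i(1) by (auto simp: i_def)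
    have tk: "take i us = take i l" by (rule nth_equalityI) (use same i u l in auto)
    have ui: "us ! i \<in> I" using u i by auto
    define j where "j = pos (us ! i)"
    have j: "j < d" "l ! j = us ! i" using posI[OF ui] by (auto simp: j_def)
    have "i < j"
    proof (rule ccontr)
      assume "\<not> i < j"
      moreover have "j \<noteq> i" using j i by auto
      ultimately have "j < i" by simp
      hence "us ! j = us ! i" using same j by simp
      thus False using u \<open>j < i\<close> i nth_eq_iff_index_eq[of us j i] by simp
    qed
    have "t j (fold s (take i l) (a 0)) - t j (a i) \<in> M"
      by (rule ops_cong[OF t(1)[OF j(1)] pre]) (use i in simp)
    moreover have "t j (a i) \<in> M" using t(2)[OF j(1) \<open>i < j\<close>] i by (simp add: a_def)
    ultimately have "t j (fold s (take i l) (a 0)) \<in> M" using M_iff by blast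
    moreover have "s (us ! i) = t j" by (simp add: s_def j_def)
    ultimately have "fold s (take (Suc i) us) (a 0) \<in> M"
      using i u by (simp add: take_Suc_conv_app_nth tk)
    hence "fold s (drop (Suc i) us) (fold s (take (Suc i) us) (a 0)) \<in> M"
      by (rule fold_ops_M[rotated]) (use u s in_set_dropD in fast)
    moreover have "fold s us (a 0) = fold s (drop (Suc i) us) (fold s (take (Suc i) us) (a 0))"
      by (metis append_take_drop_id fold_append comp_apply)
    ultimately show ?thesis by simp
  qed
  have main: "foldr s w0 (a 0) - 1 \<in> M"
    using pre[of d] l by (simp add: foldr_conv_fold l_def[symmetric] a_def)
  have "opsum s (a 0) = foldr s w0 (a 0) * \<gamma> w0 + (\<Sum>w\<in>permutations_of_set I -
    {w0}. foldr s w (a 0) * \<gamma> w)"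
    unfolding opsum_def by (rule sum.remove[OF _ w0]) simp
  moreover have "(\<Sum>w\<in>permutations_of_set I - {w0}. foldr s w (a 0) * \<gamma> w) \<in> M"
  proof (rule M_sum, rule ME[OF _ \<gamma>_E])
    fix w assume w: "w \<in> permutations_of_set I - {w0}"
    have "rev w \<in> permutations_of_set I" using w by (auto simp: permutations_of_set_def)
    moreover have "rev w \<noteq> l" using w by (auto simp: l_def)
    ultimately show "foldr s w (a 0) \<in> M" using other by (simp add: foldr_conv_fold)
  qed
  moreover have "opsum s (a 0) \<in> M" by (rule opsum_ops[OF s])
  ultimately have "foldr s w0 (a 0) \<in> M" using M_diff \<gamma>_w0
    by (metis add_diff_cancel_right' mult_1_right)
  hence "1 \<in> M" using main M_iff by blast
  thus False using one_M by simp
qed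

lemma span_cong: "(\<And>i. i < k \<Longrightarrow> v i = v' i) \<Longrightarrow> span v k = span v' k"
  unfolding span_def by (metis (no_types, lifting) lessThan_iff sum.cong)

section \<open>Dimension over the maximal subfield and finiteness of the module\<close>

text \<open>If the last coefficient were nonzero modulo \<open>M\<close>, it would be invertible,
  and the last vector would lie in the span of the earlier ones. So the successive condition implies
  independence in the usual sense.\<close>

lemma indep_unique:
  assumes ind: "\<And>i. i < k \<Longrightarrow> v i \<notin> span v i"
  shows "(\<And>i. i < k \<Longrightarrow> e i \<in> E) \<Longrightarrow> (\<Sum>i<k. v i * e i) \<in> M \<Longrightarrow> i < k \<Longrightarrow> e i \<in> M"
  using ind
proof (induct k)
  case (Suc k)
  have ek: "e k \<in> E" using Suc by simp
  have "e k \<in> M"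
  proof (rule ccontr)
    assume "e k \<notin> M"
    then obtain z where z: "z \<in> E" "e k * z - 1 \<in> M" using E_inverse[OF ek] by blast
    have "(\<Sum>i<Suc k. v i * e i) * z \<in> M" using ME[OF Suc(3) z(1)] .
    moreover have "v k * (e k * z - 1) \<in> M" by (rule Ml[OF z(2)])
    ultimately have "(\<Sum>i<Suc k. v i * e i) * z - v k * (e k * z - 1) \<in> M" by (rule M_diff)
    moreover have "(\<Sum>i<Suc k. v i * e i) * z - v k * (e k * z - 1) = v k - (\<Sum>i<k. v i * (-
      (e i * z)))"
      by (simp add: algebra_simps sum_distrib_right sum_negf)
    ultimately have "v k \<in> span v k" unfolding span_def
      using Suc(2) z(1) by (intro CollectI exI[of _ "\<lambda>i. - (e i * z)"]) (auto intro!: E_neg E_mult)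
    thus False using Suc(5)[of k] by simp
  qed
  moreover have "e i \<in> M" if "i < k"
  proof (rule Suc(1)[OF _ _ that])
    have "v k * e k \<in> M" by (rule Ml[OF \<open>e k \<in> M\<close>])
    thus "(\<Sum>i<k. v i * e i) \<in> M" using M_diff[OF Suc(3), of "v k * e k"] by simp
  qed (use Suc in auto)
  ultimately show ?case using Suc(4) by (auto simp: less_Suc_eq)
qed simp

definition E_subspace :: "'b set \<Rightarrow> bool" where
  "E_subspace W \<longleftrightarrow> additive_subgroup_set W \<and> M \<subseteq> W \<and> (\<forall>w\<in>W. \<forall>e\<in>E. w * e \<in> W)"

text \<open>The dimension of \<open>W\<close> modulo \<open>M\<close>, taken as the greatest length
  of an independent sequence; the maximum exists since the degree of the identity bounds these
  lengths.\<close>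

definition E_dim :: "'b set \<Rightarrow> nat" where
  "E_dim W = Max {k. \<exists>v. \<forall>i<k. v i \<in> W \<and> v i \<notin> span v i}"

lemma E_dim_finite: "finite {k. \<exists>v. \<forall>i<k. v i \<in> W \<and> v i \<notin> span v i}"
  by (rule finite_subset[of _ "{..<card I}"]) (use indep_bound in auto)

lemma E_dim_attained: "\<exists>v. \<forall>i<E_dim W. v i \<in> W \<and> v i \<notin> span v i"
  using Max_in[OF E_dim_finite[of W]] unfolding E_dim_def by blast

lemma E_dim_bound: "E_dim W < card I"
  using E_dim_attained[of W] indep_bound by blast

lemma span_subset:
  assumes "E_subspace W" "\<And>i. i < k \<Longrightarrow> v i \<in> W" shows "span v k \<subseteq> W"
proof
  fix u assume "u \<in> span v k"
  then obtain e where e: "\<forall>i<k. e i \<in> E" "u - (\<Sum>i<k. v i * e i) \<in> M" by (auto simp: span_def)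
  have Wa: "additive_subgroup_set W" using assms by (simp add: E_subspace_def)
  have "(\<Sum>i<k. v i * e i) \<in> W"
    by (rule asub_sum[OF Wa]) (use e assms in \<open>auto simp: E_subspace_def\<close>)
  moreover have "u - (\<Sum>i<k. v i * e i) \<in> W" using e assms by (auto simp: E_subspace_def)
  ultimately show "u \<in> W" using asub_iff[OF Wa] by blast
qed

lemma extend_indep:
  assumes v: "\<And>i. i < k \<Longrightarrow> v i \<in> W \<and> v i \<notin> span v i" and u: "u \<in> W" "u \<notin> span v k"
  shows "Suc k \<le> E_dim W"
proof -
  let ?v = "v(k := u)"
  have "span ?v i = span v i" if "i \<le> k" for i by (rule span_cong) (use that in auto)
  hence "\<forall>i<Suc k. ?v i \<in> W \<and> ?v i \<notin> span ?v i" using v u by (auto simp: less_Suc_eq)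
  hence "Suc k \<in> {k. \<exists>v. \<forall>i<k. v i \<in> W \<and> v i \<notin> span v i}" by blast
  thus ?thesis unfolding E_dim_def by (rule Max_ge[OF E_dim_finite])
qed

lemma E_dim_strict_mono:
  assumes "E_subspace W" "W \<subset> W'" shows "E_dim W < E_dim W'"
proof -
  obtain v where v: "\<forall>i<E_dim W. v i \<in> W \<and> v i \<notin> span v i" using E_dim_attained by blast
  obtain u where u: "u \<in> W'" "u \<notin> W" using assms(2) by blast
  have "u \<notin> span v (E_dim W)" using span_subset[OF assms(1)] v u by blast
  hence "Suc (E_dim W) \<le> E_dim W'" using extend_indep[of "E_dim W" v W' u] v u assms(2) by blast
  thus ?thesis by simp
qed

text \<open>The matrix entries of the generators with respect to a basis over \<open>E\<close> generate the field \<open>E\<close>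
  modulo \<open>M\<close> as a ring, so this field is finite.\<close>

theorem finite_quotient:
  assumes B: "finite B"
    and gen: "\<And>S. subring_set S \<Longrightarrow> B \<subseteq> S \<Longrightarrow> {b. \<forall>v. b * v \<in> M} \<subseteq> S \<Longrightarrow> S = UNIV"
  shows "\<exists>T. finite T \<and> (\<forall>u. \<exists>t\<in>T. u - t \<in> M)"
proof -
  define k where "k = E_dim UNIV"
  obtain v where v: "\<And>i. i < k \<Longrightarrow> v i \<notin> span v i" using E_dim_attained[of UNIV] unfolding k_def
    by blast
  have spanU: "u \<in> span v k" for u
    using extend_indep[of k v UNIV u] v by (auto simp: k_def)
  have k0: "0 < k"
  proof (rule ccontr)
    assume "\<not> 0 < k"
    thus False using spanU[of 1] one_M by (simp add: span_def)
  qed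
  define co where "co u = (SOME e. (\<forall>i<k. e i \<in> E) \<and> u - (\<Sum>i<k. v i * e i) \<in> M)" for u
  have co: "\<And>u i. i < k \<Longrightarrow> co u i \<in> E" "\<And>u. u - (\<Sum>i<k. v i * co u i) \<in> M"
  proof -
    have "(\<forall>i<k. co u i \<in> E) \<and> u - (\<Sum>i<k. v i * co u i) \<in> M" for u
      unfolding co_def using spanU[of u] unfolding span_def mem_Collect_eq by (rule someI_ex)
    thus "\<And>u i. i < k \<Longrightarrow> co u i \<in> E" "\<And>u. u - (\<Sum>i<k. v i * co u i) \<in> M" by blast+
  qed
  define Y where "Y = (\<lambda>(g, i, j). co (g * v i) j) ` (B \<times> {..<k} \<times> {..<k})"
  have "\<exists>T. finite T \<and> T \<subseteq> E \<and> (\<forall>e\<in>E. \<exists>t\<in>T. e - t \<in> M)"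
  proof (rule finite_residue_field)
    show "subring_set E" by (simp add: subring_set_def E_asub E_one E_mult)
    show "additive_subgroup_set M" by (rule Ma)
    show "M \<subseteq> E" by (rule M_E)
    show "finite Y" unfolding Y_def using B by simp
    show "Y \<subseteq> E" unfolding Y_def using co by auto
    show "\<exists>z\<in>E. y * z - 1 \<in> M" if "y \<in> E" "y \<notin> M" for y using E_inverse[OF that] by blast
    fix C assume C: "subring_set C" "M \<subseteq> C" "C \<subseteq> E" "Y \<subseteq> C"
    have Ca: "additive_subgroup_set C" and C1: "1 \<in> C" and Cm: "\<And>a b. a \<in> C \<Longrightarrow> b \<in> C \<Longrightarrow> a * b \<in> C"
      using C(1) by (auto simp: subring_set_def)
    \<comment> \<open>\<open>N\<close> is the lattice spanned over \<open>C\<close> by the basis. It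
      is stable under the generators, whose matrix entries lie in \<open>C\<close>, so it is a left
      ideal and hence everything; comparing coefficients of \<open>v 0 * e\<close> then puts
      \<open>e\<close> into \<open>C\<close>.\<close>
    define N where "N = {u. \<exists>e. (\<forall>i<k. e i \<in> C) \<and> u - (\<Sum>i<k. v i * e i) \<in> M}"
    have Na: "additive_subgroup_set N" unfolding additive_subgroup_set_def
    proof (intro conjI ballI)
      show "0 \<in> N" unfolding N_def using asub_zero[OF Ca] M_zero by (auto intro!: exI[of _ "\<lambda>i. 0"])
      fix p q assume "p \<in> N"
      then obtain e where e: "\<forall>i<k. e i \<in> C" "p - (\<Sum>i<k. v i * e i) \<in> M" by (auto simp: N_def)
      have "- p - (\<Sum>i<k. v i * - e i) = - (p - (\<Sum>i<k. v i * e i))" by (simp add: sum_negf)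
      hence "- p - (\<Sum>i<k. v i * - e i) \<in> M" using M_neg[OF e(2)] by (simp only:)
      thus "- p \<in> N" unfolding N_def using e(1) asub_neg[OF Ca]
        by (intro CollectI exI[of _ "\<lambda>i. - e i"]) blast
      assume "q \<in> N"
      then obtain f where f: "\<forall>i<k. f i \<in> C" "q - (\<Sum>i<k. v i * f i) \<in> M" by (auto simp: N_def)
      have "(p + q) - (\<Sum>i<k. v i * (e i + f i)) = (p - (\<Sum>i<k. v i * e i)) + (q - (\<Sum>i<k. v i * f i))"
        by (simp add: sum.distrib algebra_simps)
      hence "(p + q) - (\<Sum>i<k. v i * (e i + f i)) \<in> M" using M_add[OF e(2) f(2)] by (simp only:)
      thus "p + q \<in> N" unfolding N_def using e(1) f(1) asub_add[OF Ca]
        by (intro CollectI exI[of _ "\<lambda>i. e i + f i"]) blast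
    qed
    have MN: "M \<subseteq> N" unfolding N_def using asub_zero[OF Ca] by (auto intro!: exI[of _ "\<lambda>i. 0"])
    have vN: "v j * c \<in> N" if "j < k" "c \<in> C" for j c
    proof -
      have "(\<Sum>i<k. v i * (if i = j then c else 0)) = v j * c"
        using that by (simp add: if_distrib[of "\<lambda>x. v _ * x"] cong: if_cong)
      thus ?thesis unfolding N_def using that asub_zero[OF Ca] M_zero
        by (intro CollectI exI[of _ "\<lambda>i. if i = j then c else 0"]) auto
    qed
    have Ns: "u \<in> N" if "u - u' \<in> M" "u' \<in> N" for u u'
      using asub_iff[OF Na, of u u'] that MN by blast
    define S where "S = {b. \<forall>u\<in>N. b * u \<in> N}"
    have "S = UNIV"
    proof (rule gen)
      show "subring_set S" unfolding subring_set_def additive_subgroup_set_def S_def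
        using asub_zero[OF Na] asub_add[OF Na] asub_neg[OF Na]
          by (auto simp: distrib_right mult.assoc)
      show "{b. \<forall>v. b * v \<in> M} \<subseteq> S" using MN by (auto simp: S_def)
      show "B \<subseteq> S"
      proof
        fix g assume g: "g \<in> B"
        have "g * u \<in> N" if u: "u \<in> N" for u
        proof -
          obtain e where e: "\<forall>i<k. e i \<in> C" "u - (\<Sum>i<k. v i * e i) \<in> M" using u
            by (auto simp: N_def)
          have gv: "g * (v i * e i) \<in> N" if i: "i < k" for i
          proof -
            have eE: "e i \<in> E" using e i C by blast
            have 1: "(g * v i - (\<Sum>j<k. v j * co (g * v i) j)) * e i \<in> M"
              by (rule ME[OF co(2) eE])
            have "(\<Sum>j<k. v j * (co (g * v i) j * e i)) \<in> N"
            proof (rule asub_sum[OF Na], rule vN)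
              fix j assume "j \<in> {..<k}"
              thus "j < k" by simp
              hence "co (g * v i) j \<in> Y" unfolding Y_def using g i by force
              thus "co (g * v i) j * e i \<in> C" using Cm C(4) e i by blast
            qed
            moreover have "g * (v i * e i) - (\<Sum>j<k. v j * (co (g * v i) j * e i)) =
              (g * v i - (\<Sum>j<k. v j * co (g * v i) j)) * e i"
              by (simp add: algebra_simps sum_distrib_right sum_distrib_left)
            ultimately show ?thesis using Ns 1 by metis
          qed
          have "(\<Sum>i<k. g * (v i * e i)) \<in> N" by (rule asub_sum[OF Na gv]) simp
          moreover have "g * u - (\<Sum>i<k. g * (v i * e i)) = g * (u - (\<Sum>i<k. v i * e i))"
            by (simp add: algebra_simps sum_distrib_left)
          moreover have "g * (u - (\<Sum>i<k. v i * e i)) \<in> M" by (rule Ml[OF e(2)])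
          ultimately show ?thesis using Ns by metis
        qed
        thus "g \<in> S" by (simp add: S_def)
      qed
    qed
    hence "left_ideal N" unfolding left_ideal_def using Na by (auto simp: S_def)
    moreover have "v 0 \<notin> M" using v[of 0] k0 by (auto simp: span_def)
    moreover have "v 0 \<in> N" using vN[OF k0 C1] by simp
    ultimately have NU: "N = UNIV" using left_inverse MN by blast
    have "E \<subseteq> C"
    proof
      fix e assume e: "e \<in> E"
      have "v 0 * e \<in> N" using NU by simp
      then obtain c where c: "\<forall>i<k. c i \<in> C" "v 0 * e - (\<Sum>i<k. v i * c i) \<in> M" by (auto simp: N_def)
      define f where "f i = (if i = 0 then e else 0) - c i" for i
      have "(\<Sum>i<k. v i * (if i = 0 then e else 0)) = v 0 * e"
        using k0 by (simp add: if_distrib[of "\<lambda>x. v _ * x"] cong: if_cong)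
      hence "(\<Sum>i<k. v i * f i) \<in> M" using c(2) by (simp add: f_def right_diff_distrib sum_subtractf)
      moreover have "f i \<in> E" if "i < k" for i
      proof -
        have "c i \<in> E" using that c(1) C(3) by blast
        thus ?thesis unfolding f_def using e E_zero by (intro asub_diff[OF E_asub]) auto
      qed
      ultimately have "f 0 \<in> M" using indep_unique[of k v f 0] v k0 by blast
      hence "e - c 0 \<in> C" using C(2) by (auto simp: f_def)
      thus "e \<in> C" using asub_iff[OF Ca] c(1) k0 by blast
    qed
    thus "C = E" using C(3) by blast
  qed (use Ml ME E_comm one_M in auto)
  then obtain T where T: "finite T" "T \<subseteq> E" "\<And>e. e \<in> E \<Longrightarrow> \<exists>t\<in>T. e - t \<in> M" by blast
  define U where "U = (\<lambda>f. \<Sum>i<k. v i * f i) ` ({..<k} \<rightarrow>\<^sub>E T)"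
  have "finite U" unfolding U_def using T(1) by (intro finite_imageI finite_PiE) auto
  moreover have "\<exists>t\<in>U. u - t \<in> M" for u
  proof -
    have "\<forall>i\<in>{..<k}. \<exists>t. t \<in> T \<and> co u i - t \<in> M" using T(3) co(1) by blast
    then obtain t where t: "\<And>i. i < k \<Longrightarrow> t i \<in> T \<and> co u i - t i \<in> M" by (metis lessThan_iff)
    define f where "f = restrict t {..<k}"
    have "f \<in> {..<k} \<rightarrow>\<^sub>E T" using t by (auto simp: f_def)
    moreover have "(\<Sum>i<k. v i * co u i) - (\<Sum>i<k. v i * f i) = (\<Sum>i<k. v i * (co u i - f i))"
      by (simp add: right_diff_distrib sum_subtractf)
    moreover have "(\<Sum>i<k. v i * (co u i - f i)) \<in> M"
      by (rule M_sum, rule Ml) (use t in \<open>auto simp: f_def\<close>)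
    ultimately have fE: "f \<in> {..<k} \<rightarrow>\<^sub>E T" and d: "(\<Sum>i<k. v i * co u i) - (\<Sum>i<k. v i * f i) \<in> M"
      by simp_all
    have "u - (\<Sum>i<k. v i * f i) \<in> M" by (rule M_trans[OF co(2) d])
    thus ?thesis using fE unfolding U_def by blast
  qed
  ultimately show ?thesis by blast
qed

end

section \<open>Nilpotent groups acting on a simple module\<close>

definition gprod :: "('g, 'x) monoid_scheme \<Rightarrow> ('i \<Rightarrow> 'g) \<Rightarrow> 'i list \<Rightarrow> 'g" where
  "gprod G b w = foldr (\<lambda>i r. b i \<otimes>\<^bsub>G\<^esub> r) w \<one>\<^bsub>G\<^esub>"

lemma gprod_simps [simp]:
  "gprod G b [] = \<one>\<^bsub>G\<^esub>" "gprod G b (i # w) = b i \<otimes>\<^bsub>G\<^esub> gprod G b w"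
  by (simp_all add: gprod_def)

lemma gprod_cong: "(\<And>i. i \<in> set w \<Longrightarrow> b i = c i) \<Longrightarrow> gprod G b w = gprod G c w"
  by (induct w) auto

context group
begin

lemma gprod_closed [simp]: "(\<And>i. i \<in> set w \<Longrightarrow> b i \<in> carrier G) \<Longrightarrow> gprod G b w \<in> carrier G"
  by (induct w) auto

text \<open>Moving \<open>x\<close> from place \<open>i\<close> to the front means passing the
  factors to its left. It commutes with all of them except \<open>b y\<close>, which contributes the
  central \<mu>; \<open>dropWhile\<close> keeps the list from \<open>y\<close> on, so the condition
  says that \<open>y\<close> precedes \<open>i\<close>.\<close>

lemma gprod_shift:
  assumes b: "\<And>j. b j \<in> carrier G" and x: "x \<in> carrier G" "\<mu> \<in> carrier G"
    and \<mu>: "\<And>g. g \<in> carrier G \<Longrightarrow> \<mu> \<otimes> g = g \<otimes> \<mu>"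
    and xb: "\<And>j. j \<noteq> y \<Longrightarrow> b j \<otimes> x = x \<otimes> b j"
    and xy: "b y \<otimes> x = \<mu> \<otimes> (x \<otimes> b y)" and iy: "i \<noteq> y"
    and w: "distinct w" "i \<in> set w"
  shows "gprod G (b(i := x \<otimes> b i)) w =
    (if i \<in> set (dropWhile (\<lambda>j. j \<noteq> y) w) then \<mu> \<otimes> (x \<otimes> gprod G b w) else x \<otimes> gprod G b w)"
proof -
  define b' where "b' = b(i := x \<otimes> b i)"
  have b'i: "b' i = x \<otimes> b i" and b'j: "\<And>j. j \<noteq> i \<Longrightarrow> b' j = b j" by (simp_all add: b'_def)
  have "distinct w \<Longrightarrow> i \<in> set w \<Longrightarrow> gprod G b' w =
    (if i \<in> set (dropWhile (\<lambda>j. j \<noteq> y) w) then \<mu> \<otimes> (x \<otimes> gprod G b w) else x \<otimes> gprod G b w)"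
  proof (induct w)
    case (Cons j w)
    have c: "gprod G b w \<in> carrier G" using b by simp
    show ?case
    proof (cases "j = i")
      case True
      hence "i \<notin> set w" using Cons by simp
      hence "gprod G b' w = gprod G b w" by (intro gprod_cong b'j) auto
      moreover have "i \<notin> set (dropWhile (\<lambda>j. j \<noteq> y) w)" using \<open>i \<notin> set w\<close> set_dropWhileD by metis
      ultimately show ?thesis using True iy b x c by (simp add: m_assoc b'i)
    next
      case False
      hence i: "i \<in> set w" "distinct w" using Cons by auto
      show ?thesis
      proof (cases "j = y")
        case True
        have "dropWhile (\<lambda>j. j \<noteq> y) w = []" using Cons(2) True by auto
        hence "i \<notin> set (dropWhile (\<lambda>j. j \<noteq> y) w)" by (metis empty_iff list.set(1))
        hence "gprod G b' w = x \<otimes> gprod G b w" using Cons(1) i by simp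
        moreover have "b y \<otimes> (x \<otimes> gprod G b w) = \<mu> \<otimes> (x \<otimes> (b y \<otimes> gprod G b w))"
        proof -
          have "b y \<otimes> (x \<otimes> gprod G b w) = (b y \<otimes> x) \<otimes> gprod G b w" using b x c
            by (simp add: m_assoc)
          also have "\<dots> = \<mu> \<otimes> (x \<otimes> (b y \<otimes> gprod G b w))" unfolding xy using b x c
            by (simp add: m_assoc)
          finally show ?thesis .
        qed
        ultimately show ?thesis using True False i iy by (simp add: b'j)
      next
        case jy: False
        have bx: "b j \<otimes> (x \<otimes> g) = x \<otimes> (b j \<otimes> g)" if "g \<in> carrier G" for g
          using xb[OF jy] b x that by (metis m_assoc)
        have bm: "b j \<otimes> (\<mu> \<otimes> g) = \<mu> \<otimes> (b j \<otimes> g)" if "g \<in> carrier G" for g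
          using \<mu>[OF b] b x that by (metis m_assoc)
        show ?thesis using False jy Cons(1) i b x c bx bm by (simp add: b'j)
      qed
    qed
  qed simp
  thus ?thesis using w unfolding b'_def by blast
qed

text \<open>\<open>x\<close> lies in the second centre, so conjugation by \<open>x\<close>
  multiplies each \<open>g\<close> by a central element \<open>z g\<close>. Central factors cancel
  in a commutator, which is therefore fixed.\<close>

lemma comm_central_commute:
  assumes x: "x \<in> carrier G" and a: "a \<in> carrier G" and b: "b \<in> carrier G"
    and cen: "\<And>g h. g \<in> carrier G \<Longrightarrow> h \<in> carrier G \<Longrightarrow> comm G x g \<otimes> h = h \<otimes> comm G x g"
  shows "comm G a b \<otimes> x = x \<otimes> comm G a b"
proof -
  define f where "f g = inv x \<otimes> g \<otimes> x" for g
  have fc [simp]: "f g \<in> carrier G" if "g \<in> carrier G" for g using that x by (simp add: f_def)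
  have fm: "f (g \<otimes> h) = f g \<otimes> f h" if "g \<in> carrier G" "h \<in> carrier G" for g h
    using that x by (simp add: f_def free_simps)
  have fi: "f (inv g) = inv (f g)" if "g \<in> carrier G" for g
    using that x by (simp add: f_def free_simps)
  define z where "z g = inv (comm G x g)" for g
  have zc: "z g \<in> carrier G" if "g \<in> carrier G" for g using that x by (simp add: z_def)
  have zcen: "z g \<otimes> h = h \<otimes> z g" if "g \<in> carrier G" "h \<in> carrier G" for g h
    unfolding z_def by (rule inv_comm_cancel) (use that x cen in auto)
  have fz: "f g = g \<otimes> z g" if g: "g \<in> carrier G" for g
  proof -
    have "f g = comm G x (inv g) \<otimes> g" using g x by (simp add: f_def comm_def free_simps)
    also have "\<dots> = g \<otimes> comm G x (inv g)" using cen[of "inv g" g] g by simp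
    finally have 1: "f g = g \<otimes> comm G x (inv g)" .
    have "comm G x g \<otimes> comm G x (inv g) = comm G x (inv g) \<otimes> comm G x g"
      using g x by (intro cen) auto
    also have "\<dots> = inv x \<otimes> g \<otimes> x \<otimes> inv g \<otimes> comm G x g" using g x by (simp add: comm_def)
    also have "\<dots> = (inv x \<otimes> g \<otimes> x) \<otimes> (comm G x g \<otimes> inv g)"
      using g x cen[of g "inv g"] by (simp add: m_assoc)
    also have "\<dots> = \<one>" using g x by (simp add: comm_def free_simps)
    finally have "comm G x (inv g) = z g" unfolding z_def
      using g x by (metis comm_closed inv_closed inv_equality cen)
    thus ?thesis using 1 by simp
  qed
  have "f (comm G a b) = inv (f a) \<otimes> inv (f b) \<otimes> f a \<otimes> f b"
    unfolding comm_def using a b by (simp add: fm fi)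
  also have "\<dots> = inv a \<otimes> inv (z a) \<otimes> (inv b \<otimes> inv (z b)) \<otimes> (a \<otimes> z a) \<otimes> (b \<otimes> z b)"
    using a b zc by (simp add: fz inv_mult_group zcen inv_comm_cancel[OF zc])
  also have "\<dots> = comm G a b"
  proof -
    note ic = inv_comm_cancel[OF zc _ zcen]
    have "inv a \<otimes> inv (z a) \<otimes> (inv b \<otimes> inv (z b)) \<otimes> (a \<otimes> z a) \<otimes> (b \<otimes> z b)
       = inv a \<otimes> inv b \<otimes> (inv (z a) \<otimes> (inv (z b) \<otimes> a)) \<otimes> z a \<otimes> b \<otimes> z b"
      using a b zc ic[of a "inv b"] by (simp add: m_assoc) (metis m_assoc inv_closed m_closed)
    also have "\<dots> = inv a \<otimes> inv b \<otimes> (inv (z a) \<otimes> (a \<otimes> inv (z b))) \<otimes> z a \<otimes> b \<otimes> z b"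
      using a b zc ic[of b a] by simp
    also have "\<dots> = inv a \<otimes> inv b \<otimes> ((a \<otimes> inv (z a)) \<otimes> inv (z b)) \<otimes> z a \<otimes> b \<otimes> z b"
      using a b zc ic[of a a] by (simp add: m_assoc[symmetric])
    also have "\<dots> = inv a \<otimes> inv b \<otimes> a \<otimes> (inv (z a) \<otimes> (inv (z b) \<otimes> z a)) \<otimes> (b \<otimes> z b)"
      using a b zc by (simp add: m_assoc)
    also have "\<dots> = inv a \<otimes> inv b \<otimes> a \<otimes> inv (z b) \<otimes> (b \<otimes> z b)"
      using a b zc ic[of b "z a"] by (simp add: inv_cancel1)
    also have "\<dots> = inv a \<otimes> inv b \<otimes> a \<otimes> (inv (z b) \<otimes> (z b \<otimes> b))"
      using a b zc zcen[of b b] by (simp add: m_assoc)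
    also have "\<dots> = comm G a b" using a b zc by (simp add: inv_cancel1 comm_def)
    finally show ?thesis .
  qed
  finally have f: "f (comm G a b) = comm G a b" .
  have "x \<otimes> f (comm G a b) = comm G a b \<otimes> x" using x a b by (simp add: f_def free_simps)
  thus ?thesis using f by simp
qed

lemma normal_comm_comm:
  assumes N: "N \<lhd> G" and x: "x \<in> carrier G" "a \<in> carrier G" "b \<in> carrier G"
    and cen: "\<And>g. g \<in> carrier G \<Longrightarrow> comm G x g \<in> centralizer_mod N (carrier G)"
  shows "comm G (comm G a b) x \<in> N"
proof -
  interpret N: normal N G by fact
  interpret Q: group "G Mod N" by (rule N.factorgroup_is_group)
  interpret h: group_hom G "G Mod N" "\<lambda>a. N #> a"
    using N.r_coset_hom_Mod by unfold_locales
  have hc: "N #> comm G x y = comm (G Mod N) (N #> x) (N #> y)"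
    if "x \<in> carrier G" "y \<in> carrier G" for x y
    using that by (simp only: comm_def h.hom_mult h.hom_inv inv_closed m_closed)
  have surj: "\<exists>g\<in>carrier G. p = N #> g" if "p \<in> carrier (G Mod N)" for p
    using that by (auto simp: FactGroup_def RCOSETS_def)
  have "comm (G Mod N) (N #> x) p \<otimes>\<^bsub>G Mod N\<^esub> q = q \<otimes>\<^bsub>G Mod N\<^esub> comm (G Mod N) (N #> x) p"
    if pq: "p \<in> carrier (G Mod N)" "q \<in> carrier (G Mod N)" for p q
  proof -
    obtain g k where g: "g \<in> carrier G" "p = N #> g" "k \<in> carrier G" "q = N #> k"
      using surj pq by blast
    have "comm G (comm G x g) k \<in> N" using cen[OF g(1)] g(3) by (simp add: centralizer_mod_def)
    thus ?thesis using comm_in_normal_iff[OF N _ g(3), of "comm G x g"] g x by (simp add: hc)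
  qed
  from Q.comm_central_commute[OF h.hom_closed[OF x(1)] h.hom_closed[OF x(2)] h.hom_closed[OF x(3)]
    this]
  show ?thesis using comm_in_normal_iff[OF N, of "comm G a b" x] x by (simp add: hc)
qed

lemma gprod_shift_mod:
  assumes N: "N \<lhd> G" and b: "\<And>j. b j \<in> carrier G" and x: "x \<in> carrier G"
    and xb: "\<And>j. j \<noteq> y \<Longrightarrow> comm G (b j) x \<in> N"
    and mu: "comm G (b y) x \<in> centralizer_mod N (carrier G)" and iy: "i \<noteq> y"
    and w: "distinct w" "i \<in> set w"
  shows "N #> gprod G (b(i := x \<otimes> b i)) w =
    N #> (if i \<in> set (dropWhile (\<lambda>j. j \<noteq> y) w) then comm G (b y) x \<otimes> (x \<otimes> gprod G b w)
       else x \<otimes> gprod G b w)"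
proof -
  interpret N: normal N G by fact
  interpret Q: group "G Mod N" by (rule N.factorgroup_is_group)
  interpret h: group_hom G "G Mod N" "\<lambda>a. N #> a"
    using N.r_coset_hom_Mod by unfold_locales
  define \<mu> where "\<mu> = comm G (b y) x"
  have \<mu>c: "\<mu> \<in> carrier G" using b x by (simp add: \<mu>_def)
  have hg: "N #> gprod G c w = gprod (G Mod N) (\<lambda>i. N #> c i) w" if "\<And>j. c j \<in> carrier G" for c w
    by (induct w) (use that h.hom_one h.hom_mult gprod_closed in \<open>simp_all del: h.hom_mult add:
      h.hom_mult\<close>)
  have e1: "gprod (G Mod N) ((\<lambda>i. N #> b i)(i := (N #> x) \<otimes>\<^bsub>G Mod N\<^esub> (N #> b i))) w =
    (if i \<in> set (dropWhile (\<lambda>j. j \<noteq> y) w)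
     then (N #> \<mu>) \<otimes>\<^bsub>G Mod N\<^esub> ((N #> x) \<otimes>\<^bsub>G Mod N\<^esub> gprod (G Mod N) (\<lambda>i. N #> b i) w)
     else (N #> x) \<otimes>\<^bsub>G Mod N\<^esub> gprod (G Mod N) (\<lambda>i. N #> b i) w)"
  proof (rule Q.gprod_shift)
    show "N #> b j \<in> carrier (G Mod N)" for j using h.hom_closed[OF b] .
    show "N #> x \<in> carrier (G Mod N)" "N #> \<mu> \<in> carrier (G Mod N)"
      using h.hom_closed[OF x] h.hom_closed[OF \<mu>c] .
    show "i \<noteq> y" "distinct w" "i \<in> set w" by fact+
    show "(N #> \<mu>) \<otimes>\<^bsub>G Mod N\<^esub> p = p \<otimes>\<^bsub>G Mod N\<^esub> (N #> \<mu>)" if p: "p \<in> carrier (G Mod N)" for p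
    proof -
      obtain g where g: "g \<in> carrier G" "p = N #> g" using p
        by (auto simp: FactGroup_def RCOSETS_def)
      have "comm G \<mu> g \<in> N" using mu g(1) by (simp add: centralizer_mod_def \<mu>_def)
      thus ?thesis using comm_in_normal_iff[OF N \<mu>c g(1)] g by simp
    qed
    show "(N #> b j) \<otimes>\<^bsub>G Mod N\<^esub> (N #> x) = (N #> x) \<otimes>\<^bsub>G Mod N\<^esub> (N #> b j)" if "j \<noteq> y" for j
      using xb[OF that] comm_in_normal_iff[OF N b x] by blast
    have "b y \<otimes> x = x \<otimes> b y \<otimes> \<mu>" using b[of y] x by (simp add: \<mu>_def comm_def free_simps)
    hence "(N #> b y) \<otimes>\<^bsub>G Mod N\<^esub> (N #> x) = (N #> (x \<otimes> b y)) \<otimes>\<^bsub>G Mod N\<^esub> (N #> \<mu>)"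
      using h.hom_mult[OF b[of y] x] h.hom_mult[of "x \<otimes> b y" \<mu>] b[of y] x \<mu>c by simp
    also have "\<dots> = (N #> \<mu>) \<otimes>\<^bsub>G Mod N\<^esub> (N #> (x \<otimes> b y))"
    proof -
      have "comm G \<mu> (x \<otimes> b y) \<in> N" using mu b x by (simp add: centralizer_mod_def \<mu>_def)
      thus ?thesis using comm_in_normal_iff[OF N \<mu>c, of "x \<otimes> b y"] b[of y] x by simp
    qed
    finally show "(N #> b y) \<otimes>\<^bsub>G Mod N\<^esub> (N #> x) = (N #> \<mu>) \<otimes>\<^bsub>G Mod N\<^esub> ((N #> x) \<otimes>\<^bsub>G Mod N\<^esub> (N #> b y))"
      using h.hom_mult[OF x b[of y]] by simp
  qed
  have e2: "(\<lambda>i. N #> b i)(i := (N #> x) \<otimes>\<^bsub>G Mod N\<^esub> (N #> b i)) = (\<lambda>j. N #> (b(i := x \<otimes> b i)) j)"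
    using h.hom_mult[OF x b[of i]] by (auto simp: fun_eq_iff)
  have pc: "gprod G b w \<in> carrier G" using b by simp
  have e3: "N #> gprod G (b(i := x \<otimes> b i)) w = gprod (G Mod N) (\<lambda>j. N #> (b(i := x \<otimes> b i)) j) w"
    by (rule hg) (use b x in simp)
  have e4: "gprod (G Mod N) (\<lambda>j. N #> b j) w = N #> gprod G b w" by (rule hg[OF b, symmetric])
  have e5: "(N #> x) \<otimes>\<^bsub>G Mod N\<^esub> (N #> gprod G b w) = N #> (x \<otimes> gprod G b w)"
    by (rule h.hom_mult[OF x pc, symmetric])
  have e6: "(N #> \<mu>) \<otimes>\<^bsub>G Mod N\<^esub> (N #> (x \<otimes> gprod G b w)) = N #> (\<mu> \<otimes> (x \<otimes> gprod G b w))"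
    by (rule h.hom_mult[OF \<mu>c m_closed[OF x pc], symmetric])
  show ?thesis
    unfolding \<mu>_def[symmetric] e3 e2[symmetric] e1 e4 e5 e6
      by (simp only: if_distrib[of "\<lambda>g. N #> g"])
qed

lemma funpow_derived_mono_in:
  assumes "subgroup K G" "L \<subseteq> K" shows "(derived G ^^ k) L \<subseteq> K"
  by (induct k) (use assms derived_incl in auto)

end

section \<open>Sections of the module and the descent of the identity\<close>

text \<open>\<open>M\<close> is only a left ideal, so \<rho> is required to be multiplicative as an
  action: the conditions hold modulo \<open>M\<close> after application to an arbitrary vector
  \<open>v\<close>.\<close>

locale rep_module = simple_module M R0 \<gamma> I w0 + group G
  for M :: "'b::ring_1 set" and R0 and \<gamma> :: "'i list \<Rightarrow> 'b" and I w0
    and G :: "('g, 'x) monoid_scheme" (structure) +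
  fixes \<rho> :: "'g \<Rightarrow> 'b"
  assumes \<rho>_R0: "\<And>g. \<rho> g \<in> R0"
    and \<rho>_mult: "\<And>g h v. g \<in> carrier G \<Longrightarrow> h \<in> carrier G \<Longrightarrow> \<rho> (g \<otimes> h) * v - \<rho> g * (\<rho> h * v) \<in> M"
    and \<rho>_one: "\<And>v. \<rho> \<one> * v - v \<in> M"
begin

definition stable :: "'g set \<Rightarrow> 'b set \<Rightarrow> bool" where
  "stable H W \<longleftrightarrow> (\<forall>h\<in>H. \<forall>v\<in>W. \<rho> h * v \<in> W)"

definition ker_on :: "'g set \<Rightarrow> 'b set \<Rightarrow> 'b set \<Rightarrow> 'g set" where
  "ker_on H W1 W2 = {h \<in> H. \<forall>v\<in>W2. \<rho> h * v - v \<in> W1}"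

text \<open>Only group elements are substituted for the variables, and the result is read on
  \<open>W2\<close> modulo \<open>W1\<close>. In this form the identity passes to subgroups and to
  sections.\<close>

definition identity_on :: "'g set \<Rightarrow> 'b set \<Rightarrow> 'b set \<Rightarrow> 'i set \<Rightarrow> ('i list \<Rightarrow> 'b) \<Rightarrow> bool" where
  "identity_on H W1 W2 J e \<longleftrightarrow> (\<forall>b. (\<forall>j. b j \<in> H) \<longrightarrow> (\<forall>v\<in>W2.
     (\<Sum>w\<in>permutations_of_set J. \<rho> (gprod G b w) * v * e w) \<in> W1))"

lemma E_subspaceD:
  assumes "E_subspace W"
  shows "additive_subgroup_set W" "M \<subseteq> W" "\<And>w e. w \<in> W \<Longrightarrow> e \<in> E \<Longrightarrow> w * e \<in> W"
  using assms by (auto simp: E_subspace_def)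

lemma inv_act:
  assumes g: "g \<in> carrier G" shows "\<rho> (inv g) * (\<rho> g * v) - v \<in> M"
proof -
  have "\<rho> (inv g) * (\<rho> g * v) - \<rho> \<one> * v \<in> M"
    using M_sym[OF \<rho>_mult[of "inv g" g v]] g by simp
  thus ?thesis by (rule M_trans[OF _ \<rho>_one])
qed

lemma ker_on_normal:
  assumes H: "subgroup H G" and W: "E_subspace W1" "E_subspace W2" "W1 \<subseteq> W2"
    and st: "stable H W1" "stable H W2"
  shows "ker_on H W1 W2 \<lhd> G\<lparr>carrier := H\<rparr>"
proof -
  interpret H: subgroup H G by fact
  interpret GH: group "G\<lparr>carrier := H\<rparr>" by (rule subgroup_imp_group[OF H])
  let ?K = "ker_on H W1 W2"
  note a1 = E_subspaceD(1)[OF W(1)] and m1 = E_subspaceD(2)[OF W(1)]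
  have Kmult: "g \<otimes> h \<in> ?K" if "g \<in> ?K" "h \<in> ?K" for g h
  proof -
    have gh: "g \<in> H" "h \<in> H" using that by (auto simp: ker_on_def)
    have "\<rho> (g \<otimes> h) * v - v \<in> W1" if v: "v \<in> W2" for v
    proof -
      have hv: "\<rho> h * v \<in> W2" using st gh v by (auto simp: stable_def)
      have 1: "\<rho> (g \<otimes> h) * v - \<rho> g * (\<rho> h * v) \<in> W1" using \<rho>_mult[of g h v] gh m1 by auto
      have 2: "\<rho> g * (\<rho> h * v) - \<rho> h * v \<in> W1" "\<rho> h * v - v \<in> W1"
        using \<open>g \<in> ?K\<close> \<open>h \<in> ?K\<close> hv v by (auto simp: ker_on_def)
      show ?thesis by (rule asub_trans[OF a1 1 asub_trans[OF a1 2]])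
    qed
    thus ?thesis using gh by (simp add: ker_on_def)
  qed
  have Kinv: "inv g \<in> ?K" if "g \<in> ?K" for g
  proof -
    have g: "g \<in> H" using that by (auto simp: ker_on_def)
    have "\<rho> (inv g) * v - v \<in> W1" if v: "v \<in> W2" for v
    proof -
      have "\<rho> g * v - v \<in> W1" using \<open>g \<in> ?K\<close> v by (auto simp: ker_on_def)
      hence "\<rho> (inv g) * (\<rho> g * v - v) \<in> W1" using st g by (auto simp: stable_def)
      hence 1: "\<rho> (inv g) * (\<rho> g * v) - \<rho> (inv g) * v \<in> W1" by (simp add: right_diff_distrib)
      have "\<rho> (inv g) * (\<rho> g * v) - v \<in> W1" using inv_act[of g v] g m1 by auto
      from asub_trans[OF a1 asub_sym[OF a1 1] this] show ?thesis .
    qed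
    thus ?thesis using g by (simp add: ker_on_def)
  qed
  have Kone: "\<one> \<in> ?K" using \<rho>_one m1 by (auto simp: ker_on_def)
  have sub: "subgroup ?K (G\<lparr>carrier := H\<rparr>)"
  proof (rule GH.subgroupI)
    show "?K \<subseteq> carrier (G\<lparr>carrier := H\<rparr>)" by (auto simp: ker_on_def)
    show "?K \<noteq> {}" using Kone by blast
    show "inv\<^bsub>G\<lparr>carrier := H\<rparr>\<^esub> a \<in> ?K" if "a \<in> ?K" for a
      using Kinv[OF that] m_inv_consistent[OF H] that by (auto simp: ker_on_def)
  qed (use Kmult in simp)
  show ?thesis
  proof (rule GH.normal_invI[OF sub])
    fix g k assume g: "g \<in> carrier (G\<lparr>carrier := H\<rparr>)" and k: "k \<in> ?K"
    have gH: "g \<in> H" "k \<in> H" using g k by (auto simp: ker_on_def)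
    have "\<rho> (g \<otimes> k \<otimes> inv g) * v - v \<in> W1" if v: "v \<in> W2" for v
    proof -
      define u where "u = \<rho> (inv g) * v"
      have u: "u \<in> W2" using st gH v by (auto simp: stable_def u_def)
      have 1: "\<rho> (g \<otimes> k \<otimes> inv g) * v - \<rho> (g \<otimes> k) * u \<in> W1"
        unfolding u_def using \<rho>_mult[of "g \<otimes> k" "inv g" v] gH m1 by auto
      have 2: "\<rho> (g \<otimes> k) * u - \<rho> g * (\<rho> k * u) \<in> W1" using \<rho>_mult[of g k u] gH m1 by auto
      have "\<rho> k * u - u \<in> W1" using k u by (auto simp: ker_on_def)
      hence "\<rho> g * (\<rho> k * u - u) \<in> W1" using st gH by (auto simp: stable_def)
      hence 3: "\<rho> g * (\<rho> k * u) - \<rho> g * u \<in> W1" by (simp add: right_diff_distrib)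
      have 4: "\<rho> g * u - v \<in> W1" unfolding u_def using inv_act[of "inv g" v] gH m1 by auto
      show ?thesis by (rule asub_trans[OF a1 1 asub_trans[OF a1 2 asub_trans[OF a1 3 4]]])
    qed
    thus "g \<otimes>\<^bsub>G\<lparr>carrier := H\<rparr>\<^esub> k \<otimes>\<^bsub>G\<lparr>carrier := H\<rparr>\<^esub> inv\<^bsub>G\<lparr>carrier := H\<rparr>\<^esub> g \<in> ?K"
      using gH m_inv_consistent[OF H] by (auto simp: ker_on_def)
  qed
qed

lemma act_coset_cong:
  assumes H: "subgroup H G" and W: "E_subspace W1" "E_subspace W2" "W1 \<subseteq> W2"
    and st: "stable H W1" "stable H W2"
    and g: "g \<in> H" "g' \<in> H" "ker_on H W1 W2 #>\<^bsub>G\<lparr>carrier := H\<rparr>\<^esub> g = ker_on H W1 W2 #>\<^bsub>G\<lparr>carrier :=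
      H\<rparr>\<^esub> g'"
    and v: "v \<in> W2"
  shows "\<rho> g * v - \<rho> g' * v \<in> W1"
proof -
  interpret H: subgroup H G by fact
  interpret GH: group "G\<lparr>carrier := H\<rparr>" by (rule subgroup_imp_group[OF H])
  let ?K = "ker_on H W1 W2"
  interpret K: normal ?K "G\<lparr>carrier := H\<rparr>" by (rule ker_on_normal[OF H W st])
  note a1 = E_subspaceD(1)[OF W(1)] and m1 = E_subspaceD(2)[OF W(1)]
  have "g \<in> ?K #>\<^bsub>G\<lparr>carrier := H\<rparr>\<^esub> g'" using GH.rcos_self[OF _ K.subgroup_axioms, of g] g by simp
  then obtain k where k: "k \<in> ?K" "g = k \<otimes> g'" by (auto simp: r_coset_def)
  have kH: "k \<in> H" using k by (auto simp: ker_on_def)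
  have gv: "\<rho> g' * v \<in> W2" using st g v by (auto simp: stable_def)
  have 1: "\<rho> g * v - \<rho> k * (\<rho> g' * v) \<in> W1" unfolding k(2) using \<rho>_mult[of k g' v] kH g m1 by auto
  have 2: "\<rho> k * (\<rho> g' * v) - \<rho> g' * v \<in> W1" using k(1) gv by (auto simp: ker_on_def)
  show ?thesis by (rule asub_trans[OF a1 1 2])
qed

text \<open>Replacing \<open>b\<^sub>i\<close> by \<open>x b\<^sub>i\<close> multiplies a monomial by \<open>x\<close>, and by the central commutator \<open>\<mu> =
  [y, x]\<close> in addition exactly when \<open>i\<close> comes after the variable \<open>y0\<close> carrying \<open>y\<close>. Since \<open>\<mu> - 1\<close>
  is injective on \<open>W2\<close> modulo \<open>W1\<close>, doing so for each \<open>i\<close> in turn leaves only the monomials that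
  begin with \<open>y0\<close>.\<close>

lemma identity_on_descend:
  assumes H: "subgroup H G" and W: "E_subspace W1" "E_subspace W2" "W1 \<subseteq> W2"
    and st: "stable H W1" "stable H W2"
    and irr: "\<And>W. E_subspace W \<Longrightarrow> W1 \<subseteq> W \<Longrightarrow> W \<subseteq> W2 \<Longrightarrow> stable H W \<Longrightarrow> W = W1 \<or> W = W2"
    and x: "x \<in> H" and y: "y \<in> H" and xy: "comm G x y \<notin> ker_on H W1 W2"
    and cen: "\<And>g h. g \<in> H \<Longrightarrow> h \<in> H \<Longrightarrow> comm G (comm G x g) h \<in> ker_on H W1 W2"
    and J: "finite J" "y0 \<in> J" and id: "identity_on H W1 W2 J e" and eE: "\<And>w. e w \<in> E"
  shows "identity_on {h \<in> H. comm G h x \<in> ker_on H W1 W2} W1 W2 (J - {y0}) (\<lambda>w. e (y0 # w))"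
proof -
  interpret H: subgroup H G by fact
  let ?GH = "G\<lparr>carrier := H\<rparr>"
  interpret GH: group ?GH by (rule subgroup_imp_group[OF H])
  let ?K = "ker_on H W1 W2"
  have Kn: "?K \<lhd> ?GH" by (rule ker_on_normal[OF H W st])
  interpret K: normal ?K ?GH by (rule Kn)
  note a1 = E_subspaceD(1)[OF W(1)] and m1 = E_subspaceD(2)[OF W(1)]
    and e1 = E_subspaceD(3)[OF W(1)]
  note a2 = E_subspaceD(1)[OF W(2)] and e2 = E_subspaceD(3)[OF W(2)]
  have act1: "\<rho> h * v \<in> W1" if "h \<in> H" "v \<in> W1" for h v using st that by (auto simp: stable_def)
  have act2: "\<rho> h * v \<in> W2" if "h \<in> H" "v \<in> W2" for h v using st that by (auto simp: stable_def)
  have mult1: "\<rho> (g \<otimes> h) * v - \<rho> g * (\<rho> h * v) \<in> W1" if "g \<in> H" "h \<in> H" for g h v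
    using \<rho>_mult[of g h v] that m1 by auto
  have commH: "comm ?GH a b = comm G a b" if "a \<in> H" "b \<in> H" for a b
    by (rule comm_subgroup_eq[OF H that])
  have cH: "comm G a b \<in> H" if "a \<in> H" "b \<in> H" for a b by (rule subgroup_comm[OF H that])
  define \<mu> where "\<mu> = comm G y x"
  have \<mu>H: "\<mu> \<in> H" unfolding \<mu>_def by (rule cH[OF y x])
  have \<mu>K: "\<mu> \<notin> ?K"
  proof
    assume "\<mu> \<in> ?K"
    hence "comm ?GH x y \<in> ?K" using GH.comm_mem_sym[OF Kn, of y x] x y commH by (simp add: \<mu>_def)
    thus False using xy commH[OF x y] by simp
  qed
  have \<mu>c: "comm G \<mu> h \<in> ?K" if h: "h \<in> H" for h
  proof -
    have "comm ?GH x y \<in> GH.centralizer_mod ?K (carrier ?GH)"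
      using cen[OF y] cH[OF x y] commH x y by (auto simp: GH.centralizer_mod_def)
    hence "inv\<^bsub>?GH\<^esub> (comm ?GH x y) \<in> GH.centralizer_mod ?K (carrier ?GH)"
      using GH.centralizer_mod_subgroup[OF Kn order_refl] by (simp add: subgroup.m_inv_closed)
    hence "comm ?GH y x \<in> GH.centralizer_mod ?K (carrier ?GH)" using GH.comm_inv[of x y] x y by simp
    hence "comm ?GH (comm ?GH y x) h \<in> ?K" using h by (simp add: GH.centralizer_mod_def)
    thus ?thesis unfolding commH[OF y x] \<mu>_def[symmetric] commH[OF \<mu>H h] .
  qed
  have \<mu>h: "\<rho> \<mu> * (\<rho> h * u) - \<rho> h * (\<rho> \<mu> * u) \<in> W1" if h: "h \<in> H" "u \<in> W2" for h u
  proof -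
    have "?K #>\<^bsub>?GH\<^esub> (\<mu> \<otimes> h) = ?K #>\<^bsub>?GH\<^esub> (h \<otimes> \<mu>)"
    proof -
      have "comm ?GH \<mu> h \<in> ?K" using \<mu>c[OF h(1)] commH[OF \<mu>H h(1)] by simp
      hence "(?K #>\<^bsub>?GH\<^esub> \<mu>) \<otimes>\<^bsub>?GH Mod ?K\<^esub> (?K #>\<^bsub>?GH\<^esub> h) = (?K #>\<^bsub>?GH\<^esub> h) \<otimes>\<^bsub>?GH Mod ?K\<^esub> (?K #>\<^bsub>?GH\<^esub> \<mu>)"
        using GH.comm_in_normal_iff[OF Kn, of \<mu> h] \<mu>H h by simp
      thus ?thesis using K.rcos_sum[of \<mu> h] K.rcos_sum[of h \<mu>] \<mu>H h by (simp add: FactGroup_def)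
    qed
    hence 1: "\<rho> (\<mu> \<otimes> h) * u - \<rho> (h \<otimes> \<mu>) * u \<in> W1"
      using \<mu>H h by (intro act_coset_cong[OF H W st]) auto
    show ?thesis
      by (rule asub_trans[OF a1 asub_sym[OF a1 mult1[OF \<mu>H h(1)]] asub_trans[OF a1 1 mult1[OF h(1)
        \<mu>H]]])
  qed
  \<comment> \<open>The vectors fixed by \<mu> modulo \<open>W1\<close>. They are stable because
    \<mu> acts centrally, and they are not all of \<open>W2\<close>; irreducibility leaves
    \<open>W1\<close>, which is the injectivity of \<mu> - 1.\<close>
  define U where "U = {u \<in> W2. \<rho> \<mu> * u - u \<in> W1}"
  have "E_subspace U" unfolding E_subspace_def
  proof (intro conjI ballI)
    show "additive_subgroup_set U" unfolding additive_subgroup_set_def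
    proof (intro conjI ballI)
      show "0 \<in> U" using asub_zero[OF a1] asub_zero[OF a2] by (simp add: U_def)
      fix p q assume p: "p \<in> U"
      have "\<rho> \<mu> * (- p) - (- p) = - (\<rho> \<mu> * p - p)" by simp
      moreover have "- (\<rho> \<mu> * p - p) \<in> W1" using p by (intro asub_neg[OF a1]) (auto simp: U_def)
      ultimately have "\<rho> \<mu> * (- p) - (- p) \<in> W1" by (simp only:)
      moreover have "- p \<in> W2" using p by (intro asub_neg[OF a2]) (auto simp: U_def)
      ultimately show "- p \<in> U" unfolding U_def by blast
      assume q: "q \<in> U"
      have "\<rho> \<mu> * (p + q) - (p + q) = (\<rho> \<mu> * p - p) + (\<rho> \<mu> * q - q)" by (simp add: algebra_simps)
      moreover have "(\<rho> \<mu> * p - p) + (\<rho> \<mu> * q - q) \<in> W1" using p q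
        by (intro asub_add[OF a1]) (auto simp: U_def)
      ultimately have "\<rho> \<mu> * (p + q) - (p + q) \<in> W1" by (simp only:)
      moreover have "p + q \<in> W2" using p q by (intro asub_add[OF a2]) (auto simp: U_def)
      ultimately show "p + q \<in> U" unfolding U_def by blast
    qed
    show "M \<subseteq> U"
    proof
      fix m assume m: "m \<in> M"
      have "\<rho> \<mu> * m - m \<in> M" by (rule M_diff[OF Ml[OF m] m])
      thus "m \<in> U" using m m1 W(3) by (auto simp: U_def)
    qed
    fix u c assume u: "u \<in> U" and c: "c \<in> E"
    have "(\<rho> \<mu> * u - u) * c \<in> W1" using u c e1 unfolding U_def by blast
    hence "\<rho> \<mu> * (u * c) - u * c \<in> W1" by (simp only: left_diff_distrib mult.assoc)
    moreover have "u * c \<in> W2" using u c e2 unfolding U_def by blast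
    ultimately show "u * c \<in> U" unfolding U_def by blast
  qed
  moreover have "W1 \<subseteq> U"
  proof
    fix u assume u: "u \<in> W1"
    have "\<rho> \<mu> * u - u \<in> W1" by (rule asub_diff[OF a1 act1[OF \<mu>H u] u])
    thus "u \<in> U" using u W(3) by (auto simp: U_def)
  qed
  moreover have "U \<subseteq> W2" by (auto simp: U_def)
  moreover have "stable H U" unfolding stable_def
  proof (intro ballI)
    fix h u assume h: "h \<in> H" and u: "u \<in> U"
    hence u2: "u \<in> W2" "\<rho> \<mu> * u - u \<in> W1" by (auto simp: U_def)
    have "\<rho> h * (\<rho> \<mu> * u - u) \<in> W1" by (rule act1[OF h u2(2)])
    hence "\<rho> h * (\<rho> \<mu> * u) - \<rho> h * u \<in> W1" by (simp add: right_diff_distrib)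
    from asub_trans[OF a1 \<mu>h[OF h u2(1)] this]
    show "\<rho> h * u \<in> U" using act2[OF h u2(1)] by (simp add: U_def)
  qed
  moreover have "U \<noteq> W2" using \<mu>K \<mu>H by (auto simp: U_def ker_on_def)
  ultimately have "U = W1" using irr by blast
  hence inj: "u \<in> W1" if "u \<in> W2" "\<rho> \<mu> * u - u \<in> W1" for u using that by (auto simp: U_def)
  let ?H1 = "{h \<in> H. comm G h x \<in> ?K}"
  have xH1: "x \<in> ?H1" using x comm_eq_one_iff[of x x] K.one_closed by simp
  \<comment> \<open>The variables from \<open>y0\<close> on. \<open>F S b v\<close> is the part of
    the identity over orderings in which all of \<open>S\<close> comes after \<open>y0\<close>;
    enlarging \<open>S\<close> to \<open>J - {y0}\<close> forces \<open>y0\<close> to the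
    front.\<close>
  define aft where "aft w = set (dropWhile (\<lambda>j. j \<noteq> y0) w)" for w
  define F where "F S b v = (\<Sum>w\<in>{w \<in> permutations_of_set J. S \<subseteq> aft w}. \<rho> (gprod G b w) * v * e w)"
    for S b v
  have gH: "gprod G b w \<in> H" if "\<And>j. b j \<in> H" for b w
    using GH.gprod_closed[of w b] that by (simp add: gprod_def)
  have main: "\<forall>b. b y0 = y \<longrightarrow> (\<forall>j. j \<noteq> y0 \<longrightarrow> b j \<in> ?H1) \<longrightarrow> (\<forall>v\<in>W2. F S b v \<in> W1)"
    if "finite S" "S \<subseteq> J - {y0}" for S
    using that
  proof (induct S)
    case empty
    show ?case
    proof (intro allI impI ballI)
      fix b v assume b: "b y0 = y" "\<forall>j. j \<noteq> y0 \<longrightarrow> b j \<in> ?H1" and v: "v \<in> W2"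
      have "b j \<in> H" for j using b y by (cases "j = y0") auto
      thus "F {} b v \<in> W1" using id v unfolding identity_on_def F_def by simp
    qed
  next
    case (insert i S)
    show ?case
    proof (intro allI impI ballI)
      fix b v assume b: "b y0 = y" "\<forall>j. j \<noteq> y0 \<longrightarrow> b j \<in> ?H1" and v: "v \<in> W2"
      have bH: "b j \<in> H" for j using b y by (cases "j = y0") auto
      have i: "i \<noteq> y0" "i \<in> J" "i \<notin> S" using insert by auto
      define b' where "b' = b(i := x \<otimes> b i)"
      have b'H: "b' j \<in> H" for j using bH x by (simp add: b'_def)
      have "x \<otimes> b i \<in> ?H1"
      proof -
        have "?GH = ?GH" ..
        have s: "subgroup (GH.centralizer_mod ?K {x}) ?GH" using x
          by (intro GH.centralizer_mod_subgroup[OF Kn]) auto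
        have eq: "GH.centralizer_mod ?K {x} = ?H1" using x commH
          by (auto simp: GH.centralizer_mod_def)
        show ?thesis using subgroup.m_closed[OF s, of x "b i"] xH1 b(2) i(1) unfolding eq by simp
      qed
      hence b'1: "\<forall>j. j \<noteq> y0 \<longrightarrow> b' j \<in> ?H1" using b(2) by (auto simp: b'_def)
      have b'0: "b' y0 = y" using b(1) i(1) by (simp add: b'_def)
      define A where "A = {w \<in> permutations_of_set J. insert i S \<subseteq> aft w}"
      define B where "B = {w \<in> permutations_of_set J. S \<subseteq> aft w \<and> i \<notin> aft w}"
      have AB: "{w \<in> permutations_of_set J. S \<subseteq> aft w} = A \<union> B" "A \<inter> B = {}" "finite A" "finite B"
        by (auto simp: A_def B_def)
      let ?t = "\<lambda>w. \<rho> (gprod G b w) * v * e w"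
      have Fb: "F S b v = sum ?t A + sum ?t B"
        unfolding F_def AB(1) by (rule sum.union_disjoint[OF AB(3,4,2)])
      have F1: "F S b v \<in> W1" "F S b' v \<in> W1" using insert(3) insert(4) b b'1 b'0 v by blast+
      have tW2: "?t w \<in> W2" for w by (intro e2 act2 gH bH v eE)
      have sA2: "sum ?t A \<in> W2" by (rule asub_sum[OF a2 tW2])
      have shift: "?K #>\<^bsub>?GH\<^esub> gprod ?GH b' w = ?K #>\<^bsub>?GH\<^esub>
          (if i \<in> aft w then comm ?GH (b y0) x \<otimes>\<^bsub>?GH\<^esub> (x \<otimes>\<^bsub>?GH\<^esub> gprod ?GH b w) else x \<otimes>\<^bsub>?GH\<^esub> gprod ?GH b
            w)"
        if w: "w \<in> permutations_of_set J" for w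
      proof -
        have "?K #>\<^bsub>?GH\<^esub> gprod ?GH (b(i := x \<otimes>\<^bsub>?GH\<^esub> b i)) w = ?K #>\<^bsub>?GH\<^esub>
          (if i \<in> set (dropWhile (\<lambda>j. j \<noteq> y0) w) then comm ?GH (b y0) x \<otimes>\<^bsub>?GH\<^esub> (x \<otimes>\<^bsub>?GH\<^esub> gprod ?GH b w)
            else x \<otimes>\<^bsub>?GH\<^esub> gprod ?GH b w)"
        proof (rule GH.gprod_shift_mod[OF Kn])
          show "b j \<in> carrier ?GH" "x \<in> carrier ?GH" for j using bH x by auto
          show "comm ?GH (b j) x \<in> ?K" if "j \<noteq> y0" for j using b(2) that commH[OF bH x] by auto
          show "comm ?GH (b y0) x \<in> GH.centralizer_mod ?K (carrier ?GH)"
            using \<mu>c \<mu>H b(1) commH[OF y x] commH[OF \<mu>H] by (auto simp: GH.centralizer_mod_def \<mu>_def)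
          show "i \<noteq> y0" by (rule i(1))
          show "distinct w" "i \<in> set w" using w i(2) by (auto simp: permutations_of_set_def)
        qed
        thus ?thesis by (simp add: aft_def b'_def)
      qed
      have gg: "gprod ?GH c w = gprod G c w" for c w by (simp add: gprod_def)
      have dA: "\<rho> (gprod G b' w) * v * e w - \<rho> \<mu> * (\<rho> x * ?t w) \<in> W1" if w: "w \<in> A" for w
      proof -
        let ?p = "gprod G b w"
        have pH: "?p \<in> H" by (rule gH[OF bH])
        have "?K #>\<^bsub>?GH\<^esub> gprod G b' w = ?K #>\<^bsub>?GH\<^esub> (\<mu> \<otimes> (x \<otimes> ?p))"
          using shift[of w] w commH[OF y x] by (simp add: A_def gg b(1) \<mu>_def)
        hence 1: "\<rho> (gprod G b' w) * v - \<rho> (\<mu> \<otimes> (x \<otimes> ?p)) * v \<in> W1"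
          using gH[OF b'H] \<mu>H x pH v by (intro act_coset_cong[OF H W st]) auto
        have 2: "\<rho> (\<mu> \<otimes> (x \<otimes> ?p)) * v - \<rho> \<mu> * (\<rho> (x \<otimes> ?p) * v) \<in> W1" using \<mu>H x pH
          by (intro mult1) auto
        have "\<rho> \<mu> * (\<rho> (x \<otimes> ?p) * v - \<rho> x * (\<rho> ?p * v)) \<in> W1" by (intro act1[OF \<mu>H] mult1 x pH)
        hence 3: "\<rho> \<mu> * (\<rho> (x \<otimes> ?p) * v) - \<rho> \<mu> * (\<rho> x * (\<rho> ?p * v)) \<in> W1"
          by (simp add: right_diff_distrib)
        have "\<rho> (gprod G b' w) * v - \<rho> \<mu> * (\<rho> x * (\<rho> ?p * v)) \<in> W1"
          by (rule asub_trans[OF a1 1 asub_trans[OF a1 2 3]])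
        from e1[OF this eE[of w]] show ?thesis by (simp only: left_diff_distrib mult.assoc)
      qed
      have dB: "\<rho> (gprod G b' w) * v * e w - \<rho> x * ?t w \<in> W1" if w: "w \<in> B" for w
      proof -
        let ?p = "gprod G b w"
        have pH: "?p \<in> H" by (rule gH[OF bH])
        have "?K #>\<^bsub>?GH\<^esub> gprod G b' w = ?K #>\<^bsub>?GH\<^esub> (x \<otimes> ?p)"
          using shift[of w] w by (simp add: B_def gg)
        hence 1: "\<rho> (gprod G b' w) * v - \<rho> (x \<otimes> ?p) * v \<in> W1"
          using gH[OF b'H] x pH v by (intro act_coset_cong[OF H W st]) auto
        have "\<rho> (gprod G b' w) * v - \<rho> x * (\<rho> ?p * v) \<in> W1"
          by (rule asub_trans[OF a1 1 mult1[OF x pH]])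
        from e1[OF this eE[of w]] show ?thesis by (simp only: left_diff_distrib mult.assoc)
      qed
      define sA where "sA = (\<Sum>w\<in>A. \<rho> (gprod G b' w) * v * e w)"
      define sB where "sB = (\<Sum>w\<in>B. \<rho> (gprod G b' w) * v * e w)"
      define p where "p = sA - \<rho> \<mu> * (\<rho> x * sum ?t A)"
      define q where "q = sB - \<rho> x * sum ?t B"
      have Fb': "F S b' v = sA + sB"
        unfolding F_def AB(1) sA_def sB_def by (rule sum.union_disjoint[OF AB(3,4,2)])
      have "p = (\<Sum>w\<in>A. \<rho> (gprod G b' w) * v * e w - \<rho> \<mu> * (\<rho> x * ?t w))"
        by (simp add: p_def sA_def sum_subtractf sum_distrib_left)
      hence p1: "p \<in> W1" using asub_sum[OF a1 dA] by simp
      have "q = (\<Sum>w\<in>B. \<rho> (gprod G b' w) * v * e w - \<rho> x * ?t w)"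
        by (simp add: q_def sB_def sum_subtractf sum_distrib_left)
      hence q1: "q \<in> W1" using asub_sum[OF a1 dB] by simp
      have z: "\<rho> x * F S b v \<in> W1" by (rule act1[OF x F1(1)])
      \<comment> \<open>Subtracting \<open>x\<close> times the sum for \<open>b\<close> from the sum
        for \<open>b'\<close> cancels the orderings with \<open>i\<close> before \<open>y0\<close>.
        What is left is \<mu> - 1 applied to \<open>x\<close> times the other part.\<close>
      have "\<rho> \<mu> * (\<rho> x * sum ?t A) - \<rho> x * sum ?t A = F S b' v - (p + q) - \<rho> x * F S b v"
        unfolding Fb Fb' distrib_left p_def q_def by simp
      moreover have "F S b' v - (p + q) - \<rho> x * F S b v \<in> W1"
        by (intro asub_diff[OF a1] asub_add[OF a1] F1 p1 q1 z)
      ultimately have "\<rho> x * sum ?t A \<in> W1" using inj[OF act2[OF x sA2]] by simp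
      hence "\<rho> (inv x) * (\<rho> x * sum ?t A) \<in> W1" by (rule act1[OF H.m_inv_closed[OF x]])
      moreover have "\<rho> (inv x) * (\<rho> x * sum ?t A) - sum ?t A \<in> W1"
        using inv_act[of x "sum ?t A"] x m1 by auto
      ultimately have "sum ?t A \<in> W1" using asub_iff[OF a1] by blast
      thus "F (insert i S) b v \<in> W1" by (simp add: F_def A_def)
    qed
  qed
  show ?thesis unfolding identity_on_def
  proof (intro allI impI ballI)
    fix b :: "'i \<Rightarrow> 'g" and v assume b: "\<forall>j. b j \<in> ?H1" and v: "v \<in> W2"
    \<comment> \<open>The element \<open>y\<close> is put in for \<open>y0\<close>; it leads every
      surviving monomial and is finally cancelled by its inverse.\<close>
    define b' where "b' = b(y0 := y)"
    have b'H: "b' j \<in> H" for j using b y by (simp add: b'_def)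
    have bH: "b j \<in> H" for j using b by simp
    have F: "F (J - {y0}) b' v \<in> W1" using main[of "J - {y0}"] J(1) b v by (auto simp: b'_def)
    have set: "{w \<in> permutations_of_set J. J - {y0} \<subseteq> aft w} = (#) y0 ` permutations_of_set (J -
      {y0})"
    proof (intro subset_antisym subsetI)
      fix w assume w: "w \<in> {w \<in> permutations_of_set J. J - {y0} \<subseteq> aft w}"
      hence wJ: "set w = J" "distinct w" by (auto simp: permutations_of_set_def)
      then obtain i w' where iw: "w = i # w'" using J(2) by (cases w) auto
      have "i = y0"
      proof (rule ccontr)
        assume "i \<noteq> y0"
        hence "i \<in> aft w" using w wJ iw by auto
        moreover have "aft w \<subseteq> set w'" using \<open>i \<noteq> y0\<close> iw set_dropWhileD by (fastforce simp: aft_def)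
        ultimately show False using wJ iw by auto
      qed
      thus "w \<in> (#) y0 ` permutations_of_set (J - {y0})"
        using w iw by (auto simp: permutations_of_set_Cons)
    next
      fix w assume "w \<in> (#) y0 ` permutations_of_set (J - {y0})"
      then obtain w' where w': "w = y0 # w'" "w' \<in> permutations_of_set (J - {y0})" by blast
      have "aft w = insert y0 (set w')" using w' by (simp add: aft_def)
      thus "w \<in> {w \<in> permutations_of_set J. J - {y0} \<subseteq> aft w}"
        using w' J(2) by (auto simp: permutations_of_set_def)
    qed
    let ?s = "\<lambda>w. \<rho> (gprod G b w) * v * e (y0 # w)"
    have "F (J - {y0}) b' v = (\<Sum>w\<in>permutations_of_set (J -
      {y0}). \<rho> (gprod G b' (y0 # w)) * v * e (y0 # w))"
      unfolding F_def set by (subst sum.reindex) (auto simp: inj_on_def)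
    moreover have "\<rho> (gprod G b' (y0 # w)) * v * e (y0 # w) - \<rho> y * ?s w \<in> W1"
      if w: "w \<in> permutations_of_set (J - {y0})" for w
    proof -
      have "gprod G b' w = gprod G b w" by (rule gprod_cong) (use w in \<open>auto simp: b'_def
        permutations_of_set_def\<close>)
      hence "gprod G b' (y0 # w) = y \<otimes> gprod G b w" by (simp add: b'_def)
      hence "\<rho> (gprod G b' (y0 # w)) * v - \<rho> y * (\<rho> (gprod G b w) * v) \<in> W1"
        using mult1[OF y gH[OF bH], where v = v] by simp
      from e1[OF this eE[of "y0 # w"]] show ?thesis by (simp only: left_diff_distrib mult.assoc)
    qed
    hence "(\<Sum>w\<in>permutations_of_set (J - {y0}). \<rho> (gprod G b' (y0 # w)) * v * e (y0 # w) -
      \<rho> y * ?s w) \<in> W1"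
      by (rule asub_sum[OF a1])
    ultimately have "F (J - {y0}) b' v - \<rho> y * (\<Sum>w\<in>permutations_of_set (J - {y0}). ?s w) \<in> W1"
      by (simp only: sum_subtractf sum_distrib_left)
    hence "\<rho> y * (\<Sum>w\<in>permutations_of_set (J - {y0}). ?s w) \<in> W1" using F asub_iff[OF a1] by blast
    hence "\<rho> (inv y) * (\<rho> y * (\<Sum>w\<in>permutations_of_set (J - {y0}). ?s w)) \<in> W1"
      by (rule act1[OF H.m_inv_closed[OF y]])
    moreover have "\<rho> (inv y) * (\<rho> y * u) - u \<in> W1" for u using inv_act[of y u] y m1 by auto
    ultimately show "(\<Sum>w\<in>permutations_of_set (J - {y0}). ?s w) \<in> W1" using asub_iff[OF a1] by blast
  qed
qed

end

section \<open>Derived length of a nilpotent action\<close>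

context group
begin

lemma lower_central_subgroup_mono:
  assumes H: "subgroup H G" shows "lower_central (G\<lparr>carrier := H\<rparr>) n \<subseteq> lower_central G n"
proof (induct n)
  case 0 show ?case using subgroup.subset[OF H] by simp
next
  case (Suc n)
  interpret GH: group "G\<lparr>carrier := H\<rparr>" by (rule subgroup_imp_group[OF H])
  define T where "T = {comm (G\<lparr>carrier := H\<rparr>) x y |x y. x \<in> lower_central (G\<lparr>carrier := H\<rparr>) n \<and> y \<in>
    H}"
  have L: "lower_central (G\<lparr>carrier := H\<rparr>) n \<subseteq> H" using GH.lower_central_carrier[of n] by simp
  have TH: "T \<subseteq> H" unfolding T_def using L GH.comm_closed by auto
  have "T \<subseteq> lower_central G (Suc n)"
  proof
    fix t assume "t \<in> T"
    then obtain x y where xy: "t = comm (G\<lparr>carrier := H\<rparr>) x y" "x \<in> lower_central (G\<lparr>carrier :=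
      H\<rparr>) n" "y \<in> H"
      unfolding T_def by blast
    have "t = comm G x y" using xy L comm_subgroup_eq[OF H] by blast
    moreover have "comm G x y \<in> lower_central G (Suc n)"
      using xy Suc subgroup.subset[OF H] by (intro lower_central_comm) auto
    ultimately show "t \<in> lower_central G (Suc n)" by simp
  qed
  hence "generate G T \<subseteq> lower_central G (Suc n)"
    by (rule generate_subgroup_incl[OF _ normal_imp_subgroup[OF lower_central_normal]])
  moreover have "lower_central (G\<lparr>carrier := H\<rparr>) (Suc n) = generate G T"
    using generate_consistent[OF TH H] by (simp add: T_def)
  ultimately show ?case by simp
qed

end

context rep_module
begin

lemma identity_onD:
  "identity_on H W1 W2 J e \<Longrightarrow> (\<And>j. b j \<in> H) \<Longrightarrow> v \<in> W2 \<Longrightarrow>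
    (\<Sum>w\<in>permutations_of_set J. \<rho> (gprod G b w) * v * e w) \<in> W1"
  by (simp add: identity_on_def)

text \<open>If \<open>W2\<close> modulo \<open>W1\<close> is reducible, split it. Otherwise, when \<open>H\<close> does not act through an
  abelian group, choose \<open>x\<close> acting as a noncentral element of the second centre: its centralizer
  contains the derived subgroup and satisfies an identity of lower degree.\<close>

lemma derived_ker:
  assumes nil: "lower_central G n \<subseteq> ker_on (carrier G) M UNIV"
  shows "subgroup H G \<Longrightarrow> E_subspace W1 \<Longrightarrow> E_subspace W2 \<Longrightarrow> W1 \<subseteq> W2 \<Longrightarrow> stable H W1 \<Longrightarrow> stable H W2 \<Longrightarrow>
    finite J \<Longrightarrow> w1 \<in> permutations_of_set J \<Longrightarrow> e w1 = 1 \<Longrightarrow> (\<And>w. e w \<in> E) \<Longrightarrow> identity_on H W1 W2 J e \<Longrightarrow>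
    card J + E_dim W2 \<le> N + E_dim W1 \<Longrightarrow> (derived G ^^ N) H \<subseteq> ker_on H W1 W2"
proof (induct N arbitrary: H W1 W2 J w1 e)
  case 0
  \<comment> \<open>With \<open>N = 0\<close> the bound forces equal dimensions. In general
    \<open>N\<close> pays for one derived step at each drop of the degree or of the
    dimension.\<close>
  have "W1 = W2"
  proof (rule ccontr)
    assume "W1 \<noteq> W2"
    hence "E_dim W1 < E_dim W2" using 0(4) by (intro E_dim_strict_mono[OF 0(2)]) blast
    thus False using 0(12) by simp
  qed
  moreover have "ker_on H W1 W1 = H"
    unfolding ker_on_def using 0(5) asub_diff[OF E_subspaceD(1)[OF 0(2)]] by (auto simp: stable_def)
  ultimately show ?case by simp
next
  case (Suc N)
  note H = Suc(2) and W = Suc(3,4,5) and st = Suc(6,7) and J = Suc(8) and w1 = Suc(9)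
    and e1 = Suc(10)
    and eE = Suc(11) and id = Suc(12) and le = Suc(13)
  interpret H: subgroup H G by (rule H)
  let ?GH = "G\<lparr>carrier := H\<rparr>"
  interpret GH: group ?GH by (rule subgroup_imp_group[OF H])
  let ?K = "ker_on H W1 W2"
  have Kn: "?K \<lhd> ?GH" by (rule ker_on_normal[OF H W st])
  interpret K: normal ?K ?GH by (rule Kn)
  have Ks: "subgroup ?K G" by (rule incl_subgroup[OF H K.subgroup_axioms])
  note a1 = E_subspaceD(1)[OF W(1)] and m1 = E_subspaceD(2)[OF W(1)]
  have commH: "comm ?GH a b = comm G a b" if "a \<in> H" "b \<in> H" for a b
    by (rule comm_subgroup_eq[OF H that])
  have cH: "comm G a b \<in> H" if "a \<in> H" "b \<in> H" for a b by (rule subgroup_comm[OF H that])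
  have swap: "(derived G ^^ Suc N) H = (derived G ^^ N) (derived G H)" by (simp add: funpow_swap1)
  show ?case
  proof (cases "W1 = W2")
    case True
    hence "?K = H" unfolding ker_on_def using st asub_diff[OF a1] by (auto simp: stable_def)
    thus ?thesis using funpow_derived_mono_in[OF H order_refl, of "Suc N"] by (simp only:)
  next
    case W12: False
    show ?thesis
    proof (cases "J = {}")
      case True
      hence "w1 = []" using w1 by simp
      \<comment> \<open>An identity of degree 0 with coefficient 1 annihilates the section.\<close>
      have "v \<in> W1" if v: "v \<in> W2" for v
      proof -
        have "(\<Sum>w\<in>permutations_of_set J. \<rho> (gprod G (\<lambda>j. \<one>) w) * v * e w) \<in> W1"
          by (rule identity_onD[OF id _ v]) simp
        hence "\<rho> \<one> * v \<in> W1" using True e1 \<open>w1 = []\<close> by simp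
        moreover have "\<rho> \<one> * v - v \<in> W1" using \<rho>_one m1 by blast
        ultimately show ?thesis using asub_iff[OF a1] by blast
      qed
      thus ?thesis using W(3) W12 by blast
    next
      case False
      show ?thesis
      proof (cases "\<exists>W. E_subspace W \<and> W1 \<subset> W \<and> W \<subset> W2 \<and> stable H W")
        case True
        then obtain V where V: "E_subspace V" "W1 \<subset> V" "V \<subset> W2" "stable H V" by blast
        have E_dim: "E_dim W1 < E_dim V" "E_dim V < E_dim W2"
          using E_dim_strict_mono[OF W(1) V(2)] E_dim_strict_mono[OF V(1) V(3)] .
        have i1: "identity_on H W1 V J e" and i2: "identity_on H V W2 J e"
          using V(2,3) by (auto simp: identity_on_def intro: identity_onD[OF id] subsetD[of W1 V])
        let ?D = "(derived G ^^ N) H"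
        have D1: "?D \<subseteq> ker_on H W1 V"
          by (rule Suc(1)[OF H W(1) V(1) _ st(1) V(4) J w1 e1 eE i1]) (use V le E_dim in auto)
        have D2: "?D \<subseteq> ker_on H V W2"
          by (rule Suc(1)[OF H V(1) W(2) _ V(4) st(2) J w1 e1 eE i2]) (use V le E_dim in auto)
        have s1: "subgroup (ker_on H W1 V) G"
          using V by (intro incl_subgroup[OF H] normal_imp_subgroup ker_on_normal H W(1) st(1)) auto
        have s2: "subgroup (ker_on H V W2) G"
          using V by (intro incl_subgroup[OF H] normal_imp_subgroup ker_on_normal H W(2) st(2)) auto
        have DH: "?D \<subseteq> H" using D1 by (auto simp: ker_on_def)
        have "derived G ?D \<subseteq> ?K"
        proof (rule derived_comm[OF _ Ks])
          show "?D \<subseteq> carrier G" using DH H.subset by blast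
          fix a0 b0 assume a0: "a0 \<in> ?D" and b0: "b0 \<in> ?D"
          define a where "a = inv a0"
          define b where "b = inv b0"
          have a: "a \<in> ker_on H W1 V" "a \<in> ker_on H V W2"
            and b: "b \<in> ker_on H W1 V" "b \<in> ker_on H V W2"
            unfolding a_def b_def using a0 b0 D1 D2 subgroup.m_inv_closed[OF s1]
              subgroup.m_inv_closed[OF s2] by blast+
          have ab: "a \<in> H" "b \<in> H" using a b by (auto simp: ker_on_def)
          have "\<rho> (comm G a b) * v - v \<in> W1" if v: "v \<in> W2" for v
          proof -
            have mult1: "\<rho> (g \<otimes> h) * v - \<rho> g * (\<rho> h * v) \<in> W1" if "g \<in> H" "h \<in> H" for g h v
              using \<rho>_mult[of g h v] that m1 by auto
            \<comment> \<open>\<open>p\<close> and \<open>q\<close> lie in \<open>V\<close>, where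
              \<open>a\<close> and \<open>b\<close> act trivially modulo \<open>W1\<close>;
              expanding shows that \<open>a\<close> and \<open>b\<close> commute on
              \<open>W2\<close> modulo \<open>W1\<close>.\<close>
            define p where "p = \<rho> b * v - v"
            define q where "q = \<rho> a * v - v"
            have pq: "p \<in> V" "q \<in> V" using a b v by (auto simp: ker_on_def p_def q_def)
            have 1: "\<rho> a * p - p \<in> W1" "\<rho> b * q - q \<in> W1" using a b pq by (auto simp: ker_on_def)
            have "\<rho> a * (\<rho> b * v) - \<rho> b * (\<rho> a * v) = (\<rho> a * p - p) - (\<rho> b * q - q)"
              unfolding p_def q_def by (simp add: algebra_simps)
            hence 2: "\<rho> a * (\<rho> b * v) - \<rho> b * (\<rho> a * v) \<in> W1" using asub_diff[OF a1 1] by simp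
            let ?c = "comm G a b"
            have c: "?c \<in> H" by (rule cH[OF ab])
            have "a \<otimes> b = (b \<otimes> a) \<otimes> ?c" using ab by (simp add: comm_def free_simps)
            hence 3: "\<rho> (a \<otimes> b) * v - \<rho> (b \<otimes> a) * (\<rho> ?c * v) \<in> W1"
              using mult1[of "b \<otimes> a" ?c v] ab c by simp
            have 4: "\<rho> (a \<otimes> b) * v - \<rho> (b \<otimes> a) * v \<in> W1"
              by (rule asub_trans[OF a1 mult1[OF ab] asub_trans[OF a1 2 asub_sym[OF a1 mult1[OF
                ab(2,1)]]]])
            have "\<rho> (b \<otimes> a) * (\<rho> ?c * v) - \<rho> (b \<otimes> a) * v \<in> W1"
              by (rule asub_trans[OF a1 asub_sym[OF a1 3] 4])
            hence "\<rho> (b \<otimes> a) * (\<rho> ?c * v - v) \<in> W1" by (simp only: right_diff_distrib)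
            hence 5: "\<rho> (inv (b \<otimes> a)) * (\<rho> (b \<otimes> a) * (\<rho> ?c * v - v)) \<in> W1"
              using st(1) H.m_inv_closed[OF H.m_closed[OF ab(2,1)]] unfolding stable_def by blast
            have "\<rho> (inv (b \<otimes> a)) * (\<rho> (b \<otimes> a) * (\<rho> ?c * v - v)) - (\<rho> ?c * v - v) \<in> W1"
              by (rule subsetD[OF m1 inv_act]) (use ab in simp)
            thus ?thesis using 5 asub_iff[OF a1] by blast
          qed
          thus "comm G (inv a0) (inv b0) \<in> ?K" unfolding a_def[symmetric] b_def[symmetric]
            using cH[OF ab] unfolding ker_on_def by blast
        qed
        thus ?thesis by simp
      next
        case irr: False
        let ?L = "lower_central ?GH"
        let ?Z = "GH.centralizer_mod ?K (carrier ?GH)"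
        have KZ: "?K \<subseteq> ?Z"
        proof
          fix k assume k: "k \<in> ?K"
          have "comm ?GH k z \<in> ?K" if "z \<in> carrier ?GH" for z
            by (rule GH.normal_comm(1)[OF Kn k that])
          thus "k \<in> ?Z" using k K.subset by (auto simp: GH.centralizer_mod_def)
        qed
        have "?L n \<subseteq> ?K"
        proof
          fix g assume g: "g \<in> ?L n"
          hence "g \<in> ker_on (carrier G) M UNIV" using lower_central_subgroup_mono[OF H] nil by blast
          moreover have "g \<in> H" using g GH.lower_central_carrier[of n] by auto
          ultimately show "g \<in> ?K" using m1 by (auto simp: ker_on_def)
        qed
        hence ex: "\<exists>i. ?L i \<subseteq> ?Z" using KZ by blast
        define i where "i = (LEAST i. ?L i \<subseteq> ?Z)"
        have i: "?L i \<subseteq> ?Z" unfolding i_def using ex by (rule LeastI_ex)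
        show ?thesis
        proof (cases i)
          case 0
          have "derived G H \<subseteq> ?K"
          proof (rule derived_comm[OF H.subset Ks])
            fix a b assume ab: "a \<in> H" "b \<in> H"
            hence "inv a \<in> ?L 0" by simp
            hence "inv a \<in> ?Z" using i 0 by blast
            hence "comm ?GH (inv a) (inv b) \<in> ?K" using ab by (auto simp: GH.centralizer_mod_def)
            thus "comm G (inv a) (inv b) \<in> ?K" using commH ab by simp
          qed
          thus ?thesis unfolding swap by (rule funpow_derived_mono_in[OF Ks])
        next
          case (Suc j)
          have "\<not> ?L j \<subseteq> ?Z" using not_less_Least[of j "\<lambda>i. ?L i \<subseteq> ?Z"] Suc unfolding i_def by simp
          \<comment> \<open>The next term is central modulo \<open>?K\<close>, so \<open>x\<close>
            acts as an element of the second centre, and it is itself not central.\<close>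
          then obtain x where x: "x \<in> ?L j" "x \<notin> ?Z" by blast
          have xH: "x \<in> H" using x GH.lower_central_carrier[of j] by auto
          then obtain y where y: "y \<in> H" "comm G x y \<notin> ?K" using x(2) commH
            by (auto simp: GH.centralizer_mod_def)
          have xZ: "comm ?GH x g \<in> ?Z" if g: "g \<in> carrier ?GH" for g
            using GH.lower_central_comm[OF x(1) g] i unfolding Suc by blast
          have cen: "comm G (comm G x g) h \<in> ?K" if g: "g \<in> H" "h \<in> H" for g h
          proof -
            have "comm ?GH (comm ?GH x g) h \<in> ?K" using xZ[of g] g
              by (simp add: GH.centralizer_mod_def)
            thus ?thesis unfolding commH[OF xH g(1)] commH[OF cH[OF xH g(1)] g(2)] .
          qed
          obtain y0 w2 where w12: "w1 = y0 # w2" using False w1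
            by (cases w1) (auto simp: permutations_of_set_def)
          have y0: "y0 \<in> J" "w2 \<in> permutations_of_set (J - {y0})" using w1
            unfolding w12 permutations_of_set_Cons by auto
          let ?H1 = "{h \<in> H. comm G h x \<in> ?K}"
          have irr': "W = W1 \<or> W = W2" if "E_subspace W" "W1 \<subseteq> W" "W \<subseteq> W2" "stable H W" for W
            using irr that by blast
          have id': "identity_on ?H1 W1 W2 (J - {y0}) (\<lambda>w. e (y0 # w))"
            by (rule identity_on_descend[OF H W st irr' xH y cen J y0(1) id eE])
          have H1e: "GH.centralizer_mod ?K {x} = ?H1" using xH commH
            by (auto simp: GH.centralizer_mod_def)
          have "subgroup ?H1 ?GH" unfolding H1e[symmetric]
            by (rule GH.centralizer_mod_subgroup[OF Kn]) (use xH in simp)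
          hence H1: "subgroup ?H1 G" by (rule incl_subgroup[OF H])
          have "derived G H \<subseteq> ?H1"
          proof (rule derived_comm[OF H.subset H1])
            fix a b assume ab: "a \<in> H" "b \<in> H"
            have "comm ?GH (comm ?GH (inv a) (inv b)) x \<in> ?K"
              by (rule GH.normal_comm_comm[OF Kn _ _ _ xZ]) (use xH ab in auto)
            moreover have c: "comm G (inv a) (inv b) \<in> H" using ab by (intro cH) auto
            moreover have "comm ?GH (inv a) (inv b) = comm G (inv a) (inv b)" using ab
              by (intro commH) auto
            ultimately show "comm G (inv a) (inv b) \<in> ?H1" using commH[OF c xH] by simp
          qed
          hence "(derived G ^^ N) (derived G H) \<subseteq> (derived G ^^ N) ?H1"
            by (rule mono_exp_of_derived)
          also have "\<dots> \<subseteq> ker_on ?H1 W1 W2"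
          proof (rule Suc.hyps(1)[OF H1 W _ _ _ y0(2) _ _ id'])
            show "stable ?H1 W1" "stable ?H1 W2" using st by (auto simp: stable_def)
            show "finite (J - {y0})" using J by simp
            show "e (y0 # w2) = 1" using e1 w12 by simp
            show "e (y0 # w) \<in> E" for w by (rule eE)
            show "card (J - {y0}) + E_dim W2 \<le> N + E_dim W1" using le card_Suc_Diff1[OF J y0(1)]
              by simp
          qed
          also have "\<dots> \<subseteq> ?K" by (auto simp: ker_on_def)
          finally show ?thesis unfolding swap .
        qed
      qed
    qed
  qed
qed

text \<open>The degree contributes \<open>card I\<close> and the dimension of the whole module less
  than that. The nilpotency index \<open>n\<close> does not enter the bound.\<close>

theorem derived_trivial:
  assumes nil: "lower_central G n \<subseteq> ker_on (carrier G) M UNIV"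
  shows "(derived G ^^ (2 * card I)) (carrier G) \<subseteq> ker_on (carrier G) M UNIV"
proof (rule derived_ker[OF nil subgroup_self])
  show "E_subspace M" by (simp add: E_subspace_def Ma ME)
  show "E_subspace UNIV" by (simp add: E_subspace_def additive_subgroup_set_def)
  show "stable (carrier G) M" "stable (carrier G) UNIV" by (auto simp: stable_def Ml)
  show "finite I" "w0 \<in> permutations_of_set I" "\<gamma> w0 = 1" "\<gamma> w \<in> E" for w
    by (rule finI w0 \<gamma>_w0 \<gamma>_E)+
  show "card I + E_dim UNIV \<le> 2 * card I + E_dim M" using E_dim_bound[of UNIV] by simp
  show "identity_on (carrier G) M UNIV I \<gamma>" unfolding identity_on_def
  proof (intro allI impI ballI)
    fix b :: "'i \<Rightarrow> 'g" and v :: 'b assume b: "\<forall>j. b j \<in> carrier G"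
    have p: "\<rho> (gprod G b w) * u - prod_list (map (\<lambda>i. \<rho> (b i)) w) * u \<in> M" for w u
    proof (induct w arbitrary: u)
      case Nil show ?case using \<rho>_one by simp
    next
      case (Cons i w)
      have 1: "\<rho> (b i \<otimes> gprod G b w) * u - \<rho> (b i) * (\<rho> (gprod G b w) * u) \<in> M"
        using b by (intro \<rho>_mult) auto
      have "\<rho> (b i) * (\<rho> (gprod G b w) * u - prod_list (map (\<lambda>i. \<rho> (b i)) w) * u) \<in> M"
        by (rule Ml[OF Cons])
      hence "\<rho> (b i) * (\<rho> (gprod G b w) * u) - \<rho> (b i) * (prod_list (map (\<lambda>i. \<rho> (b i)) w) * u) \<in> M"
        by (simp only: right_diff_distrib)
      from M_trans[OF 1 this] show ?case by (simp add: mult.assoc)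
    qed
    have "(\<Sum>w\<in>permutations_of_set I. (\<rho> (gprod G b w) * v -
      prod_list (map (\<lambda>i. \<rho> (b i)) w) * v) * \<gamma> w) \<in> M"
      by (rule M_sum[OF ME[OF p \<gamma>_E]])
    moreover have "(\<Sum>w\<in>permutations_of_set I. prod_list (map (\<lambda>i. \<rho> (b i)) w) * v * \<gamma> w) \<in> M"
      by (rule identity_right[OF \<rho>_R0])
    ultimately have "(\<Sum>w\<in>permutations_of_set I. (\<rho> (gprod G b w) * v -
      prod_list (map (\<lambda>i. \<rho> (b i)) w) * v) * \<gamma> w)
      + (\<Sum>w\<in>permutations_of_set I. prod_list (map (\<lambda>i. \<rho> (b i)) w) * v * \<gamma> w) \<in> M" by (rule M_add)
    thus "(\<Sum>w\<in>permutations_of_set I. \<rho> (gprod G b w) * v * \<gamma> w) \<in> M"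
      by (simp add: left_diff_distrib sum_subtractf)
  qed
qed auto

end

section \<open>Engel groups in finitely generated rings with a polynomial identity\<close>

lemma poly_mapping_sum_single:
  "p = (\<Sum>k\<in>Poly_Mapping.keys p. Poly_Mapping.single k (Poly_Mapping.lookup p k))"
proof (rule poly_mapping_eqI)
  fix i
  show "Poly_Mapping.lookup p i = Poly_Mapping.lookup (\<Sum>k\<in>Poly_Mapping.keys p. Poly_Mapping.single k
    (Poly_Mapping.lookup p k)) i"
    by (simp add: lookup_sum lookup_single when_def sum.delta not_in_keys_iff_lookup_eq_zero)
qed

lemma add_gen_sum:
  "finite A \<Longrightarrow> (\<And>i. i \<in> A \<Longrightarrow> f i \<in> S) \<Longrightarrow> sum f A \<in> add_gen S"
proof (induct A rule: finite_induct)
  case (insert i A)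
  have "sum f A + f i \<in> add_gen S" using insert by (intro add_gen_add) auto
  thus ?case using insert by (simp add: add.commute)
qed (simp add: add_gen_zero)

lemma maximal_left_ideal:
  fixes L :: "'b::ring_1 set"
  assumes L: "left_ideal L" "1 \<notin> L"
  obtains M where "left_ideal M" "L \<subseteq> M" "1 \<notin> M" "\<And>N. left_ideal N \<Longrightarrow> M \<subseteq> N \<Longrightarrow> N = M \<or> N = UNIV"
proof -
  define A where "A = {N. left_ideal N \<and> L \<subseteq> N \<and> 1 \<notin> N}"
  have "\<exists>M\<in>A. \<forall>N\<in>A. M \<subseteq> N \<longrightarrow> N = M"
  proof (rule subset_Zorn_nonempty)
    show "A \<noteq> {}" using L by (auto simp: A_def)
    fix C assume C: "C \<noteq> {}" "subset.chain A C"
    have CA: "\<And>N. N \<in> C \<Longrightarrow> left_ideal N" "\<And>N. N \<in> C \<Longrightarrow> L \<subseteq> N \<and> 1 \<notin> N"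
      using C(2) by (auto simp: subset.chain_def A_def)
    have "a + b \<in> \<Union>C" if ab: "a \<in> \<Union>C" "b \<in> \<Union>C" for a b
    proof -
      obtain N N' where N: "N \<in> C" "a \<in> N" "N' \<in> C" "b \<in> N'" using ab by blast
      hence "N \<subseteq> N' \<or> N' \<subseteq> N" using C(2) by (auto simp: subset.chain_def)
      thus ?thesis using N asub_add[OF left_ideal_asub[OF CA(1)]] by blast
    qed
    moreover have "0 \<in> \<Union>C" using C(1) CA(1) asub_zero[OF left_ideal_asub] by blast
    moreover have "- a \<in> \<Union>C" if "a \<in> \<Union>C" for a using that CA(1) left_ideal_neg by blast
    moreover have "r * a \<in> \<Union>C" if "a \<in> \<Union>C" for r a using that CA(1) left_ideal_mult by blast
    ultimately have "left_ideal (\<Union>C)" unfolding left_ideal_def additive_subgroup_set_def by blast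
    thus "\<Union>C \<in> A" using C(1) CA(2) by (auto simp: A_def)
  qed
  then obtain M where M: "M \<in> A" "\<And>N. N \<in> A \<Longrightarrow> M \<subseteq> N \<Longrightarrow> N = M" by blast
  have "N = M \<or> N = UNIV" if N: "left_ideal N" "M \<subseteq> N" for N
  proof (cases "1 \<in> N")
    case True
    have "r \<in> N" for r using left_ideal_mult[OF N(1) True, of r] by simp
    thus ?thesis by blast
  next
    case False
    thus ?thesis using M N by (auto simp: A_def)
  qed
  thus ?thesis using that M(1) by (auto simp: A_def)
qed

abbreviation const_poly :: "'a::ring_1 \<Rightarrow> nat \<Rightarrow>\<^sub>0 'a" where "const_poly \<equiv> Poly_Mapping.single 0"

lemma const_poly_mult: "const_poly (a * b) = const_poly a * const_poly b"
  by (simp add: mult_single)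

lemma const_poly_sum: "const_poly (sum f A) = (\<Sum>i\<in>A. const_poly (f i))"
  by (induct A rule: infinite_finite_induct) (simp_all add: single_add)

lemma const_poly_prod_list: "const_poly (prod_list (map f w)) =
  prod_list (map (\<lambda>i. const_poly (f i)) w)"
  by (induct w) (simp_all add: const_poly_mult)

lemma const_poly_mlin: "mlin (\<lambda>w. const_poly (\<gamma> w)) I (\<lambda>i. const_poly (f i)) =
  const_poly (mlin \<gamma> I f)"
  by (simp add: mlin_def const_poly_sum const_poly_mult const_poly_prod_list)

lemma mult_single_left:
  "Poly_Mapping.single j c * p =
    (\<Sum>k\<in>Poly_Mapping.keys p. Poly_Mapping.single (j + k) (c * Poly_Mapping.lookup p k))"
  for p :: "nat \<Rightarrow>\<^sub>0 'a::ring_1"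
  by (subst poly_mapping_sum_single[of p]) (simp add: sum_distrib_left mult_single)

lemma mult_single_right:
  "p * Poly_Mapping.single j c =
    (\<Sum>k\<in>Poly_Mapping.keys p. Poly_Mapping.single (k + j) (Poly_Mapping.lookup p k * c))"
  for p :: "nat \<Rightarrow>\<^sub>0 'a::ring_1"
  by (subst poly_mapping_sum_single[of p]) (simp add: sum_distrib_right mult_single)

lemma lookup_const_mult: "Poly_Mapping.lookup (const_poly c * p) i = c * Poly_Mapping.lookup p i"
  unfolding mult_single_left
  by (simp add: lookup_sum lookup_single when_def sum.delta not_in_keys_iff_lookup_eq_zero)

lemma lookup_mult_const: "Poly_Mapping.lookup (p * const_poly c) i = Poly_Mapping.lookup p i * c"
  unfolding mult_single_right
  by (simp add: lookup_sum lookup_single when_def sum.delta not_in_keys_iff_lookup_eq_zero)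

lemma lookup_mult_var:
  "Poly_Mapping.lookup (p * Poly_Mapping.single 1 c) 0 = 0"
  "Poly_Mapping.lookup (p * Poly_Mapping.single 1 c) (Suc i) = Poly_Mapping.lookup p i * c"
  for p :: "nat \<Rightarrow>\<^sub>0 'a::ring_1"
  unfolding mult_single_right
  by (simp_all add: lookup_sum lookup_single when_def sum.delta not_in_keys_iff_lookup_eq_zero)

text \<open>The indeterminate commutes with noncommutative coefficients. Hence the constants
  generate the polynomial ring over its centre, as the simple-module argument demands of
  \<open>R0\<close>.\<close>

lemma single_one_central: "Poly_Mapping.single j 1 * p = p * Poly_Mapping.single j 1"
  for p :: "nat \<Rightarrow>\<^sub>0 'a::ring_1"
  unfolding mult_single_left mult_single_right by (simp add: add.commute)

text \<open>The ideal \<open>Q[t]\<close>: calculating modulo it amounts to calculating with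
  polynomials over the quotient by \<open>Q\<close>.\<close>

definition poly_ideal :: "'a::ring_1 set \<Rightarrow> (nat \<Rightarrow>\<^sub>0 'a) set" where
  "poly_ideal Q = {p. \<forall>i. Poly_Mapping.lookup p i \<in> Q}"

lemma poly_ideal_asub: "additive_subgroup_set Q \<Longrightarrow> additive_subgroup_set (poly_ideal Q)"
  by (simp add: additive_subgroup_set_def poly_ideal_def lookup_add)

lemma poly_ideal_left:
  assumes Q: "left_ideal Q" shows "left_ideal (poly_ideal Q)"
  unfolding left_ideal_def
proof (intro conjI allI ballI)
  show a: "additive_subgroup_set (poly_ideal Q)" by (rule poly_ideal_asub[OF left_ideal_asub[OF Q]])
  fix r q assume q: "q \<in> poly_ideal Q"
  have "Poly_Mapping.single j c * q \<in> poly_ideal Q" for j c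
    unfolding mult_single_left
  proof (rule asub_sum[OF a])
    fix k
    show "Poly_Mapping.single (j + k) (c * Poly_Mapping.lookup q k) \<in> poly_ideal Q"
      using q left_ideal_mult[OF Q] asub_zero[OF left_ideal_asub[OF Q]]
      by (auto simp: poly_ideal_def lookup_single when_def)
  qed
  hence "(\<Sum>k\<in>Poly_Mapping.keys r. Poly_Mapping.single k (Poly_Mapping.lookup r k) * q) \<in>
    poly_ideal Q"
    by (intro asub_sum[OF a])
  thus "r * q \<in> poly_ideal Q"
    using poly_mapping_sum_single[of r] by (metis sum_distrib_right)
qed

text \<open>Rabinowitsch's trick: \<open>1 - a t\<close> generates a proper left ideal of \<open>(A / Q)[t]\<close>, because a
  left inverse would have to be the geometric series of \<open>a\<close>.\<close>

lemma rabinowitsch: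
  fixes Q :: "'a::ring_1 set"
  assumes Q: "two_sided Q" and a: "\<And>n. a ^ n \<notin> Q"
  obtains M where "left_ideal M" "poly_ideal Q \<subseteq> M" "1 \<notin> M"
    "\<And>N. left_ideal N \<Longrightarrow> M \<subseteq> N \<Longrightarrow> N = M \<or> N = UNIV" "\<exists>v. const_poly a * v \<notin> M"
proof -
  note Ql = two_sided_left[OF Q] and Qa = two_sided_asub[OF Q]
  note Pl = poly_ideal_left[OF Ql]
  note Pa = left_ideal_asub[OF Pl]
  define s :: "nat \<Rightarrow>\<^sub>0 'a" where "s = 1 - Poly_Mapping.single 1 a"
  define L where "L = {u * s + q | u q. q \<in> poly_ideal Q}"
  have LI: "u * s + q \<in> L" if "q \<in> poly_ideal Q" for u q using that by (auto simp: L_def)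
  have L: "left_ideal L" unfolding left_ideal_def additive_subgroup_set_def
  proof (intro conjI ballI allI)
    show "0 \<in> L" using LI[OF asub_zero[OF Pa], of 0] by simp
    fix x y assume "x \<in> L"
    then obtain u q where x: "x = u * s + q" "q \<in> poly_ideal Q" by (auto simp: L_def)
    show "- x \<in> L" using LI[OF asub_neg[OF Pa x(2)], of "- u"] x(1) by simp
    show "r * x \<in> L" for r
      using LI[OF left_ideal_mult[OF Pl x(2), of r], of "r * u"] x(1)
        by (simp add: distrib_left mult.assoc)
    assume "y \<in> L"
    then obtain u' q' where y: "y = u' * s + q'" "q' \<in> poly_ideal Q" by (auto simp: L_def)
    show "x + y \<in> L" using LI[OF asub_add[OF Pa x(2) y(2)], of "u + u'"] x(1) y(1)
      by (simp add: algebra_simps)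
  qed
  have "1 \<notin> L"
  proof
    assume "1 \<in> L"
    then obtain u q where uq: "1 = u * s + q" "q \<in> poly_ideal Q" by (auto simp: L_def)
    have q: "Poly_Mapping.lookup q i \<in> Q" for i using uq(2) by (simp add: poly_ideal_def)
    have e: "q = 1 - u + u * Poly_Mapping.single 1 a" using uq(1) by (simp add: s_def algebra_simps)
    have "Poly_Mapping.lookup u i - a ^ i \<in> Q" for i
    proof (induct i)
      case 0
      have "Poly_Mapping.lookup q 0 = 1 - Poly_Mapping.lookup u 0"
        unfolding e lookup_add lookup_minus lookup_mult_var(1) by (simp add: lookup_one)
      thus ?case using asub_sym[OF Qa, of 1 "Poly_Mapping.lookup u 0"] q[of 0] by simp
    next
      case (Suc i)
      have 1: "Poly_Mapping.lookup q (Suc i) = - Poly_Mapping.lookup u (Suc i) +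
        Poly_Mapping.lookup u i * a"
        unfolding e lookup_add lookup_minus lookup_mult_var(2) by (simp add: lookup_one)
      have "Poly_Mapping.lookup u (Suc i) - Poly_Mapping.lookup u i * a \<in> Q"
        using asub_neg[OF Qa q[of "Suc i"]] unfolding 1 by simp
      moreover have "Poly_Mapping.lookup u i * a - a ^ Suc i \<in> Q"
        using two_sided_rmult[OF Q Suc, of a]
          by (simp add: left_diff_distrib power_Suc2 del: power_Suc)
      ultimately show ?case by (rule asub_trans[OF Qa])
    qed
    \<comment> \<open>A polynomial has only finitely many nonzero coefficients, so one of the powers
      of \<open>a\<close> is congruent to 0, contrary to assumption.\<close>
    moreover obtain i where "i \<notin> Poly_Mapping.keys u"
      using ex_new_if_finite[OF infinite_UNIV_nat finite_keys] by blast
    hence "Poly_Mapping.lookup u i = 0" by (simp add: not_in_keys_iff_lookup_eq_zero)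
    ultimately have "- (a ^ i) \<in> Q" by (metis diff_0)
    thus False using asub_neg[OF Qa, of "- (a ^ i)"] a[of i] by simp
  qed
  then obtain M where M: "left_ideal M" "L \<subseteq> M" "1 \<notin> M" "\<And>N. left_ideal N \<Longrightarrow> M \<subseteq> N \<Longrightarrow>
    N = M \<or> N = UNIV"
    using maximal_left_ideal[OF L] by blast
  have "poly_ideal Q \<subseteq> M" using LI[of _ 0] M(2) by auto
  \<comment> \<open>The witness is the indeterminate: if \<open>a t\<close> were in
    \<open>M\<close>, then 1 would be the sum of \<open>s\<close> and \<open>a t\<close> in
    \<open>M\<close>.\<close>
  moreover have "const_poly a * Poly_Mapping.single 1 1 \<notin> M"
  proof
    assume "const_poly a * Poly_Mapping.single 1 1 \<in> M"
    hence "Poly_Mapping.single 1 a \<in> M" by (simp add: mult_single)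
    moreover have "s \<in> M" using LI[OF asub_zero[OF Pa], of 1] M(2) by auto
    ultimately have "s + Poly_Mapping.single 1 a \<in> M"
      by (intro asub_add[OF left_ideal_asub[OF M(1)]])
    thus False using M(3) by (simp add: s_def)
  qed
  ultimately show ?thesis using that M by blast
qed

text \<open>\<open>\<rho>\<close> represents \<open>G\<close> by units of the quotient of \<open>'a\<close> by \<open>Q0\<close>, a ring generated by \<open>B\<close> and
  satisfying the multilinear identity. Working modulo ideals keeps all quotients in the type \<open>'a\<close>.\<close>

locale pi_rep = group G
  for G :: "('g, 'x) monoid_scheme" (structure) +
  fixes gens :: "'g set" and \<rho> :: "'g \<Rightarrow> 'a::ring_1" and Q0 :: "'a set" and B :: "'a set"
    and \<gamma> :: "'i list \<Rightarrow> 'a" and I :: "'i set" and w0 :: "'i list"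
  assumes engel: "\<And>a b. a \<in> carrier G \<Longrightarrow> b \<in> carrier G \<Longrightarrow> \<exists>n. engel G n a b = \<one>"
    and gens: "finite gens" "gens \<subseteq> carrier G" "generate G gens = carrier G"
    and Q0: "two_sided Q0"
    and \<rho>_mult0: "\<And>g h. g \<in> carrier G \<Longrightarrow> h \<in> carrier G \<Longrightarrow> \<rho> (g \<otimes> h) - \<rho> g * \<rho> h \<in> Q0"
    and \<rho>_one0: "\<rho> \<one> - 1 \<in> Q0"
    and B: "finite B" and B_gen: "\<And>S. subring_set S \<Longrightarrow> B \<subseteq> S \<Longrightarrow> Q0 \<subseteq> S \<Longrightarrow> S = UNIV"
    and I: "finite I" "w0 \<in> permutations_of_set I" "\<gamma> w0 = 1"
    and \<gamma>_central0: "\<And>w b. \<gamma> w * b - b * \<gamma> w \<in> Q0"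
    and identity0: "\<And>x. mlin \<gamma> I x \<in> Q0"
begin

text \<open>The constants play the role of \<open>R0\<close>, and the indeterminate joins the
  finitely many ring generators. So the simple module is finite, which supplies the nilpotency that
  the bound on the derived length presupposes.\<close>

lemma derived_acts_trivially:
  assumes Q: "two_sided Q" "Q0 \<subseteq> Q"
    and M: "left_ideal M" "poly_ideal Q \<subseteq> M" "1 \<notin> M" "\<And>N. left_ideal N \<Longrightarrow> M \<subseteq> N \<Longrightarrow> N = M \<or> N = UNIV"
    and h: "h \<in> (derived G ^^ (2 * card I)) (carrier G)"
  shows "const_poly (\<rho> h) * v - v \<in> M"
proof -
  have cQ: "const_poly q * v \<in> M" if "q \<in> Q0" for q v
  proof -
    have "const_poly q * v \<in> poly_ideal Q"
      using that Q two_sided_rmult[OF Q(1)] by (auto simp: poly_ideal_def lookup_const_mult)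
    thus ?thesis using M(2) by blast
  qed
  interpret rep_module M "range const_poly" "\<lambda>w. const_poly (\<gamma> w)" I w0 G "\<lambda>g. const_poly (\<rho> g)"
  proof unfold_locales
    show "left_ideal M" "1 \<notin> M" by fact+
    show "N = M \<or> N = UNIV" if "left_ideal N" "M \<subseteq> N" for N by (rule M(4)[OF that])
    show "subring_set (range const_poly)"
      unfolding subring_set_def additive_subgroup_set_def
      by (auto simp flip: single_add const_poly_mult single_uminus intro: range_eqI[of _ _ 0]
        range_eqI[of _ _ 1])
    show "p \<in> add_gen {c * z |c z. c \<in> range const_poly \<and> (\<forall>a. z * a = a * z)}" for p :: "nat \<Rightarrow>\<^sub>0 'a"
    proof (subst poly_mapping_sum_single[of p], rule add_gen_sum[OF finite_keys])
      fix k
      have "Poly_Mapping.single k (Poly_Mapping.lookup p k) =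
        const_poly (Poly_Mapping.lookup p k) * Poly_Mapping.single k 1"
        by (simp add: mult_single)
      thus "Poly_Mapping.single k (Poly_Mapping.lookup p k) \<in> {c * z |c z. c \<in> range const_poly \<and>
        (\<forall>a. z * a = a * z)}"
        using single_one_central[of k] by blast
    qed
    show "finite I" "w0 \<in> permutations_of_set I" "const_poly (\<gamma> w0) = 1" using I by simp_all
    show "const_poly (\<gamma> w) * b - b * const_poly (\<gamma> w) \<in> M" for w b
    proof -
      have "const_poly (\<gamma> w) * b - b * const_poly (\<gamma> w) \<in> poly_ideal Q"
        using \<gamma>_central0 Q(2) by (auto simp: poly_ideal_def lookup_minus lookup_const_mult
          lookup_mult_const)
      thus ?thesis using M(2) by blast
    qed
    show "mlin (\<lambda>w. const_poly (\<gamma> w)) I x * v \<in> M" if x: "\<And>i. x i \<in> range const_poly" for x v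
    proof -
      have "\<forall>i. \<exists>a. x i = const_poly a" using x by blast
      then obtain f where "\<forall>i. x i = const_poly (f i)" using choice[of "\<lambda>i a. x i = const_poly a"]
        by blast
      hence "x = (\<lambda>i. const_poly (f i))" by (simp add: fun_eq_iff)
      thus ?thesis using cQ[OF identity0] by (simp add: const_poly_mlin)
    qed
    show "const_poly (\<rho> g) \<in> range const_poly" for g by blast
    show "const_poly (\<rho> (g \<otimes> h)) * v - const_poly (\<rho> g) * (const_poly (\<rho> h) * v) \<in> M"
      if "g \<in> carrier G" "h \<in> carrier G" for g h v
      using cQ[OF \<rho>_mult0[OF that], of v]
        by (simp add: single_diff const_poly_mult left_diff_distrib mult.assoc)
    show "const_poly (\<rho> \<one>) * v - v \<in> M" for v
      using cQ[OF \<rho>_one0, of v] by (simp add: single_diff left_diff_distrib)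
  qed
  have "\<exists>T. finite T \<and> (\<forall>u. \<exists>t\<in>T. u - t \<in> M)"
  proof (rule finite_quotient[of "const_poly ` B \<union> {Poly_Mapping.single 1 1}"])
    show "finite (const_poly ` B \<union> {Poly_Mapping.single 1 1})" using B by simp
    fix S :: "(nat \<Rightarrow>\<^sub>0 'a) set"
    assume S: "subring_set S" "const_poly ` B \<union> {Poly_Mapping.single 1 1} \<subseteq> S" "{b. \<forall>v. b * v \<in> M} \<subseteq>
      S"
    have Sa: "additive_subgroup_set S" and S1: "1 \<in> S" and Sm: "\<And>a b. a \<in> S \<Longrightarrow> b \<in> S \<Longrightarrow> a * b \<in> S"
      using S(1) by (auto simp: subring_set_def)
    have "{a. const_poly a \<in> S} = UNIV"
    proof (rule B_gen)
      show "subring_set {a. const_poly a \<in> S}"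
        unfolding subring_set_def additive_subgroup_set_def
        using Sm S1 asub_zero[OF Sa] asub_add[OF Sa] asub_neg[OF Sa]
        by (auto simp: single_add const_poly_mult single_uminus)
      show "B \<subseteq> {a. const_poly a \<in> S}" using S(2) by auto
      show "Q0 \<subseteq> {a. const_poly a \<in> S}" using S(3) cQ by auto
    qed
    hence c: "const_poly a \<in> S" for a by blast
    have t: "Poly_Mapping.single k 1 \<in> S" for k
    proof (induct k)
      case 0 show ?case using S1 by simp
    next
      case (Suc k)
      have "Poly_Mapping.single 1 1 * Poly_Mapping.single k 1 \<in> S" using Suc S(2) by (intro Sm) auto
      thus ?case by (simp add: mult_single)
    qed
    have "p \<in> S" for p
    proof (subst poly_mapping_sum_single[of p], rule asub_sum[OF Sa])
      fix k
      have "const_poly (Poly_Mapping.lookup p k) * Poly_Mapping.single k 1 \<in> S" by (rule Sm[OF c t])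
      thus "Poly_Mapping.single k (Poly_Mapping.lookup p k) \<in> S" by (simp add: mult_single)
    qed
    thus "S = UNIV" by blast
  qed
  then obtain T where T: "finite T" "\<And>u. \<exists>t\<in>T. u - t \<in> M" by blast
  let ?K = "ker_on (carrier G) M UNIV"
  have "?K \<lhd> G\<lparr>carrier := carrier G\<rparr>"
  proof (rule ker_on_normal[OF subgroup_self])
    show "E_subspace M" by (simp add: E_subspace_def Ma ME)
    show "E_subspace UNIV" by (simp add: E_subspace_def additive_subgroup_set_def)
    show "stable (carrier G) M" "stable (carrier G) UNIV" by (auto simp: stable_def Ml)
  qed simp
  hence Kn: "?K \<lhd> G" by simp
  interpret K: normal ?K G by (rule Kn)
  define rep where "rep u = (SOME t. t \<in> T \<and> u - t \<in> M)" for u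
  have rep: "rep u \<in> T" "u - rep u \<in> M" for u
    using someI_ex[of "\<lambda>t. t \<in> T \<and> u - t \<in> M"] T(2)[of u] unfolding rep_def by blast+
  \<comment> \<open>\<open>f g\<close> is the table of the action of \<open>g\<close> on
    representatives. There are finitely many tables, and equal tables mean equal cosets of the
    kernel.\<close>
  define f where "f g = (\<lambda>t\<in>T. rep (const_poly (\<rho> g) * t))" for g
  have feq: "?K #> g = ?K #> g'" if g: "g \<in> carrier G" "g' \<in> carrier G" "f g = f g'" for g g'
  proof -
    have 1: "const_poly (\<rho> g) * u - const_poly (\<rho> g') * u \<in> M" for u
    proof -
      obtain t where t: "t \<in> T" "u - t \<in> M" using T(2) by blast
      have r: "rep (const_poly (\<rho> g) * t) = rep (const_poly (\<rho> g') * t)"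
        using fun_cong[OF g(3), of t] t(1) by (simp add: f_def)
      have d: "const_poly (\<rho> k) * u - rep (const_poly (\<rho> k) * t) \<in> M" for k
        by (rule M_trans[OF Ml[OF t(2), of "const_poly (\<rho> k)", unfolded right_diff_distrib] rep(2)])
      show ?thesis by (rule M_trans[OF d[of g, unfolded r] M_sym[OF d]])
    qed
    have "const_poly (\<rho> (g \<otimes> inv g')) * v - v \<in> M" for v
    proof -
      let ?u = "const_poly (\<rho> (inv g')) * v"
      have 2: "const_poly (\<rho> (g \<otimes> inv g')) * v - const_poly (\<rho> g) * ?u \<in> M"
        using g by (intro \<rho>_mult) auto
      have 3: "const_poly (\<rho> g') * ?u - v \<in> M" using inv_act[of "inv g'" v] g by simp
      show ?thesis by (rule M_trans[OF 2 M_trans[OF 1 3]])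
    qed
    moreover have gc: "g \<otimes> inv g' \<in> carrier G" using g by simp
    ultimately have "g \<otimes> inv g' \<in> ?K" unfolding ker_on_def by blast
    hence "?K #> (g \<otimes> inv g') = ?K" by (rule coset_join2[OF gc K.subgroup_axioms])
    thus ?thesis by (rule coset_mult_inv1[OF _ g(1,2) K.subset])
  qed
  have "finite (rcosets ?K)"
  proof -
    have "f ` carrier G \<subseteq> T \<rightarrow>\<^sub>E T" using rep(1) by (auto simp: f_def)
    hence fin: "finite (f ` carrier G)" using finite_PiE[OF T(1), of "\<lambda>_. T"] T(1) finite_subset
      by blast
    define k where "k p = ?K #> (SOME g. g \<in> carrier G \<and> f g = p)" for p
    have "?K #> g = k (f g)" if g: "g \<in> carrier G" for g
    proof -
      define g' where "g' = (SOME g'. g' \<in> carrier G \<and> f g' = f g)"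
      have "g' \<in> carrier G \<and> f g' = f g" unfolding g'_def by (rule someI[of _ g]) (use g in simp)
      hence "?K #> g = ?K #> g'" using feq[OF g, of g'] by simp
      thus ?thesis unfolding k_def g'_def .
    qed
    hence "rcosets ?K \<subseteq> k ` (f ` carrier G)" unfolding RCOSETS_def by auto
    thus ?thesis using fin finite_subset by blast
  qed
  then obtain n where "lower_central G n \<subseteq> ?K" using engel_finite_index[OF engel Kn] by blast
  hence "h \<in> ?K" using derived_trivial h by blast
  thus ?thesis unfolding ker_on_def by blast
qed

text \<open>Each element of the left ideal generated by \<open>\<rho> h - 1\<close> annihilates the
  simple modules that the Rabinowitsch trick provides, so it is nilpotent modulo \<open>Q\<close>; a
  nil left ideal lies in \<open>Q\<close>.\<close>

lemma derived_in_prime: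
  assumes Q: "prime_ideal Q" "Q0 \<subseteq> Q" and h: "h \<in> (derived G ^^ (2 * card I)) (carrier G)"
  shows "\<rho> h - 1 \<in> Q"
proof -
  have Q2: "two_sided Q" using Q by (simp add: prime_ideal_def)
  note Qa = two_sided_asub[OF Q2]
  define L where "L = range (\<lambda>r. r * (\<rho> h - 1))"
  have "L \<subseteq> Q"
  proof (rule nil_left_ideal_in_prime[OF Q(1) I(1) _ _ I(2), where \<gamma> = \<gamma>])
    show "left_ideal L" unfolding left_ideal_def additive_subgroup_set_def L_def
      by (auto simp flip: mult.assoc distrib_right mult_minus_left intro: range_eqI[of _ _ 0])
    show "\<exists>n. a ^ n \<in> Q" if a: "a \<in> L" for a
    proof (rule ccontr)
      assume "\<nexists>n. a ^ n \<in> Q"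
      then obtain M where M: "left_ideal M" "poly_ideal Q \<subseteq> M" "1 \<notin> M"
        "\<And>N. left_ideal N \<Longrightarrow> M \<subseteq> N \<Longrightarrow> N = M \<or> N = UNIV" "\<exists>v. const_poly a * v \<notin> M"
        using rabinowitsch[OF Q2, of a] by blast
      obtain r where r: "a = r * (\<rho> h - 1)" using a by (auto simp: L_def)
      have "const_poly a * v \<in> M" for v
      proof -
        have "const_poly r * (const_poly (\<rho> h) * v - v) \<in> M"
          by (rule left_ideal_mult[OF M(1) derived_acts_trivially[OF Q2 Q(2) M(1-4) h]])
        moreover have "const_poly a * v = const_poly r * (const_poly (\<rho> h) * v - v)"
          unfolding r const_poly_mult by (simp add: single_diff left_diff_distrib mult.assoc)
        ultimately show ?thesis by simp
      qed
      thus False using M(5) by blast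
    qed
    show "\<gamma> w0 = 1" by (rule I(3))
    show "\<gamma> w * b - b * \<gamma> w \<in> Q" for w b using \<gamma>_central0 Q(2) by blast
    show "y * mlin \<gamma> I x \<in> Q" for x y using two_sided_lmult[OF Q2] identity0 Q(2) by blast
  qed
  moreover have "1 * (\<rho> h - 1) \<in> L" unfolding L_def by blast
  ultimately show ?thesis by auto
qed

definition kernel_mod :: "'a set \<Rightarrow> 'g set" where
  "kernel_mod Q = {g \<in> carrier G. \<rho> g - 1 \<in> Q}"

lemma kernel_mod_normal:
  assumes Q: "two_sided Q" "Q0 \<subseteq> Q" shows "kernel_mod Q \<lhd> G"
proof -
  note Qa = two_sided_asub[OF Q(1)] and Ql = two_sided_lmult[OF Q(1)]
    and Qr = two_sided_rmult[OF Q(1)]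
  have m: "\<rho> (g \<otimes> h) - \<rho> g * \<rho> h \<in> Q" if "g \<in> carrier G" "h \<in> carrier G" for g h
    using \<rho>_mult0[OF that] Q(2) by blast
  have one: "\<rho> \<one> - 1 \<in> Q" using \<rho>_one0 Q(2) by blast
  have inv: "\<rho> g * \<rho> (inv g) - 1 \<in> Q" if g: "g \<in> carrier G" for g
    using asub_trans[OF Qa asub_sym[OF Qa m[of g "inv g"]], of 1] g one by simp
  have km: "g \<otimes> h \<in> kernel_mod Q" if gh: "g \<in> kernel_mod Q" "h \<in> kernel_mod Q" for g h
  proof -
    have c: "g \<in> carrier G" "h \<in> carrier G" "\<rho> g - 1 \<in> Q" "\<rho> h - 1 \<in> Q" using gh
      by (auto simp: kernel_mod_def)
    have "(\<rho> g - 1) * \<rho> h \<in> Q" by (rule Qr[OF c(3)])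
    hence 1: "\<rho> g * \<rho> h - \<rho> h \<in> Q" by (simp add: left_diff_distrib)
    have "\<rho> (g \<otimes> h) - 1 \<in> Q" by (rule asub_trans[OF Qa m[OF c(1,2)] asub_trans[OF Qa 1 c(4)]])
    thus ?thesis using c by (simp add: kernel_mod_def)
  qed
  have kc: "g \<otimes> k \<otimes> inv g \<in> kernel_mod Q" if g: "g \<in> carrier G" and k: "k \<in> kernel_mod Q" for g k
  proof -
    have kk: "k \<in> carrier G" "\<rho> k - 1 \<in> Q" using k by (auto simp: kernel_mod_def)
    have 1: "\<rho> (g \<otimes> k \<otimes> inv g) - \<rho> (g \<otimes> k) * \<rho> (inv g) \<in> Q" using g kk by (intro m) auto
    have "(\<rho> (g \<otimes> k) - \<rho> g * \<rho> k) * \<rho> (inv g) \<in> Q" by (rule Qr[OF m[OF g kk(1)]])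
    hence 2: "\<rho> (g \<otimes> k) * \<rho> (inv g) - \<rho> g * \<rho> k * \<rho> (inv g) \<in> Q" by (simp add: left_diff_distrib)
    have "\<rho> g * (\<rho> k - 1) * \<rho> (inv g) \<in> Q" by (rule Qr[OF Ql[OF kk(2)]])
    hence 3: "\<rho> g * \<rho> k * \<rho> (inv g) - \<rho> g * \<rho> (inv g) \<in> Q" by (simp add: algebra_simps)
    have "\<rho> (g \<otimes> k \<otimes> inv g) - 1 \<in> Q"
      by (rule asub_trans[OF Qa 1 asub_trans[OF Qa 2 asub_trans[OF Qa 3 inv[OF g]]]])
    thus ?thesis using g kk by (simp add: kernel_mod_def)
  qed
  have ki: "inv k \<in> kernel_mod Q" if k: "k \<in> kernel_mod Q" for k
  proof -
    have kk: "k \<in> carrier G" "\<rho> k - 1 \<in> Q" using k by (auto simp: kernel_mod_def)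
    have "(\<rho> k - 1) * \<rho> (inv k) \<in> Q" by (rule Qr[OF kk(2)])
    hence "\<rho> k * \<rho> (inv k) - \<rho> (inv k) \<in> Q" by (simp add: left_diff_distrib)
    from asub_trans[OF Qa asub_sym[OF Qa this] inv[OF kk(1)]]
    show ?thesis using kk by (simp add: kernel_mod_def)
  qed
  show ?thesis
  proof (rule normal_invI)
    show "subgroup (kernel_mod Q) G"
    proof (rule subgroupI)
      show "kernel_mod Q \<subseteq> carrier G" by (auto simp: kernel_mod_def)
      have "\<one> \<in> kernel_mod Q" using one by (simp add: kernel_mod_def)
      thus "kernel_mod Q \<noteq> {}" by blast
    qed (use ki km in auto)
  qed (rule kc)
qed

section \<open>Maximal ideals of non-nilpotency are prime\<close>

theorem nilpotent_mod: "\<exists>n. lower_central G n \<subseteq> kernel_mod Q0"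
proof (rule ccontr)
  assume neg: "\<nexists>n. lower_central G n \<subseteq> kernel_mod Q0"
  define A where "A = {Q. two_sided Q \<and> Q0 \<subseteq> Q \<and> (\<forall>n. \<not> lower_central G n \<subseteq> kernel_mod Q)}"
  have "\<exists>Q\<in>A. \<forall>P\<in>A. Q \<subseteq> P \<longrightarrow> P = Q"
  proof (rule subset_Zorn_nonempty)
    show "A \<noteq> {}" using neg Q0 by (auto simp: A_def)
    fix C assume C: "C \<noteq> {}" "subset.chain A C"
    have CA: "\<And>Q. Q \<in> C \<Longrightarrow> two_sided Q" "\<And>Q. Q \<in> C \<Longrightarrow> Q0 \<subseteq> Q" "\<And>Q n. Q \<in> C \<Longrightarrow>
      \<not> lower_central G n \<subseteq> kernel_mod Q"
      using C(2) by (auto simp: subset.chain_def A_def)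
    have "a + b \<in> \<Union>C" if ab: "a \<in> \<Union>C" "b \<in> \<Union>C" for a b
    proof -
      obtain N N' where N: "N \<in> C" "a \<in> N" "N' \<in> C" "b \<in> N'" using ab by blast
      hence "N \<subseteq> N' \<or> N' \<subseteq> N" using C(2) by (auto simp: subset.chain_def)
      thus ?thesis using N asub_add[OF two_sided_asub[OF CA(1)]] by blast
    qed
    moreover have "0 \<in> \<Union>C" using C(1) CA(1) asub_zero[OF two_sided_asub] by blast
    moreover have "- a \<in> \<Union>C" if "a \<in> \<Union>C" for a using that CA(1) asub_neg[OF two_sided_asub] by blast
    moreover have "r * a \<in> \<Union>C" if "a \<in> \<Union>C" for r a using that CA(1) two_sided_lmult by blast
    moreover have "a * r \<in> \<Union>C" if "a \<in> \<Union>C" for r a using that CA(1) two_sided_rmult by blast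
    ultimately have U: "two_sided (\<Union>C)" unfolding two_sided_def left_ideal_def
      additive_subgroup_set_def by blast
    have QU: "Q0 \<subseteq> \<Union>C" using C(1) CA(2) by blast
    \<comment> \<open>Whether a lower central term is trivial modulo an ideal is decided by the
      finitely many elements \<open>\<rho> g - 1\<close> for commutators \<open>g\<close> of
      generators, and these lie in a single member of the chain.\<close>
    have "\<not> lower_central G n \<subseteq> kernel_mod (\<Union>C)" for n
    proof
      assume "lower_central G n \<subseteq> kernel_mod (\<Union>C)"
      hence "(\<lambda>g. \<rho> g - 1) ` gen_comms gens n \<subseteq> \<Union>C"
        using gen_comms_lower_central[OF gens(2), of n] by (auto simp: kernel_mod_def)
      then obtain Q where Q: "Q \<in> C" "(\<lambda>g. \<rho> g - 1) ` gen_comms gens n \<subseteq> Q"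
        using finite_subset_Union_chain[OF finite_imageI[OF gen_comms_finite[OF gens(1)]] _ C]
          by blast
      hence "gen_comms gens n \<subseteq> kernel_mod Q"
        using gen_comms_lower_central[OF gens(2), of n] lower_central_carrier[of n]
          by (auto simp: kernel_mod_def)
      hence "lower_central G n \<subseteq> kernel_mod Q"
        by (rule lower_central_subset_if_gen_comms[OF gens(2,3) kernel_mod_normal[OF CA(1,2)[OF
          Q(1)]]])
      thus False using CA(3)[OF Q(1)] by blast
    qed
    thus "\<Union>C \<in> A" using U QU by (simp add: A_def)
  qed
  then obtain Q where QA: "Q \<in> A" and Qmax: "\<And>P. P \<in> A \<Longrightarrow> Q \<subseteq> P \<Longrightarrow> P = Q" by blast
  have Q: "two_sided Q" "Q0 \<subseteq> Q" and Qneg: "\<And>n. \<not> lower_central G n \<subseteq> kernel_mod Q" using QA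
    by (auto simp: A_def)
  note Qa = two_sided_asub[OF Q(1)] and Ql = two_sided_lmult[OF Q(1)]
    and Qr = two_sided_rmult[OF Q(1)]
  \<comment> \<open>The sum of \<open>Q\<close> and the two-sided ideal generated by
    \<open>a\<close>.\<close>
  define ideal_with where "ideal_with a = {q. \<exists>S. q - S \<in> Q \<and> S \<in> add_gen {r * a * s | r s. True}}"
    for a
  have add_gen_plus: "x + y \<in> add_gen Z" if "x \<in> add_gen Z" "y \<in> add_gen Z" for x y
    and Z :: "'a set"
    using that(2,1) by (induct y) (auto simp flip: add.assoc intro: add_gen_add)
  have add_gen_map: "f x \<in> add_gen Z" if "x \<in> add_gen Z" "\<And>x y. f (x + y) = f x + f y" "f 0 = 0"
    "\<And>s. s \<in> Z \<Longrightarrow> f s \<in> Z"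
    for x f and Z :: "'a set"
    using that(1) by (induct x) (auto simp: that(2,3) intro: add_gen_zero add_gen_add that(4))
  have IW: "two_sided (ideal_with a) \<and> Q \<subseteq> ideal_with a \<and> a \<in> ideal_with a" for a
  proof -
    let ?X = "{r * a * s | r s. True}"
    have mem: "q \<in> ideal_with a" if "q - S \<in> Q" "S \<in> add_gen ?X" for q S using that
      by (auto simp: ideal_with_def)
    have f: "- S \<in> add_gen ?X" "t * S \<in> add_gen ?X" "S * t \<in> add_gen ?X" if S: "S \<in> add_gen ?X"
      for S t
    proof -
      show "- S \<in> add_gen ?X"
        by (rule add_gen_map[OF S]) (auto, metis mult_minus_left)
      show "t * S \<in> add_gen ?X"
        by (rule add_gen_map[OF S]) (auto simp: distrib_left, metis mult.assoc)
      show "S * t \<in> add_gen ?X"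
        by (rule add_gen_map[OF S]) (auto simp: distrib_right, metis mult.assoc)
    qed
    have "two_sided (ideal_with a)" unfolding two_sided_def left_ideal_def additive_subgroup_set_def
    proof (intro conjI ballI allI)
      show "0 \<in> ideal_with a" by (rule mem[of _ 0]) (simp_all add: asub_zero[OF Qa] add_gen_zero)
      fix x y r assume "x \<in> ideal_with a"
      then obtain S where S: "x - S \<in> Q" "S \<in> add_gen ?X" by (auto simp: ideal_with_def)
      have "- x - - S \<in> Q" using asub_neg[OF Qa S(1)] by simp
      thus "- x \<in> ideal_with a" by (rule mem[OF _ f(1)[OF S(2)]])
      have "r * x - r * S \<in> Q" using Ql[OF S(1), of r] by (simp only: right_diff_distrib)
      thus "r * x \<in> ideal_with a" by (rule mem[OF _ f(2)[OF S(2)]])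
      have "x * r - S * r \<in> Q" using Qr[OF S(1), of r] by (simp only: left_diff_distrib)
      thus "x * r \<in> ideal_with a" by (rule mem[OF _ f(3)[OF S(2)]])
      assume "y \<in> ideal_with a"
      then obtain S' where S': "y - S' \<in> Q" "S' \<in> add_gen ?X" by (auto simp: ideal_with_def)
      have "(x - S) + (y - S') \<in> Q" by (rule asub_add[OF Qa S(1) S'(1)])
      thus "x + y \<in> ideal_with a" by (intro mem[OF _ add_gen_plus[OF S(2) S'(2)]]) (simp add:
        algebra_simps)
    qed
    moreover have "q \<in> ideal_with a" if "q \<in> Q" for q
      by (rule mem[of _ 0]) (use that in \<open>simp_all add: add_gen_zero\<close>)
    moreover have "a \<in> ideal_with a"
    proof (rule mem[of _ "0 + a"])
      have "a \<in> ?X" by (auto intro!: exI[of _ 1])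
      thus "0 + a \<in> add_gen ?X" by (intro add_gen_add add_gen_zero)
    qed (simp add: asub_zero[OF Qa])
    ultimately show ?thesis by blast
  qed
  have "prime_ideal Q" unfolding prime_ideal_def
  proof (intro conjI allI impI)
    show "two_sided Q" by (rule Q(1))
    fix a b assume aRb: "\<forall>r. a * r * b \<in> Q"
    show "a \<in> Q \<or> b \<in> Q"
    proof (rule ccontr)
      assume "\<not> (a \<in> Q \<or> b \<in> Q)"
      hence nab: "a \<notin> Q" "b \<notin> Q" by auto
      have good: "\<exists>n. lower_central G n \<subseteq> kernel_mod (ideal_with c)" if "c \<notin> Q" for c
        using Qmax[of "ideal_with c"] IW[of c] that Q(2) by (auto simp: A_def)
      obtain n m where nm: "lower_central G n \<subseteq> kernel_mod (ideal_with a)" "lower_central G m \<subseteq>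
        kernel_mod (ideal_with b)"
        using good nab by blast
      have prod: "x * y \<in> Q" if x: "x \<in> ideal_with a" and y: "y \<in> ideal_with b" for x y
      proof -
        obtain S S' where S: "x - S \<in> Q" "S \<in> add_gen {r * a * s | r s. True}"
          "y - S' \<in> Q" "S' \<in> add_gen {r * b * s | r s. True}" using x y
            by (auto simp: ideal_with_def)
        have 1: "r * a * s * S' \<in> Q" for r s
          using S(4)
        proof (induct S')
          case add_gen_zero thus ?case using asub_zero[OF Qa] by simp
        next
          case (add_gen_add u v)
          then obtain r' s' where "v = r' * b * s'" by blast
          moreover have "r * (a * (s * r') * b) * s' \<in> Q" using aRb Ql Qr by blast
          ultimately have "r * a * s * v \<in> Q" by (simp add: mult.assoc)
          thus ?case using asub_add[OF Qa add_gen_add(2)] by (simp add: distrib_left)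
        qed
        have "S * S' \<in> Q" using S(2)
        proof (induct S)
          case add_gen_zero thus ?case using asub_zero[OF Qa] by simp
        next
          case (add_gen_add u v)
          then obtain r s where "v = r * a * s" by blast
          thus ?case using asub_add[OF Qa add_gen_add(2) 1[of r s]] by (simp add: distrib_right)
        qed
        moreover have "x * y - S * S' = (x - S) * y + S * (y - S')" by (simp add: algebra_simps)
        moreover have "(x - S) * y + S * (y - S') \<in> Q"
          by (intro asub_add[OF Qa] Qr[OF S(1)] Ql[OF S(3)])
        ultimately show ?thesis using asub_iff[OF Qa] by metis
      qed
      \<comment> \<open>On \<open>BB\<close> the products of \<open>\<rho> g - 1\<close> and
        \<open>\<rho> h - 1\<close> lie in \<open>Q\<close> in either order, so \<open>BB\<close> is
        abelian modulo the kernel of \<open>Q\<close>, while some lower central term lies in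
        \<open>BB\<close>.\<close>
      define BB where "BB = kernel_mod (ideal_with a) \<inter> kernel_mod (ideal_with b)"
      have Bn: "BB \<lhd> G" unfolding BB_def
        using IW Q(2) by (intro normal_subgroup_intersect kernel_mod_normal) blast+
      have KB: "kernel_mod Q \<subseteq> BB" using IW[of a] IW[of b] by (auto simp: BB_def kernel_mod_def)
      have dec: "lower_central G (n + k) \<subseteq> lower_central G n" for n k
        by (induct k) (use lower_central_Suc_subset in auto)
      have nB: "lower_central G (n + m) \<subseteq> BB"
        using nm dec[of n m] dec[of m n] by (auto simp: BB_def add.commute)
      have ab: "comm G g h \<in> kernel_mod Q" if gh: "g \<in> BB" "h \<in> BB" for g h
      proof -
        have c: "g \<in> carrier G" "h \<in> carrier G" using gh by (auto simp: BB_def kernel_mod_def)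
        have 1: "(\<rho> g - 1) * (\<rho> h - 1) \<in> Q" "(\<rho> h - 1) * (\<rho> g - 1) \<in> Q"
          using prod gh by (auto simp: BB_def kernel_mod_def)
        have "\<rho> g * \<rho> h - \<rho> h * \<rho> g = (\<rho> g - 1) * (\<rho> h - 1) - (\<rho> h - 1) * (\<rho> g - 1)"
          by (simp add: algebra_simps)
        hence 2: "\<rho> g * \<rho> h - \<rho> h * \<rho> g \<in> Q" using asub_diff[OF Qa 1] by simp
        have m: "\<rho> (g \<otimes> h) - \<rho> g * \<rho> h \<in> Q" if "g \<in> carrier G" "h \<in> carrier G" for g h
          using \<rho>_mult0[OF that] Q(2) by blast
        have 3: "\<rho> (g \<otimes> h) - \<rho> (h \<otimes> g) \<in> Q"
          by (rule asub_trans[OF Qa m[OF c] asub_trans[OF Qa 2 asub_sym[OF Qa m[OF c(2,1)]]]])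
        let ?k = "inv (h \<otimes> g)"
        have kc: "?k \<in> carrier G" using c by simp
        have "\<rho> ?k * (\<rho> (g \<otimes> h) - \<rho> (h \<otimes> g)) \<in> Q" by (rule Ql[OF 3])
        hence 4: "\<rho> ?k * \<rho> (g \<otimes> h) - \<rho> ?k * \<rho> (h \<otimes> g) \<in> Q" by (simp add: right_diff_distrib)
        have 5: "\<rho> (?k \<otimes> (g \<otimes> h)) - \<rho> ?k * \<rho> (g \<otimes> h) \<in> Q" using kc c by (intro m) auto
        have "\<rho> (?k \<otimes> (h \<otimes> g)) - \<rho> ?k * \<rho> (h \<otimes> g) \<in> Q" using kc c by (intro m) auto
        hence 6: "\<rho> ?k * \<rho> (h \<otimes> g) - \<rho> \<one> \<in> Q" using asub_sym[OF Qa] c by simp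
        have 7: "\<rho> \<one> - 1 \<in> Q" using \<rho>_one0 Q(2) by blast
        have "\<rho> (?k \<otimes> (g \<otimes> h)) - 1 \<in> Q"
          by (rule asub_trans[OF Qa 5 asub_trans[OF Qa 4 asub_trans[OF Qa 6 7]]])
        moreover have "?k \<otimes> (g \<otimes> h) = comm G g h" using c by (simp add: comm_def free_simps)
        ultimately show ?thesis using c by (simp add: kernel_mod_def)
      qed
      have "\<exists>k. lower_central G k \<subseteq> kernel_mod Q"
        by (rule engel_abelian_by_nilpotent[OF engel gens kernel_mod_normal[OF Q] Bn KB ab nB])
      thus False using Qneg by blast
    qed
  qed
  hence solv: "(derived G ^^ (2 * card I)) (carrier G) \<subseteq> kernel_mod Q"
    using derived_in_prime[OF _ Q(2)] exp_of_derived_in_carrier[OF order_refl, of "2 * card I"]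
    by (auto simp: kernel_mod_def)
  have "\<exists>m. lower_central G m \<subseteq> kernel_mod Q"
    by (rule engel_solvable[OF engel gens kernel_mod_normal[OF Q] solv])
  thus False using Qneg by blast
qed

end

section \<open>Linearization\<close>

text \<open>The list \<tau> records which summand is chosen at each place of \<open>w\<close>; the
  letters of \<open>w\<close> are recovered as \<open>map a \<tau>\<close>.\<close>

lemma prod_list_sum_expand:
  fixes y :: "nat \<Rightarrow> 'a::ring_1"
  assumes "finite S"
  shows "prod_list (map (\<lambda>k. \<Sum>j\<in>{j \<in> S. a j = k}. y j) w) =
    (\<Sum>\<tau>\<in>{\<tau>. set \<tau> \<subseteq> S \<and> map a \<tau> = w}. prod_list (map y \<tau>))"
proof (induct w)
  case Nil
  have "{\<tau>. set \<tau> \<subseteq> S \<and> map a \<tau> = []} = {[]}" by auto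
  thus ?case by simp
next
  case (Cons k w)
  let ?T = "{\<tau>. set \<tau> \<subseteq> S \<and> map a \<tau> = w}"
  let ?J = "{j \<in> S. a j = k}"
  have "{\<tau>. set \<tau> \<subseteq> S \<and> map a \<tau> = k # w} = (\<lambda>(j, \<tau>). j # \<tau>) ` (?J \<times> ?T)"
    by (auto simp: map_eq_Cons_conv image_iff)
  hence "(\<Sum>\<tau>\<in>{\<tau>. set \<tau> \<subseteq> S \<and> map a \<tau> = k # w}. prod_list (map y \<tau>)) =
      (\<Sum>(j, \<tau>)\<in>?J \<times> ?T. y j * prod_list (map y \<tau>))"
    by (simp add: sum.reindex inj_on_def case_prod_unfold)
  also have "\<dots> = (\<Sum>j\<in>?J. y j) * (\<Sum>\<tau>\<in>?T. prod_list (map y \<tau>))"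
    by (simp add: sum_product sum.cartesian_product)
  finally show ?case using Cons by simp
qed

lemma alternating_sum_Pow:
  "finite F \<Longrightarrow> (\<Sum>R\<in>Pow F. (- 1 :: 'a::ring_1) ^ card R) = (if F = {} then 1 else 0)"
proof (induct F rule: finite_induct)
  case (insert x F)
  have inj: "inj_on (insert x) (Pow F)" using insert(2) by (auto simp: inj_on_def)
  have d: "Pow F \<inter> insert x ` Pow F = {}" using insert(2) by auto
  have "(\<Sum>R\<in>insert x ` Pow F. (- 1 :: 'a) ^ card R) = (\<Sum>R\<in>Pow F. (- 1) ^ card (insert x R))"
    by (simp add: sum.reindex[OF inj])
  also have "\<dots> = (\<Sum>R\<in>Pow F. - ((- 1) ^ card R))"
  proof (rule sum.cong[OF refl])
    fix R assume "R \<in> Pow F"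
    hence "x \<notin> R" "finite R" using insert finite_subset by auto
    thus "(- 1 :: 'a) ^ card (insert x R) = - ((- 1) ^ card R)" by simp
  qed
  finally have "(\<Sum>R\<in>insert x ` Pow F. (- 1 :: 'a) ^ card R) = - (\<Sum>R\<in>Pow F. (- 1) ^ card R)"
    by (simp add: sum_negf)
  thus ?case unfolding Pow_insert using insert(1) d by (simp add: sum.union_disjoint)
qed simp

text \<open>Inclusion-exclusion over the set \<open>R\<close> of omitted variables extracts the part that is
  multilinear in the new variables \<open>y j\<close>, where \<open>y j\<close> is a summand substituted for the old
  variable \<open>a j\<close>.\<close>

lemma multilinear_part:
  fixes y :: "nat \<Rightarrow> 'a::ring_1"
  assumes len: "length w \<le> n"
  shows "(\<Sum>R\<in>Pow {..<n}. (- 1) ^ card R * prod_list (map (\<lambda>k. \<Sum>j\<in>{j \<in> {..<n} - R. a j =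
    k}. y j) w)) =
    (\<Sum>\<sigma>\<in>permutations_of_set {..<n}. if map a \<sigma> = w then prod_list (map y \<sigma>) else 0)"
proof -
  let ?T = "{\<tau>. set \<tau> \<subseteq> {..<n} \<and> map a \<tau> = w}"
  have "?T \<subseteq> {\<tau>. set \<tau> \<subseteq> {..<n} \<and> length \<tau> = length w}" by auto
  hence fin: "finite ?T" using finite_lists_length_eq[of "{..<n}" "length w"] finite_subset by blast
  let ?p = "\<lambda>\<tau>. prod_list (map y \<tau>)"
  have "(\<Sum>R\<in>Pow {..<n}. (- 1) ^ card R * prod_list (map (\<lambda>k. \<Sum>j\<in>{j \<in> {..<n} - R. a j = k}. y j) w))
    = (\<Sum>R\<in>Pow {..<n}. \<Sum>\<tau>\<in>{\<tau> \<in> ?T. set \<tau> \<inter> R = {}}. (- 1) ^ card R * ?p \<tau>)"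
  proof (rule sum.cong[OF refl])
    fix R
    have "{\<tau>. set \<tau> \<subseteq> {..<n} - R \<and> map a \<tau> = w} = {\<tau> \<in> ?T. set \<tau> \<inter> R = {}}" by auto
    thus "(- 1) ^ card R * prod_list (map (\<lambda>k. \<Sum>j\<in>{j \<in> {..<n} - R. a j = k}. y j) w) =
        (\<Sum>\<tau>\<in>{\<tau> \<in> ?T. set \<tau> \<inter> R = {}}. (- 1) ^ card R * ?p \<tau>)"
      by (simp only: prod_list_sum_expand finite_Diff finite_lessThan sum_distrib_left)
  qed
  also have "\<dots> = (\<Sum>\<tau>\<in>?T. \<Sum>R\<in>{R \<in> Pow {..<n}. set \<tau> \<inter> R = {}}. (- 1) ^ card R * ?p \<tau>)"
    by (rule sum.swap_restrict[OF _ fin]) simp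
  also have "\<dots> = (\<Sum>\<tau>\<in>?T. if set \<tau> = {..<n} then ?p \<tau> else 0)"
  proof (rule sum.cong[OF refl])
    fix \<tau> assume t: "\<tau> \<in> ?T"
    have "{R \<in> Pow {..<n}. set \<tau> \<inter> R = {}} = Pow ({..<n} - set \<tau>)" by auto
    hence "(\<Sum>R\<in>{R \<in> Pow {..<n}. set \<tau> \<inter> R = {}}. (- 1) ^ card R * ?p \<tau>)
      = (\<Sum>R\<in>Pow ({..<n} - set \<tau>). (- 1) ^ card R) * ?p \<tau>" by (simp only: sum_distrib_right)
    also have "\<dots> = (if set \<tau> = {..<n} then ?p \<tau> else 0)"
      using t by (subst alternating_sum_Pow) auto
    finally show "(\<Sum>R\<in>{R \<in> Pow {..<n}. set \<tau> \<inter> R = {}}. (- 1) ^ card R * ?p \<tau>) = (if set \<tau> =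
      {..<n} then ?p \<tau> else 0)" .
  qed
  also have "\<dots> = (\<Sum>\<tau>\<in>{\<tau> \<in> ?T. set \<tau> = {..<n}}. ?p \<tau>)"
    by (rule sum.inter_filter[OF fin, symmetric])
  also have "{\<tau> \<in> ?T. set \<tau> = {..<n}} = {\<sigma> \<in> permutations_of_set {..<n}. map a \<sigma> = w}"
  proof (intro subset_antisym subsetI)
    fix \<tau> assume t: "\<tau> \<in> {\<tau> \<in> ?T. set \<tau> = {..<n}}"
    hence "length \<tau> \<le> n" using len length_map[of a \<tau>] by auto
    moreover have "card (set \<tau>) = n" using t by simp
    ultimately have "distinct \<tau>" using card_length[of \<tau>] by (intro card_distinct) simp
    thus "\<tau> \<in> {\<sigma> \<in> permutations_of_set {..<n}. map a \<sigma> = w}" using t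
      by (auto simp: permutations_of_set_def)
  qed (auto simp: permutations_of_set_def)
  also have "(\<Sum>\<tau>\<in>{\<sigma> \<in> permutations_of_set {..<n}. map a \<sigma> = w}. ?p \<tau>) =
      (\<Sum>\<sigma>\<in>permutations_of_set {..<n}. if map a \<sigma> = w then ?p \<sigma> else 0)"
    by (rule sum.inter_filter) simp
  finally show ?thesis .
qed

text \<open>Each position of a longest word \<open>w0\<close> receives its own new variable, a
  summand of the letter at that position. Only rearrangements of \<open>w0\<close> contribute a part
  multilinear in all of them. The ordering by position keeps the coefficient of \<open>w0\<close>,
  so the result is not trivial.\<close>

lemma multilinear_identity:
  fixes \<kappa> :: "nat list \<Rightarrow> 'a::ring_1"
  assumes Q: "two_sided Q" and W: "finite W" "w0 \<in> W" "\<And>w. w \<in> W \<Longrightarrow> length w \<le> length w0"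
    and id: "\<And>s. (\<Sum>w\<in>W. \<kappa> w * prod_list (map s w)) \<in> Q"
  shows "mlin (\<lambda>\<sigma>. if map ((!) w0) \<sigma> \<in> W then \<kappa> (map ((!) w0) \<sigma>) else 0) {..<length w0} y \<in> Q"
proof -
  let ?n = "length w0"
  let ?a = "(!) w0"
  let ?s = "\<lambda>R k. \<Sum>j\<in>{j \<in> {..<?n} - R. ?a j = k}. y j"
  have cm: "(- 1) ^ k * x = x * (- 1) ^ k" for k and x :: 'a by (cases "even k") simp_all
  have "(\<Sum>R\<in>Pow {..<?n}. (- 1) ^ card R * (\<Sum>w\<in>W. \<kappa> w * prod_list (map (?s R) w))) \<in> Q"
    by (rule asub_sum[OF two_sided_asub[OF Q]], rule two_sided_lmult[OF Q id])
  also have "(\<Sum>R\<in>Pow {..<?n}. (- 1) ^ card R * (\<Sum>w\<in>W. \<kappa> w * prod_list (map (?s R) w))) =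
     (\<Sum>R\<in>Pow {..<?n}. \<Sum>w\<in>W. \<kappa> w * ((- 1) ^ card R * prod_list (map (?s R) w)))"
    by (simp add: sum_distrib_left cm[symmetric] mult.assoc[symmetric])
  also have "\<dots> = (\<Sum>w\<in>W. \<kappa> w * (\<Sum>R\<in>Pow {..<?n}. (- 1) ^ card R * prod_list (map (?s R) w)))"
    by (subst sum.swap) (simp add: sum_distrib_left)
  also have "\<dots> = (\<Sum>w\<in>W. \<kappa> w * (\<Sum>\<sigma>\<in>permutations_of_set {..<?n}.
    if map ?a \<sigma> = w then prod_list (map y \<sigma>) else 0))"
    by (rule sum.cong[OF refl]) (simp only: multilinear_part[OF W(3)])
  also have "\<dots> = (\<Sum>\<sigma>\<in>permutations_of_set {..<?n}. \<Sum>w\<in>W.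
    if map ?a \<sigma> = w then \<kappa> w * prod_list (map y \<sigma>) else 0)"
    by (subst sum.swap) (simp add: sum_distrib_left if_distrib[of "(*) _"] cong: if_cong)
  also have "\<dots> = mlin (\<lambda>\<sigma>. if map ?a \<sigma> \<in> W then \<kappa> (map ?a \<sigma>) else 0) {..<?n} y"
    unfolding mlin_def by (rule sum.cong[OF refl]) (simp add: sum.delta'[OF W(1)])
  finally show ?thesis .
qed

section \<open>Free rings\<close>

text \<open>The free ring on letters of type \<open>'x\<close> is the integral monoid ring of the free monoid. Every
  finitely generated ring is a quotient of it, so quotients become ideals of one type.\<close>

datatype 'x word = Word (letters: "'x list")

instantiation word :: (type) monoid_add
begin

definition zero_word :: "'a word" where "0 = Word []"

definition plus_word :: "'a word \<Rightarrow> 'a word \<Rightarrow> 'a word" where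
  "u + v = Word (letters u @ letters v)"

instance by standard (simp_all add: zero_word_def plus_word_def)

end

type_synonym 'x free_ring = "'x word \<Rightarrow>\<^sub>0 int"

abbreviation monomial :: "'x list \<Rightarrow> 'x free_ring" where
  "monomial xs \<equiv> Poly_Mapping.single (Word xs) 1"

lemma monomial_Nil: "monomial [] = 1"
  by (simp flip: zero_word_def)

lemma monomial_append: "monomial (xs @ ys) = monomial xs * monomial ys"
  by (simp add: mult_single plus_word_def)

lemma free_ring_induct:
  assumes "\<And>w c. Pr (Poly_Mapping.single w c)" "Pr 0" "\<And>p q. Pr p \<Longrightarrow> Pr q \<Longrightarrow> Pr (p + q)"
  shows "Pr (p :: 'y free_ring)"
proof -
  have "Pr (\<Sum>k\<in>F. Poly_Mapping.single k (Poly_Mapping.lookup p k))" if "finite F" for F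
    using that by (induct F) (auto intro: assms)
  thus ?thesis using poly_mapping_sum_single[of p] by (metis finite_keys)
qed

section \<open>Evaluation of the free ring\<close>

context ring
begin

definition eval_word :: "('x \<Rightarrow> 'a) \<Rightarrow> 'x word \<Rightarrow> 'a" where
  "eval_word f w = foldr (\<lambda>x r. f x \<otimes> r) (letters w) \<one>"

definition eval_free :: "('x \<Rightarrow> 'a) \<Rightarrow> 'x free_ring \<Rightarrow> 'a" where
  "eval_free f p = (\<Oplus>w\<in>Poly_Mapping.keys p. add_pow R (Poly_Mapping.lookup p w) (eval_word f w))"

lemma add_pow_zero_int [simp]: "add_pow R (0::int) x = \<zero>"
  by (simp add: add_pow_def)

context
  fixes f :: "'x \<Rightarrow> 'a" assumes f: "\<And>x. f x \<in> carrier R"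
begin

lemma foldr_closed: "foldr (\<lambda>x r. f x \<otimes> r) xs \<one> \<in> carrier R"
  by (induct xs) (simp_all add: f)

lemma eval_word_closed [simp]: "eval_word f w \<in> carrier R"
  unfolding eval_word_def by (rule foldr_closed)

lemma eval_word_plus: "eval_word f (u + v) = eval_word f u \<otimes> eval_word f v"
proof -
  have "foldr (\<lambda>x r. f x \<otimes> r) (xs @ ys) \<one> = foldr (\<lambda>x r. f x \<otimes> r) xs \<one> \<otimes> foldr (\<lambda>x r. f x \<otimes> r) ys \<one>"
    for xs ys
    using foldr_closed by (induct xs) (simp_all add: f m_assoc)
  thus ?thesis by (simp add: eval_word_def plus_word_def)
qed

lemma eval_free_superset:
  assumes "finite F" "Poly_Mapping.keys p \<subseteq> F"
  shows "eval_free f p = (\<Oplus>w\<in>F. add_pow R (Poly_Mapping.lookup p w) (eval_word f w))"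
  unfolding eval_free_def
  by (rule add.finprod_mono_neutral_cong_left[OF assms])
    (auto simp: not_in_keys_iff_lookup_eq_zero)

lemma eval_free_closed [simp]: "eval_free f p \<in> carrier R"
  unfolding eval_free_def by (intro finsum_closed) auto

lemma eval_free_add: "eval_free f (p + q) = eval_free f p \<oplus> eval_free f q"
proof -
  let ?F = "Poly_Mapping.keys p \<union> Poly_Mapping.keys q"
  have fin: "finite ?F" by simp
  have "eval_free f (p + q) = (\<Oplus>w\<in>?F. add_pow R (Poly_Mapping.lookup p w +
    Poly_Mapping.lookup q w) (eval_word f w))"
    using eval_free_superset[OF fin keys_add[of p q]] by (simp add: lookup_add)
  also have "\<dots> = (\<Oplus>w\<in>?F. add_pow R (Poly_Mapping.lookup p w) (eval_word f w) \<oplus> add_pow R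
    (Poly_Mapping.lookup q w) (eval_word f w))"
    by (simp add: add.int_pow_mult)
  also have "\<dots> = (\<Oplus>w\<in>?F. add_pow R (Poly_Mapping.lookup p w) (eval_word f w)) \<oplus> (\<Oplus>w\<in>?F. add_pow R
    (Poly_Mapping.lookup q w) (eval_word f w))"
    by (rule finsum_addf) auto
  finally show ?thesis using eval_free_superset[OF fin] by simp
qed

lemma eval_free_zero [simp]: "eval_free f 0 = \<zero>"
  by (simp add: eval_free_def)

lemma eval_free_single: "eval_free f (Poly_Mapping.single w c) = add_pow R c (eval_word f w)"
  by (cases "c = 0") (simp_all add: eval_free_def)

lemma eval_free_uminus: "eval_free f (- p) = \<ominus> eval_free f p"
  using eval_free_add[of "- p" p] by (simp add: minus_equality)

lemma eval_free_diff: "eval_free f (p - q) = eval_free f p \<ominus> eval_free f q"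
  using eval_free_add[of p "- q"] by (simp add: eval_free_uminus a_minus_def)

lemma eval_free_mult: "eval_free f (p * q) = eval_free f p \<otimes> eval_free f q"
proof (induct p rule: free_ring_induct)
  case (1 u c)
  show ?case
  proof (induct q rule: free_ring_induct)
    case (1 v d)
    have "eval_free f (Poly_Mapping.single u c * Poly_Mapping.single v d) =
        add_pow R (c * d) (eval_word f u \<otimes> eval_word f v)"
      by (simp add: mult_single eval_free_single eval_word_plus)
    also have "\<dots> = add_pow R c (eval_word f u) \<otimes> add_pow R d (eval_word f v)"
      by (simp add: add_pow_ldistr_int add_pow_rdistr_int add.int_pow_pow mult.commute)
    finally show ?case by (simp add: eval_free_single)
  qed (simp_all add: distrib_left eval_free_add r_distr)
qed (simp_all add: distrib_right eval_free_add l_distr)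

lemma eval_free_one: "eval_free f 1 = \<one>"
  unfolding monomial_Nil[symmetric] eval_free_single by (simp add: eval_word_def)

lemma eval_free_sum: "finite F \<Longrightarrow> eval_free f (sum p F) = (\<Oplus>i\<in>F. eval_free f (p i))"
  by (induct F rule: finite_induct) (simp_all add: eval_free_add)

lemma eval_free_kernel: "two_sided {p. eval_free f p = \<zero>}"
  unfolding two_sided_def left_ideal_def additive_subgroup_set_def
  by (simp add: eval_free_add eval_free_uminus eval_free_mult)

lemma eval_free_monomial: "eval_free f (monomial xs) = foldr (\<lambda>x r. f x \<otimes> r) xs \<one>"
  by (simp add: eval_free_single eval_word_def foldr_closed)

lemma eval_free_prod_list:
  "eval_free f (prod_list (map s w)) = foldr (\<lambda>i r. eval_free f (s i) \<otimes> r) w \<one>"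
  by (induct w) (simp_all add: eval_free_mult eval_free_one)

text \<open>The type of letters may be infinite. A letter outside \<open>T\<close> is congruent to 1
  modulo the kernel, so only the letters of \<open>T\<close> count.\<close>

lemma eval_free_generated:
  assumes S: "subring_set S" "{p. eval_free f p = \<zero>} \<subseteq> S" "(\<lambda>x. monomial [x]) ` T \<subseteq> S"
    and T: "\<And>x. x \<notin> T \<Longrightarrow> f x = \<one>"
  shows "S = UNIV"
proof -
  have Sa: "additive_subgroup_set S" and S1: "1 \<in> S" and Sm: "\<And>a b. a \<in> S \<Longrightarrow> b \<in> S \<Longrightarrow> a * b \<in> S"
    using S(1) by (auto simp: subring_set_def)
  have x: "monomial [x] \<in> S" for x
  proof (cases "x \<in> T")
    case True thus ?thesis using S(3) by blast
  next
    case False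
    have "eval_free f (monomial [x] - 1) = \<zero>"
      using T[OF False] by (simp add: eval_free_diff eval_free_monomial eval_free_one a_minus_def
        r_neg)
    hence "monomial [x] - 1 \<in> S" using S(2) by blast
    thus ?thesis using S1 asub_iff[OF Sa] by blast
  qed
  have w: "monomial xs \<in> S" for xs
  proof (induct xs)
    case Nil show ?case using S1 by (simp add: monomial_Nil)
  next
    case (Cons y xs)
    have "monomial ([y] @ xs) \<in> S" unfolding monomial_append by (rule Sm[OF x Cons])
    thus ?case by simp
  qed
  have i: "of_int c \<in> S" for c
  proof (induct c rule: int_induct[of _ 0])
    case base show ?case using asub_zero[OF Sa] by simp
  next
    case (step1 i) thus ?case using asub_add[OF Sa _ S1] by simp
  next
    case (step2 i) thus ?case using asub_diff[OF Sa _ S1] by simp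
  qed
  have "p \<in> S" for p
  proof (induct p rule: free_ring_induct)
    case (1 u c)
    have "of_int c * monomial (letters u) \<in> S" by (rule Sm[OF i w])
    moreover have "of_int c * monomial (letters u) = Poly_Mapping.single u c"
      by (simp add: mult_single flip: single_of_int)
    ultimately show ?case by simp
  qed (simp_all add: asub_zero[OF Sa] asub_add[OF Sa])
  thus ?thesis by blast
qed

end

end

section \<open>From a PI-group to a quotient of the free ring\<close>

theorem theorem2:
  fixes G :: "('g, 'x) monoid_scheme"
  assumes "PI_group TYPE('p) TYPE('a) G"
    and "nil_group G"
  shows "locally_nilpotent G"
proof -
  interpret group G using assms(2) by (simp add: nil_group_def)
  obtain P :: "'p ring" and A :: "('p, 'a) module" and H
    where PA: "PI_algebra P A" "subgroup H (units_of A)" "G \<cong> (units_of A)\<lparr>carrier := H\<rparr>"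
    using assms(1) by (auto simp: PI_group_def)
  have alg: "assoc_algebra P A" using PA(1) by (simp add: PI_algebra_def)
  interpret A: ring A by (rule assoc_algebra.axioms(3)[OF alg])
  interpret P: field P by (rule assoc_algebra.axioms(2)[OF alg])
  interpret M: module P A by (rule assoc_algebra.axioms(1)[OF alg])
  interpret H: subgroup H "units_of A" by (rule PA(2))
  interpret U: group "units_of A" by (rule A.units_group)
  interpret UH: group "(units_of A)\<lparr>carrier := H\<rparr>" by (rule U.subgroup_imp_group[OF PA(2)])
  obtain \<phi> where \<phi>: "\<phi> \<in> iso G ((units_of A)\<lparr>carrier := H\<rparr>)" using PA(3) by (auto simp: is_iso_def)
  interpret h: group_hom G "(units_of A)\<lparr>carrier := H\<rparr>" \<phi>
    using \<phi> by unfold_locales (auto simp: iso_def)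
  have \<phi>c: "\<phi> g \<in> carrier A" if "g \<in> carrier G" for g
    using h.hom_closed[OF that] H.subset by (auto simp: units_of_carrier dest: A.Units_closed)
  have \<phi>m: "\<phi> (g \<otimes>\<^bsub>G\<^esub> k) = \<phi> g \<otimes>\<^bsub>A\<^esub> \<phi> k" if "g \<in> carrier G" "k \<in> carrier G" for g k
    using h.hom_mult[OF that] by (simp add: units_of_mult)
  have \<phi>1: "\<phi> \<one>\<^bsub>G\<^esub> = \<one>\<^bsub>A\<^esub>" using h.hom_one by (simp add: units_of_one)
  have \<phi>inj: "inj_on \<phi> (carrier G)" using \<phi> by (simp add: iso_def bij_betw_def)
  obtain f where f: "f \<in> nc_polys P" "nc_support P f \<noteq> {}"
    "\<And>s. range s \<subseteq> carrier A \<Longrightarrow> nc_eval P A f s = \<zero>\<^bsub>A\<^esub>"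
    using PA(1) by (auto simp: PI_algebra_def)
  define W where "W = nc_support P f"
  have W: "finite W" "W \<noteq> {}" and fc: "f w \<in> carrier P" for w using f
    by (auto simp: nc_polys_def W_def)
  have "Max (length ` W) \<in> length ` W" using W by (intro Max_in) auto
  then obtain w0 where w0: "w0 \<in> W" "length w0 = Max (length ` W)" by auto
  have w0max: "length w \<le> length w0" if "w \<in> W" for w using that W w0(2) by simp
  define c where "c = inv\<^bsub>P\<^esub> (f w0)"
  have "f w0 \<in> Units P" using w0(1) fc[of w0] by (simp add: P.field_Units W_def nc_support_def)
  hence c: "c \<in> carrier P" "c \<otimes>\<^bsub>P\<^esub> f w0 = \<one>\<^bsub>P\<^esub>" by (simp_all add: c_def)
  \<comment> \<open>Scaling by \<open>c\<close> gives the longest word \<open>w0\<close> the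
    coefficient 1. The coefficients are scalar multiples of the unit of \<open>A\<close>, hence
    central.\<close>
  define k where "k w = (c \<otimes>\<^bsub>P\<^esub> f w) \<odot>\<^bsub>A\<^esub> \<one>\<^bsub>A\<^esub>" for w
  have kc: "k w \<in> carrier A" for w using c fc by (simp add: k_def)
  have k0: "k w0 = \<one>\<^bsub>A\<^esub>" by (simp add: k_def c(2))
  have kl: "k w \<otimes>\<^bsub>A\<^esub> x = (c \<otimes>\<^bsub>P\<^esub> f w) \<odot>\<^bsub>A\<^esub> x" "x \<otimes>\<^bsub>A\<^esub> k w = (c \<otimes>\<^bsub>P\<^esub> f w) \<odot>\<^bsub>A\<^esub> x"
    if "x \<in> carrier A" for x w
    using that c fc by (simp_all add: k_def assoc_algebra.smult_mult_left[OF alg]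
      assoc_algebra.smult_mult_right[OF alg])
  have "nilpotent_group (G\<lparr>carrier := generate G S\<rparr>)" if S: "finite S" "S \<subseteq> carrier G" for S
  proof -
    define N where "N = generate G S"
    have N: "subgroup N G" unfolding N_def by (rule generate_is_subgroup[OF S(2)])
    interpret N: subgroup N G by (rule N)
    let ?N = "G\<lparr>carrier := N\<rparr>"
    interpret GN: group ?N by (rule subgroup_imp_group[OF N])
    have SN: "S \<subseteq> N" unfolding N_def by (auto intro: generate.incl)
    \<comment> \<open>Elements of \<open>A\<close> themselves serve as letters. Inverses of the
      generators are included because group elements are to be represented by monomials, and the
      coefficients so that the identity can be stated in the free ring.\<close>
    define T where "T = \<phi> ` S \<union> (\<lambda>s. \<phi> (inv\<^bsub>G\<^esub> s)) ` S \<union> k ` W"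
    have T: "finite T" "T \<subseteq> carrier A" unfolding T_def
      using S W(1) \<phi>c[OF subsetD[OF S(2)]] \<phi>c[OF inv_closed[OF subsetD[OF S(2)]]] kc by auto
    \<comment> \<open>Letters outside \<open>T\<close> evaluate to \<open>1\<close>, so \<open>T\<close> generates the free ring modulo the kernel.\<close>
    define v where "v x = (if x \<in> T then x else \<one>\<^bsub>A\<^esub>)" for x
    have vc: "v x \<in> carrier A" for x using T by (auto simp: v_def)
    note ev = A.eval_free_monomial[of v, OF vc] A.eval_free_mult[of v, OF vc] A.eval_free_diff[of v,
      OF vc]
      A.eval_free_one[of v, OF vc]
    have evc: "A.eval_free v p \<in> carrier A" for p by (rule A.eval_free_closed[of v, OF vc])
    have letter: "A.eval_free v (monomial [x]) = x" if "x \<in> T" for x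
      using that T by (auto simp: ev v_def)
    have ex: "\<exists>xs. A.eval_free v (monomial xs) = \<phi> g" if "g \<in> N" for g
      using that unfolding N_def
    proof (induct g rule: generate.induct)
      case one
      have "A.eval_free v (monomial []) = \<phi> \<one>\<^bsub>G\<^esub>" by (simp add: ev units_of_one)
      thus ?case by blast
    next
      case (incl g) thus ?case using letter[of "\<phi> g"] by (auto simp: T_def)
    next
      case (inv g) thus ?case using letter[of "\<phi> (inv\<^bsub>G\<^esub> g)"] by (auto simp: T_def)
    next
      case (eng g1 g2)
      then obtain xs ys where xy: "A.eval_free v (monomial xs) = \<phi> g1"
        "A.eval_free v (monomial ys) = \<phi> g2" by blast
      have "g1 \<in> carrier G" "g2 \<in> carrier G" using eng S(2) generate_in_carrier by auto
      hence "A.eval_free v (monomial (xs @ ys)) = \<phi> (g1 \<otimes>\<^bsub>G\<^esub> g2)"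
        unfolding monomial_append using xy by (simp only: ev(2) \<phi>m)
      thus ?case by blast
    qed
    \<comment> \<open>A monomial is chosen for each group element; the choice respects products only
      modulo \<open>Q0\<close>, which is all that \<open>pi_rep\<close> asks.\<close>
    define \<rho> where "\<rho> g = monomial (SOME xs. A.eval_free v (monomial xs) = \<phi> g)" for g
    have \<rho>: "A.eval_free v (\<rho> g) = \<phi> g" if "g \<in> N" for g
      unfolding \<rho>_def using ex[OF that] by (rule someI_ex)
    define Q0 where "Q0 = {p. A.eval_free v p = \<zero>\<^bsub>A\<^esub>}"
    have Q0: "two_sided Q0" unfolding Q0_def by (rule A.eval_free_kernel[of v, OF vc])
    \<comment> \<open>The coefficient of \<open>w0\<close> must be 1 itself and not merely congruent
      to 1, so the letter \<open>k w0\<close> is avoided.\<close>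
    define \<kappa> where "\<kappa> w = (if w = w0 then 1 else monomial [k w])" for w
    have \<kappa>: "A.eval_free v (\<kappa> w) = k w" if "w \<in> W" for w
      using that letter[of "k w"] by (auto simp: \<kappa>_def ev(4) k0 T_def)
    have id: "(\<Sum>w\<in>W. \<kappa> w * prod_list (map s w)) \<in> Q0" for s
    proof -
      define m where "m w = nc_monom_eval A (\<lambda>i. A.eval_free v (s i)) w" for w
      have mc: "m w \<in> carrier A" for w
        unfolding m_def nc_monom_eval_def by (induct w) (simp_all add: evc)
      have "A.eval_free v (\<Sum>w\<in>W. \<kappa> w * prod_list (map s w)) =
          (\<Oplus>\<^bsub>A\<^esub>w\<in>W. A.eval_free v (\<kappa> w * prod_list (map s w)))"
        by (rule A.eval_free_sum[of v, OF vc W(1)])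
      also have "\<dots> = (\<Oplus>\<^bsub>A\<^esub>w\<in>W. c \<odot>\<^bsub>A\<^esub> (f w \<odot>\<^bsub>A\<^esub> m w))"
      proof (rule A.finsum_cong')
        show "(\<lambda>w. c \<odot>\<^bsub>A\<^esub> (f w \<odot>\<^bsub>A\<^esub> m w)) \<in> W \<rightarrow> carrier A" using c fc mc by auto
        fix w assume w: "w \<in> W"
        have "A.eval_free v (prod_list (map s w)) = m w"
          unfolding m_def nc_monom_eval_def by (rule A.eval_free_prod_list[of v, OF vc])
        thus "A.eval_free v (\<kappa> w * prod_list (map s w)) = c \<odot>\<^bsub>A\<^esub> (f w \<odot>\<^bsub>A\<^esub> m w)"
          using \<kappa>[OF w] kl(1)[OF mc] c(1) fc mc by (simp add: ev(2) M.smult_assoc1)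
      qed simp
      also have "\<dots> = c \<odot>\<^bsub>A\<^esub> (\<Oplus>\<^bsub>A\<^esub>w\<in>W. f w \<odot>\<^bsub>A\<^esub> m w)"
        by (rule M.finsum_smult_ldistr[symmetric]) (use W c fc mc in auto)
      also have "(\<Oplus>\<^bsub>A\<^esub>w\<in>W. f w \<odot>\<^bsub>A\<^esub> m w) = nc_eval P A f (\<lambda>i. A.eval_free v (s i))"
        by (simp add: nc_eval_def W_def m_def)
      also have "\<dots> = \<zero>\<^bsub>A\<^esub>" by (rule f(3)) (use evc in auto)
      finally show ?thesis using c(1) by (simp add: Q0_def)
    qed
    define n where "n = length w0"
    define \<gamma> where "\<gamma> = (\<lambda>\<sigma>. if map ((!) w0) \<sigma> \<in> W then \<kappa> (map ((!) w0) \<sigma>) else 0)"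
    have \<gamma>0: "\<gamma> [0..<n] = 1" using w0(1) by (simp add: \<gamma>_def n_def map_nth \<kappa>_def)
    have cen: "\<gamma> \<sigma> * b - b * \<gamma> \<sigma> \<in> Q0" for \<sigma> b
    proof (cases "map ((!) w0) \<sigma> \<in> W")
      case True
      have "A.eval_free v (\<kappa> w * b - b * \<kappa> w) = \<zero>\<^bsub>A\<^esub>" if w: "w \<in> W" for w
        using \<kappa>[OF w] kl[OF evc] c(1) fc evc by (simp add: ev(2,3) a_minus_def A.r_neg)
      thus ?thesis using True by (simp add: \<gamma>_def Q0_def)
    next
      case False
      thus ?thesis using asub_zero[OF two_sided_asub[OF Q0]] by (simp add: \<gamma>_def)
    qed
    interpret pi_rep ?N S \<rho> Q0 "(\<lambda>x. monomial [x]) ` T" \<gamma> "{..<n}" "[0..<n]"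
    proof unfold_locales
      show "\<exists>n. engel ?N n a b = \<one>\<^bsub>?N\<^esub>" if "a \<in> carrier ?N" "b \<in> carrier ?N" for a b
      proof -
        have ab: "a \<in> N" "b \<in> N" using that by auto
        hence "\<exists>n\<ge>1. engel G n a b = \<one>\<^bsub>G\<^esub>" using assms(2) by (simp add: nil_group_def nil_element_def)
        thus ?thesis using engel_subgroup_eq[OF N ab] by auto
      qed
      show "finite S" "S \<subseteq> carrier ?N" using S(1) SN by auto
      show "generate ?N S = carrier ?N" using generate_consistent[OF SN N] by (simp add: N_def)
      show "two_sided Q0" by (rule Q0)
      show "\<rho> (g \<otimes>\<^bsub>?N\<^esub> h) - \<rho> g * \<rho> h \<in> Q0" if "g \<in> carrier ?N" "h \<in> carrier ?N" for g h
      proof -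
        have gh: "g \<in> N" "h \<in> N" "g \<otimes>\<^bsub>G\<^esub> h \<in> N" using that by auto
        have "A.eval_free v (\<rho> (g \<otimes>\<^bsub>G\<^esub> h) - \<rho> g * \<rho> h) = \<phi> (g \<otimes>\<^bsub>G\<^esub> h) \<ominus>\<^bsub>A\<^esub> \<phi> g \<otimes>\<^bsub>A\<^esub> \<phi> h"
          by (simp only: ev(2,3) \<rho> gh)
        also have "\<dots> = \<zero>\<^bsub>A\<^esub>" using \<phi>m[of g h] \<phi>c[of "g \<otimes>\<^bsub>G\<^esub> h"] gh by (simp add: a_minus_def A.r_neg)
        finally show ?thesis by (simp add: Q0_def)
      qed
      show "\<rho> \<one>\<^bsub>?N\<^esub> - 1 \<in> Q0" by (simp add: Q0_def ev(3,4) \<rho> units_of_one a_minus_def A.r_neg)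
      show "finite ((\<lambda>x. monomial [x]) ` T)" using T(1) by simp
      show "Z = UNIV" if "subring_set Z" "(\<lambda>x. monomial [x]) ` T \<subseteq> Z" "Q0 \<subseteq> Z" for Z
        by (rule A.eval_free_generated[of v, OF vc that(1) _ that(2)]) (use that(3) in \<open>auto simp:
          Q0_def v_def\<close>)
      show "finite {..<n}" by simp
      show "[0..<n] \<in> permutations_of_set {..<n}" by (auto simp: permutations_of_set_def)
      show "\<gamma> [0..<n] = 1" by (rule \<gamma>0)
      show "\<gamma> \<sigma> * b - b * \<gamma> \<sigma> \<in> Q0" for \<sigma> b by (rule cen)
      show "mlin \<gamma> {..<n} x \<in> Q0" for x
        unfolding \<gamma>_def n_def by (rule multilinear_identity[OF Q0 W(1) w0(1) w0max id])
    qed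
    obtain m where m: "lower_central ?N m \<subseteq> kernel_mod Q0" using nilpotent_mod by blast
    \<comment> \<open>Congruence to 1 modulo \<open>Q0\<close> means evaluation to 1 in
      \<open>A\<close>, and \<phi> is injective; so nilpotency modulo \<open>Q0\<close> is
      nilpotency.\<close>
    have "kernel_mod Q0 \<subseteq> {\<one>\<^bsub>?N\<^esub>}"
    proof
      fix g assume "g \<in> kernel_mod Q0"
      hence g: "g \<in> N" "\<rho> g - 1 \<in> Q0" by (auto simp: kernel_mod_def)
      have gc: "g \<in> carrier G" using g(1) by simp
      have "\<phi> g \<ominus>\<^bsub>A\<^esub> \<one>\<^bsub>A\<^esub> = \<zero>\<^bsub>A\<^esub>" using g \<rho>[OF g(1)] by (simp add: Q0_def ev(3,4))
      hence "\<phi> g = \<phi> \<one>\<^bsub>G\<^esub>" using \<phi>c[OF gc] \<phi>1 by simp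
      hence "g = \<one>\<^bsub>G\<^esub>" using inj_onD[OF \<phi>inj _ gc one_closed] by blast
      thus "g \<in> {\<one>\<^bsub>?N\<^esub>}" by simp
    qed
    moreover have "\<one>\<^bsub>?N\<^esub> \<in> lower_central ?N m"
      using GN.lower_central_normal[of m] by (meson normal_imp_subgroup subgroup.one_closed)
    ultimately have "lower_central ?N m = {\<one>\<^bsub>?N\<^esub>}" using m by blast
    thus ?thesis unfolding N_def[symmetric] nilpotent_group_def using GN.group_axioms by blast
  qed
  thus ?thesis unfolding locally_nilpotent_def using group_axioms by blast
qed

end
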